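(* Let $\mathfrak{g}$ be a type-A seaweed or a type-C seaweed (over $\mathbb{C}$). Then $\mathfrak{g}$ is contact if and only if $\operatorname{ind}\mathfrak{g}=1$.
   Context: All Lie algebras are over $\mathbb{C}$. **Index.** For a finite-dimensional Lie algebra $\mathfrak{g}$ and $\varphi\in\mathfrak{g}^*$, let $B_\varphi(x,y)=\varphi([x,y])$ be the Kirillov form. The index is $\operatorname{ind}\mathfrak{g}=\min_{\varphi\in\mathfrak{g}^*}\dim\ker(B_\varphi)$. **Contact.** A Lie algebra $\mathfrak{g}$ of odd dimension $2k+1$ is contact if there is $\varphi\in\mathfrak{g}^*$ with $\varphi\wedge(d\varphi)^k\neq 0$, where $d\varphi(x,y)=-\varphi([x,y])$. (Contact Lie algebras are by definition odd-dimensional.) **Type-A seaweed.** Let $n\ge 1$ and let $\underline a=(a_1,\dots,a_m)$, $\underline b=(b_1,\dots,b_t)$ be compositions of $n$ (sequences of positive integers with sum $n$). Let $X_{\underline a}$ be the space of block-diagonal $n\times n$ matrices with consecutive diagonal blocks of sizes $a_1\times a_1,\dots,a_m\times a_m$, and define $X_{\underline b}$ similarly. A position $(i,j)$ is admissible if $i\ge j$ and $(i,j)$ lies in a block of $X_{\underline a}$, or $i\le j$ and $(i,j)$ lies in a block of $X_{\underline b}$. The type-A seaweed defined by $\underline a,\underline b$ is the Lie subalgebra of $\mathfrak{sl}(n)$ consisting of all trace-zero matrices whose entries vanish at all non-admissible positions. **Type-C seaweed.** Let $n\ge1$. Realize $\mathfrak{sp}(2n)$ as the span in $M_{2n}(\mathbb{C})$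 of the matrices: $e_{i,j}-e_{2n-j+1,2n-i+1}$ for $1\le i,j\le n$; $e_{i,j}$ for $i+j=2n+1$; and $e_{i,j}+e_{2n-j+1,2n-i+1}$ for $i+j<2n+1$ with either $i\le n<j$ or $j\le n<i$. Let $\underline a=(a_1,\dots,a_m)$ and $\underline b=(b_1,\dots,b_t)$ be partial compositions of $n$, i.e. (possibly empty) sequences of positive integers with $\sum a_i\le n$ and $\sum b_i\le n$. Let $X_{\underline a}$ be the space of block-diagonal $2n\times 2n$ matrices with consecutive diagonal blocks of sizes $a_1,\dots,a_m,\,2(n-\sum a_i),\,a_m,\dots,a_1$ (the middle block omitted if its size is $0$), and similarly $X_{\underline b}$. Position $(i,j)$ is admissible if $i\ge j$ and $(i,j)$ lies in a block of $X_{\underline a}$, or $i\le j$ and $(i,j)$ lies in a block of $X_{\underline b}$. The type-C seaweed $\mathfrak{p}_{2n}^C\frac{a_1|\dots|a_m}{b_1|\dots|b_t}$ is the Lie subalgebra of $\mathfrak{sp}(2n)$ of all matrices in $\mathfrak{sp}(2n)$ whose entries vanish at all non-admissible positions. *)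

theory Defs
  imports
    Complex_Main
    "HOL-Library.Function_Algebras"
    "HOL-Combinatorics.Permutations"
begin

section \<open>Finite-dimensional complex Lie algebras\<close>

text \<open>
  The carrier is a subspace of an ambient type of class \<^class>\<open>ab_group_add\<close>, so that
  \<^const>\<open>vector_space.dim\<close> and \<^const>\<open>module.span\<close> apply to it.
\<close>

record 'a lie_structure =
  lie_carrier :: "'a set"
  lie_scale :: "complex \<Rightarrow> 'a \<Rightarrow> 'a"
  lie_bracket :: "'a \<Rightarrow> 'a \<Rightarrow> 'a"

locale lie_algebra =
  fixes L :: "'a::ab_group_add lie_structure"
  assumes vector_space: "vector_space (lie_scale L)"
    and fin_dim: "\<exists>B. finite B \<and> lie_carrier L = module.span (lie_scale L) B"
    and bracket_closed:
      "\<lbrakk>x \<in> lie_carrier L; y \<in> lie_carrier L\<rbrakk> \<Longrightarrow> lie_bracket L x y \<in> lie_carrier L"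
    and bracket_add_left:
      "\<lbrakk>x \<in> lie_carrier L; y \<in> lie_carrier L; z \<in> lie_carrier L\<rbrakk> \<Longrightarrow>
        lie_bracket L (x + y) z = lie_bracket L x z + lie_bracket L y z"
    and bracket_add_right:
      "\<lbrakk>x \<in> lie_carrier L; y \<in> lie_carrier L; z \<in> lie_carrier L\<rbrakk> \<Longrightarrow>
        lie_bracket L x (y + z) = lie_bracket L x y + lie_bracket L x z"
    and bracket_scale_left:
      "\<lbrakk>x \<in> lie_carrier L; y \<in> lie_carrier L\<rbrakk> \<Longrightarrow>
        lie_bracket L (lie_scale L c x) y = lie_scale L c (lie_bracket L x y)"
    and bracket_scale_right:
      "\<lbrakk>x \<in> lie_carrier L; y \<in> lie_carrier L\<rbrakk> \<Longrightarrow>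
        lie_bracket L x (lie_scale L c y) = lie_scale L c (lie_bracket L x y)"
    and bracket_alternating: "x \<in> lie_carrier L \<Longrightarrow> lie_bracket L x x = 0"
    and jacobi:
      "\<lbrakk>x \<in> lie_carrier L; y \<in> lie_carrier L; z \<in> lie_carrier L\<rbrakk> \<Longrightarrow>
        lie_bracket L x (lie_bracket L y z) + lie_bracket L y (lie_bracket L z x)
          + lie_bracket L z (lie_bracket L x y) = 0"

definition lie_dim :: "'a::ab_group_add lie_structure \<Rightarrow> nat" where
  "lie_dim L = vector_space.dim (lie_scale L) (lie_carrier L)"

text \<open>
  Linear functionals on the carrier. The values off the carrier are unconstrained, and no
  definition below depends on them.
\<close>

definition lie_dual :: "'a::ab_group_add lie_structure \<Rightarrow> ('a \<Rightarrow> complex) set" where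
  "lie_dual L = {\<phi>.
     (\<forall>x\<in>lie_carrier L. \<forall>y\<in>lie_carrier L. \<phi> (x + y) = \<phi> x + \<phi> y) \<and>
     (\<forall>c. \<forall>x\<in>lie_carrier L. \<phi> (lie_scale L c x) = c * \<phi> x)}"

definition kirillov_form ::
    "'a lie_structure \<Rightarrow> ('a \<Rightarrow> complex) \<Rightarrow> 'a \<Rightarrow> 'a \<Rightarrow> complex" where
  "kirillov_form L \<phi> x y = \<phi> (lie_bracket L x y)"

definition kirillov_kernel :: "'a lie_structure \<Rightarrow> ('a \<Rightarrow> complex) \<Rightarrow> 'a set" where
  "kirillov_kernel L \<phi> = {x \<in> lie_carrier L. \<forall>y\<in>lie_carrier L. kirillov_form L \<phi> x y = 0}"

definition lie_index :: "'a::ab_group_add lie_structure \<Rightarrow> nat" where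
  "lie_index L =
     (LEAST d. \<exists>\<phi>\<in>lie_dual L. d = vector_space.dim (lie_scale L) (kirillov_kernel L \<phi>))"


section \<open>Exterior forms and contact Lie algebras\<close>

text \<open>
  A \<open>p\<close>-form is a function on argument sequences \<open>x 0, \<dots>, x (p - 1)\<close>; the later entries
  of the sequence are ignored.
\<close>

type_synonym 'a form = "(nat \<Rightarrow> 'a) \<Rightarrow> complex"

definition wedge :: "nat \<Rightarrow> nat \<Rightarrow> 'a form \<Rightarrow> 'a form \<Rightarrow> 'a form" where
  "wedge p q \<alpha> \<beta> x =
     (\<Sum>\<sigma> | \<sigma> permutes {..<p + q}.
        of_int (sign \<sigma>) * \<alpha> (\<lambda>i. x (\<sigma> i)) * \<beta> (\<lambda>i. x (\<sigma> (p + i)))) / (fact p * fact q)"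

primrec wedge_power :: "nat \<Rightarrow> 'a form \<Rightarrow> nat \<Rightarrow> 'a form" where
  "wedge_power p \<alpha> 0 = (\<lambda>x. 1)"
| "wedge_power p \<alpha> (Suc k) = wedge p (p * k) \<alpha> (wedge_power p \<alpha> k)"

definition one_form :: "('a \<Rightarrow> complex) \<Rightarrow> 'a form" where
  "one_form \<phi> x = \<phi> (x 0)"

definition lie_differential :: "'a lie_structure \<Rightarrow> ('a \<Rightarrow> complex) \<Rightarrow> 'a form" where
  "lie_differential L \<phi> x = - \<phi> (lie_bracket L (x 0) (x 1))"

definition nonzero_form :: "'a lie_structure \<Rightarrow> nat \<Rightarrow> 'a form \<Rightarrow> bool" where
  "nonzero_form L p \<alpha> \<longleftrightarrow> (\<exists>x. (\<forall>i<p. x i \<in> lie_carrier L) \<and> \<alpha> x \<noteq> 0)"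

definition contact :: "'a::ab_group_add lie_structure \<Rightarrow> bool" where
  "contact L \<longleftrightarrow> (\<exists>k. lie_dim L = 2 * k + 1 \<and>
     (\<exists>\<phi>\<in>lie_dual L. nonzero_form L (2 * k + 1)
        (wedge 1 (2 * k) (one_form \<phi>) (wedge_power 2 (lie_differential L \<phi>) k))))"


section \<open>Matrix Lie algebras\<close>

text \<open>
  An \<open>N \<times> N\<close> matrix is a function on index pairs that vanishes outside \<open>{1..N} \<times> {1..N}\<close>.
  Addition is the pointwise one. Note that \<open>*\<close> on this type is pointwise as well and is
  not used; the matrix product is \<open>mat_prod N\<close>.
\<close>

type_synonym cmat = "nat \<Rightarrow> nat \<Rightarrow> complex"

definition mat_scale :: "complex \<Rightarrow> cmat \<Rightarrow> cmat" where
  "mat_scale c x = (\<lambda>i j. c * x i j)"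

definition mat_prod :: "nat \<Rightarrow> cmat \<Rightarrow> cmat \<Rightarrow> cmat" where
  "mat_prod N x y = (\<lambda>i j. \<Sum>k=1..N. x i k * y k j)"

definition mat_commutator :: "nat \<Rightarrow> cmat \<Rightarrow> cmat \<Rightarrow> cmat" where
  "mat_commutator N x y = mat_prod N x y - mat_prod N y x"

definition mat_trace :: "nat \<Rightarrow> cmat \<Rightarrow> complex" where
  "mat_trace N x = (\<Sum>i=1..N. x i i)"

definition mat_unit :: "nat \<Rightarrow> nat \<Rightarrow> cmat" where
  "mat_unit i j = (\<lambda>r s. if r = i \<and> s = j then 1 else 0)"

definition gl_space :: "nat \<Rightarrow> cmat set" where
  "gl_space N = {x. \<forall>i j. x i j \<noteq> 0 \<longrightarrow> i \<in> {1..N} \<and> j \<in> {1..N}}"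

definition sl_space :: "nat \<Rightarrow> cmat set" where
  "sl_space N = {x \<in> gl_space N. mat_trace N x = 0}"

definition sp_generators :: "nat \<Rightarrow> cmat set" where
  "sp_generators n =
     {mat_unit i j - mat_unit (2 * n - j + 1) (2 * n - i + 1) | i j.
        i \<in> {1..n} \<and> j \<in> {1..n}} \<union>
     {mat_unit i j | i j. i \<in> {1..2 * n} \<and> j \<in> {1..2 * n} \<and> i + j = 2 * n + 1} \<union>
     {mat_unit i j + mat_unit (2 * n - j + 1) (2 * n - i + 1) | i j.
        i \<in> {1..2 * n} \<and> j \<in> {1..2 * n} \<and> i + j < 2 * n + 1 \<and>
        (i \<le> n \<and> n < j \<or> j \<le> n \<and> n < i)}"

definition sp_space :: "nat \<Rightarrow> cmat set" where
  "sp_space n = module.span mat_scale (sp_generators n)"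

definition mat_lie :: "nat \<Rightarrow> cmat set \<Rightarrow> cmat lie_structure" where
  "mat_lie N S =
     \<lparr>lie_carrier = S, lie_scale = mat_scale, lie_bracket = mat_commutator N\<rparr>"


section \<open>Seaweeds\<close>

definition composition :: "nat \<Rightarrow> nat list \<Rightarrow> bool" where
  "composition n a \<longleftrightarrow> (\<forall>k\<in>set a. 0 < k) \<and> sum_list a = n"

definition partial_composition :: "nat \<Rightarrow> nat list \<Rightarrow> bool" where
  "partial_composition n a \<longleftrightarrow> (\<forall>k\<in>set a. 0 < k) \<and> sum_list a \<le> n"

text \<open>
  The position \<open>(i, j)\<close> lies in one of the consecutive diagonal blocks with sizes listed
  in \<open>c\<close>.
\<close>

definition in_block :: "nat list \<Rightarrow> nat \<Rightarrow> nat \<Rightarrow> bool" where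
  "in_block c i j \<longleftrightarrow> (\<exists>k<length c.
     i \<in> {sum_list (take k c)<..sum_list (take (Suc k) c)} \<and>
     j \<in> {sum_list (take k c)<..sum_list (take (Suc k) c)})"

definition admissible :: "nat list \<Rightarrow> nat list \<Rightarrow> nat \<Rightarrow> nat \<Rightarrow> bool" where
  "admissible c d i j \<longleftrightarrow> i \<ge> j \<and> in_block c i j \<or> i \<le> j \<and> in_block d i j"

definition symmetric_blocks :: "nat \<Rightarrow> nat list \<Rightarrow> nat list" where
  "symmetric_blocks n a =
     a @ (if sum_list a = n then [] else [2 * (n - sum_list a)]) @ rev a"

definition seaweed_A :: "nat \<Rightarrow> nat list \<Rightarrow> nat list \<Rightarrow> cmat lie_structure" where
  "seaweed_A n a b =
     mat_lie n {x \<in> sl_space n. \<forall>i\<in>{1..n}. \<forall>j\<in>{1..n}. \<not> admissible a b i j \<longrightarrow> x i j = 0}"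

definition seaweed_C :: "nat \<Rightarrow> nat list \<Rightarrow> nat list \<Rightarrow> cmat lie_structure" where
  "seaweed_C n a b =
     mat_lie (2 * n) {x \<in> sp_space n. \<forall>i\<in>{1..2 * n}. \<forall>j\<in>{1..2 * n}.
       \<not> admissible (symmetric_blocks n a) (symmetric_blocks n b) i j \<longrightarrow> x i j = 0}"

definition type_A_seaweed :: "cmat lie_structure \<Rightarrow> bool" where
  "type_A_seaweed L \<longleftrightarrow>
     (\<exists>n a b. 1 \<le> n \<and> composition n a \<and> composition n b \<and> L = seaweed_A n a b)"

definition type_C_seaweed :: "cmat lie_structure \<Rightarrow> bool" where
  "type_C_seaweed L \<longleftrightarrow>
     (\<exists>n a b. 1 \<le> n \<and> partial_composition n a \<and> partial_composition n b \<and> L = seaweed_C n a b)"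


section \<open>Seaweeds are Lie algebras\<close>

interpretation mat: vector_space mat_scale
  by unfold_locales (auto simp: mat_scale_def fun_eq_iff algebra_simps)

lemma mat_simps:
  "mat_scale c x i j = c * x i j"
  "mat_commutator N x y i j = (\<Sum>k=1..N. x i k * y k j) - (\<Sum>k=1..N. y i k * x k j)"
  by (simp_all add: mat_scale_def mat_commutator_def mat_prod_def)

lemma sum_fun_apply: "(\<Sum>k\<in>A. f k) i j = (\<Sum>k\<in>A. f k i j)" for f :: "'k \<Rightarrow> cmat"
  by (induction A rule: infinite_finite_induct) auto

lemma mat_prod_simps:
  "mat_prod N (x + y) z = mat_prod N x z + mat_prod N y z"
  "mat_prod N x (y + z) = mat_prod N x y + mat_prod N x z"
  "mat_prod N (x - y) z = mat_prod N x z - mat_prod N y z"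
  "mat_prod N x (y - z) = mat_prod N x y - mat_prod N x z"
  "mat_prod N (mat_scale c x) y = mat_scale c (mat_prod N x y)"
  "mat_prod N x (mat_scale c y) = mat_scale c (mat_prod N x y)"
  by (auto simp: mat_prod_def mat_scale_def fun_eq_iff algebra_simps sum.distrib
      sum_subtractf sum_distrib_left)

lemma mat_prod_assoc: "mat_prod N (mat_prod N x y) z = mat_prod N x (mat_prod N y z)"
proof (intro ext)
  fix i j
  have "mat_prod N (mat_prod N x y) z i j = (\<Sum>k=1..N. \<Sum>l=1..N. x i l * y l k * z k j)"
    by (simp add: mat_prod_def sum_distrib_right)
  also have "\<dots> = (\<Sum>l=1..N. \<Sum>k=1..N. x i l * y l k * z k j)"
    by (rule sum.swap)
  also have "\<dots> = mat_prod N x (mat_prod N y z) i j"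
    by (simp add: mat_prod_def sum_distrib_left mult.assoc)
  finally show "mat_prod N (mat_prod N x y) z i j = mat_prod N x (mat_prod N y z) i j" .
qed

lemma gl_space_expand:
  assumes "x \<in> gl_space N"
  shows "x = (\<Sum>(i, j)\<in>{1..N} \<times> {1..N}. mat_scale (x i j) (mat_unit i j))"
proof (intro ext)
  fix r s
  have "(\<Sum>p\<in>{1..N} \<times> {1..N}. mat_scale (x (fst p) (snd p)) (mat_unit (fst p) (snd p))) r s
      = (\<Sum>p\<in>{1..N} \<times> {1..N}. if p = (r, s) then x r s else 0)"
    unfolding sum_fun_apply
    by (rule sum.cong) (auto simp: mat_scale_def mat_unit_def)
  also have "\<dots> = x r s"
    using assms by (auto simp: gl_space_def)
  finally show "x r s = (\<Sum>(i, j)\<in>{1..N} \<times> {1..N}. mat_scale (x i j) (mat_unit i j)) r s"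
    by (simp add: case_prod_beta)
qed

lemma finite_span_of_subspace:
  assumes "mat.subspace S" "S \<subseteq> gl_space N"
  shows "\<exists>B. finite B \<and> S = mat.span B"
proof -
  let ?U = "(\<lambda>(i, j). mat_unit i j) ` ({1..N} \<times> {1..N})"
  have gl: "gl_space N \<subseteq> mat.span ?U"
  proof
    fix x assume x: "x \<in> gl_space N"
    have "(\<Sum>(i, j)\<in>{1..N} \<times> {1..N}. mat_scale (x i j) (mat_unit i j)) \<in> mat.span ?U"
      by (rule mat.span_sum, clarify) (intro mat.span_scale mat.span_base, auto)
    then show "x \<in> mat.span ?U"
      by (subst gl_space_expand[OF x])
  qed
  obtain B where B: "B \<subseteq> S" "mat.independent B" "S \<subseteq> mat.span B"
    using mat.maximal_independent_subset by blast
  have "B \<subseteq> mat.span ?U" using B(1) assms(2) gl by (rule order_trans[OF order_trans])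
  then have "finite B"
    using mat.independent_span_bound[OF _ B(2), of ?U] by simp
  moreover have "mat.span B = S"
    by (rule equalityI[OF mat.span_minimal[OF B(1) assms(1)] B(3)])
  ultimately show ?thesis by metis
qed

lemma mat_lie_is_lie_algebra:
  assumes "mat.subspace S" "S \<subseteq> gl_space N"
    and "\<And>x y. \<lbrakk>x \<in> S; y \<in> S\<rbrakk> \<Longrightarrow> mat_commutator N x y \<in> S"
  shows "lie_algebra (mat_lie N S)"
proof (rule lie_algebra.intro)
  show "vector_space (lie_scale (mat_lie N S))"
    using mat.vector_space_axioms by (simp add: mat_lie_def)
  show "\<exists>B. finite B \<and> lie_carrier (mat_lie N S) = module.span (lie_scale (mat_lie N S)) B"
    using finite_span_of_subspace[OF assms(1,2)] by (simp add: mat_lie_def)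
qed (use assms(3) in \<open>simp_all add: mat_lie_def mat_commutator_def mat_prod_simps
  mat_prod_assoc mat.scale_right_diff_distrib\<close>)

lemma in_block_trans: "\<lbrakk>in_block c i k; in_block c k j\<rbrakk> \<Longrightarrow> in_block c i j"
proof -
  have unique: "p = q" if "k \<in> {sum_list (take p c)<..sum_list (take (Suc p) c)}"
    "k \<in> {sum_list (take q c)<..sum_list (take (Suc q) c)}" for p q
  proof (rule ccontr)
    have mono: "sum_list (take u c) \<le> sum_list (take v c)" if "u \<le> v" for u v
      using that by (metis le_add1 le_add_diff_inverse sum_list_append take_add)
    assume "p \<noteq> q"
    then have "Suc p \<le> q \<or> Suc q \<le> p" by linarith
    then show False
      using that mono[of "Suc p" q] mono[of "Suc q" p] by auto
  qed
  assume "in_block c i k" "in_block c k j"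
  then show ?thesis
    unfolding in_block_def using unique by metis
qed

lemma in_block_sym: "in_block c i j \<Longrightarrow> in_block c j i"
  by (auto simp: in_block_def)

lemma in_block_between:
  assumes "in_block c i j" "min i j \<le> k" "k \<le> max i j"
  shows "in_block c i k" "in_block c k j"
  using assms unfolding in_block_def min_def max_def
  by (auto split: if_splits intro: le_less_trans less_le_trans order_trans)

lemma admissible_trans:
  assumes "admissible c d i k" "admissible c d k j"
  shows "admissible c d i j"
proof -
  consider "i \<ge> k" "k \<ge> j" "in_block c i k" "in_block c k j"
    | "i \<le> k" "k \<le> j" "in_block d i k" "in_block d k j"
    | "i \<ge> k" "k \<le> j" "in_block c i k" "in_block d k j"
    | "i \<le> k" "k \<ge> j" "in_block d i k" "in_block c k j"
    using assms unfolding admissible_def by blast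
  then show ?thesis
  proof cases
    case 1
    then have "in_block c i j" using in_block_trans by blast
    with 1 show ?thesis by (simp add: admissible_def)
  next
    case 2
    then have "in_block d i j" using in_block_trans by blast
    with 2 show ?thesis by (simp add: admissible_def)
  next
    case 3
    then show ?thesis unfolding admissible_def
      using in_block_between[of c i k j] in_block_between[of d k j i] by (cases "i \<ge> j") auto
  next
    case 4
    then show ?thesis unfolding admissible_def
      using in_block_between[of d i k j] in_block_between[of c k j i] by (cases "i \<ge> j") auto
  qed
qed

definition admissible_space :: "nat \<Rightarrow> nat list \<Rightarrow> nat list \<Rightarrow> cmat set" where
  "admissible_space N c d =
     {x. \<forall>i\<in>{1..N}. \<forall>j\<in>{1..N}. \<not> admissible c d i j \<longrightarrow> x i j = 0}"

lemma subspace_admissible: "mat.subspace (admissible_space N c d)"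
  by (rule mat.subspaceI) (auto simp: admissible_space_def mat_scale_def)

lemma commutator_admissible:
  assumes "x \<in> admissible_space N c d" "y \<in> admissible_space N c d"
  shows "mat_commutator N x y \<in> admissible_space N c d"
proof -
  have "(\<Sum>k=1..N. u i k * v k j) = 0"
    if "u \<in> admissible_space N c d" "v \<in> admissible_space N c d"
      "i \<in> {1..N}" "j \<in> {1..N}" "\<not> admissible c d i j" for u v i j
  proof (rule sum.neutral, rule ballI)
    fix k assume "k \<in> {1..N}"
    moreover have "\<not> admissible c d i k \<or> \<not> admissible c d k j"
      using that(5) admissible_trans by blast
    ultimately show "u i k * v k j = 0"
      using that(1-4) by (auto simp: admissible_space_def)
  qed
  then show ?thesis
    using assms by (auto simp: admissible_space_def mat_simps)
qed

lemma subspace_gl: "mat.subspace (gl_space N)"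
  by (rule mat.subspaceI)
    (auto simp: gl_space_def mat_scale_def simp del: neq0_conv, (metis add_0)+)

lemma commutator_gl:
  assumes "x \<in> gl_space N" "y \<in> gl_space N"
  shows "mat_commutator N x y \<in> gl_space N"
proof -
  have *: "i \<in> {1..N} \<and> j \<in> {1..N}"
    if uv: "u \<in> gl_space N" "v \<in> gl_space N" and nz: "(\<Sum>k=1..N. u i k * v k j) \<noteq> 0" for u v i j
  proof -
    from nz obtain k where "u i k * v k j \<noteq> 0" by (rule sum.not_neutral_contains_not_neutral)
    then show ?thesis using uv by (auto simp: gl_space_def)
  qed
  show ?thesis
    unfolding gl_space_def
  proof (rule CollectI, intro allI impI)
    fix i j assume "mat_commutator N x y i j \<noteq> 0"
    then have "(\<Sum>k=1..N. x i k * y k j) \<noteq> 0 \<or> (\<Sum>k=1..N. y i k * x k j) \<noteq> 0"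
      by (auto simp: mat_simps)
    then show "i \<in> {1..N} \<and> j \<in> {1..N}"
      using *[of x y i j] *[of y x i j] assms by blast
  qed
qed

lemma subspace_sl: "mat.subspace (sl_space N)"
proof -
  have "sl_space N = gl_space N \<inter> {x. mat_trace N x = 0}"
    by (auto simp: sl_space_def)
  moreover have "mat.subspace {x. mat_trace N x = 0}"
    by (rule mat.subspaceI)
      (auto simp: mat_trace_def mat_scale_def sum.distrib simp flip: sum_distrib_left)
  ultimately show ?thesis
    using subspace_gl mat.subspace_inter by simp
qed

lemma commutator_sl:
  assumes "x \<in> gl_space N" "y \<in> gl_space N"
  shows "mat_commutator N x y \<in> sl_space N"
proof -
  have "(\<Sum>i=1..N. \<Sum>k=1..N. x i k * y k i) = (\<Sum>k=1..N. \<Sum>i=1..N. x i k * y k i)"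
    by (rule sum.swap)
  then have "mat_trace N (mat_commutator N x y) = 0"
    by (simp add: mat_trace_def mat_simps sum_subtractf mult.commute)
  then show ?thesis
    using commutator_gl[OF assms] by (simp add: sl_space_def)
qed

theorem seaweed_A_is_lie_algebra: "lie_algebra (seaweed_A n a b)"
proof -
  have *: "seaweed_A n a b = mat_lie n (sl_space n \<inter> admissible_space n a b)"
    by (auto simp: seaweed_A_def admissible_space_def Int_def)
  show ?thesis
    unfolding *
    by (intro mat_lie_is_lie_algebra mat.subspace_inter subspace_sl subspace_admissible IntI
        commutator_sl commutator_admissible) (auto simp: sl_space_def)
qed

text \<open>
  The matrices spanned by \<^const>\<open>sp_generators\<close> are those that are skew with respect to
  the signed reflection in the antidiagonal.
\<close>

definition half_sign :: "nat \<Rightarrow> nat \<Rightarrow> complex" where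
  "half_sign n i = (if i \<le> n then 1 else - 1)"

definition flip :: "nat \<Rightarrow> nat \<Rightarrow> nat" where
  "flip n i = 2 * n + 1 - i"

definition antiskew :: "nat \<Rightarrow> cmat set" where
  "antiskew n = {x. \<forall>i\<in>{1..2 * n}. \<forall>j\<in>{1..2 * n}.
     x (flip n j) (flip n i) = - half_sign n i * half_sign n j * x i j}"

lemma half_sign_simps [simp]:
  "half_sign n i * half_sign n i = 1"
  "half_sign n i * (half_sign n i * z) = z"
  by (auto simp: half_sign_def)

lemma subspace_antiskew: "mat.subspace (antiskew n)"
  by (rule mat.subspaceI) (auto simp: antiskew_def mat_scale_def algebra_simps)

lemma flip_simps:
  assumes "i \<in> {1..2 * n}"
  shows "flip n i \<in> {1..2 * n}" "flip n (flip n i) = i"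
    "half_sign n (flip n i) = - half_sign n i"
  using assms by (auto simp: flip_def half_sign_def)

definition antiskew_unit :: "nat \<Rightarrow> nat \<Rightarrow> nat \<Rightarrow> cmat" where
  "antiskew_unit n i j =
     mat_unit i j - mat_scale (half_sign n i * half_sign n j) (mat_unit (flip n j) (flip n i))"

lemma antiskew_unit_apply:
  "antiskew_unit n i j r s = (if r = i \<and> s = j then 1 else 0) -
     (if r = flip n j \<and> s = flip n i then half_sign n i * half_sign n j else 0)"
  by (simp add: antiskew_unit_def mat_scale_def mat_unit_def)

lemma antiskew_unit_in_gl:
  assumes "i \<in> {1..2 * n}" "j \<in> {1..2 * n}"
  shows "antiskew_unit n i j \<in> gl_space (2 * n)"
  unfolding gl_space_def
proof (rule CollectI, intro allI impI)
  fix r s assume "antiskew_unit n i j r s \<noteq> 0"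
  then have "r = i \<and> s = j \<or> r = flip n j \<and> s = flip n i"
    by (auto simp: antiskew_unit_apply split: if_splits)
  then show "r \<in> {1..2 * n} \<and> s \<in> {1..2 * n}"
    using assms flip_simps(1) by metis
qed

lemma antiskew_unit_in_antiskew:
  assumes "i \<in> {1..2 * n}" "j \<in> {1..2 * n}"
  shows "antiskew_unit n i j \<in> antiskew n"
  unfolding antiskew_def
proof (rule CollectI, intro ballI)
  fix r s assume rs: "r \<in> {1..2 * n}" "s \<in> {1..2 * n}"
  have eq: "flip n s = i \<longleftrightarrow> s = flip n i" "flip n r = j \<longleftrightarrow> r = flip n j"
    "flip n s = flip n j \<longleftrightarrow> s = j" "flip n r = flip n i \<longleftrightarrow> r = i"
    using rs assms flip_simps(2) by metis+
  have sgn: "half_sign n (flip n i) = - half_sign n i" "half_sign n (flip n j) = - half_sign n j"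
    using assms flip_simps(3) by blast+
  let ?A = "r = flip n j \<and> s = flip n i" and ?B = "r = i \<and> s = j"
  have "flip n s = i \<and> flip n r = j \<longleftrightarrow> ?A" "flip n s = flip n j \<and> flip n r = flip n i \<longleftrightarrow> ?B"
    using eq by blast+
  then have "antiskew_unit n i j (flip n s) (flip n r) =
      (if ?A then 1 else 0) - (if ?B then half_sign n i * half_sign n j else 0)"
    by (simp only: antiskew_unit_apply)
  also have "(if ?A then 1 else 0) =
      half_sign n r * half_sign n s * (if ?A then half_sign n i * half_sign n j else 0)"
  proof (cases ?A)
    case True
    then have "half_sign n r = - half_sign n j" "half_sign n s = - half_sign n i"
      using sgn by blast+
    with True show ?thesis by (simp only: if_True) (simp add: mult.left_commute mult.assoc)
  next
    case False
    then show ?thesis by (simp only: if_False) simp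
  qed
  also have "(if ?B then half_sign n i * half_sign n j else 0) =
      half_sign n r * half_sign n s * (if ?B then 1 else 0)"
  proof (cases ?B)
    case True
    then show ?thesis by (simp only: if_True) simp
  next
    case False
    then show ?thesis by (simp only: if_False) simp
  qed
  finally show "antiskew_unit n i j (flip n s) (flip n r) =
      - half_sign n r * half_sign n s * antiskew_unit n i j r s"
    unfolding antiskew_unit_apply by (simp only: mult_minus_left right_diff_distrib minus_diff_minus minus_diff_eq)
qed

lemma antiskew_unit_block:
  assumes "i \<in> {1..n}" "j \<in> {1..n}"
  shows "antiskew_unit n i j = mat_unit i j - mat_unit (2 * n - j + 1) (2 * n - i + 1)"
proof -
  have "flip n i = 2 * n - i + 1" "flip n j = 2 * n - j + 1"
    "half_sign n i = 1" "half_sign n j = 1"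
    using assms by (auto simp: flip_def half_sign_def)
  then show ?thesis by (simp add: antiskew_unit_def)
qed

lemma antiskew_unit_antidiagonal:
  assumes "i \<in> {1..2 * n}" "j \<in> {1..2 * n}" "i + j = 2 * n + 1"
  shows "antiskew_unit n i j = mat_scale 2 (mat_unit i j)"
proof -
  have "flip n i = j" "flip n j = i" "half_sign n i * half_sign n j = - 1"
    using assms by (auto simp: flip_def half_sign_def)
  then show ?thesis
    by (simp add: antiskew_unit_def fun_eq_iff mat_scale_def)
qed

lemma antiskew_unit_off_block:
  assumes "i \<in> {1..2 * n}" "j \<in> {1..2 * n}" "i \<le> n \<and> n < j \<or> j \<le> n \<and> n < i"
  shows "antiskew_unit n i j = mat_unit i j + mat_unit (2 * n - j + 1) (2 * n - i + 1)"
proof -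
  have "flip n i = 2 * n - i + 1" "flip n j = 2 * n - j + 1"
    "half_sign n i * half_sign n j = - 1"
    using assms by (auto simp: flip_def half_sign_def)
  then show ?thesis
    by (simp add: antiskew_unit_def fun_eq_iff mat_scale_def)
qed

lemma antiskew_unit_flip:
  assumes "i \<in> {1..2 * n}" "j \<in> {1..2 * n}"
  shows "antiskew_unit n i j =
    mat_scale (- half_sign n i * half_sign n j) (antiskew_unit n (flip n j) (flip n i))"
  using assms by (simp add: antiskew_unit_def flip_simps fun_eq_iff mat_scale_def algebra_simps)

lemma sp_generators_subset: "sp_generators n \<subseteq> gl_space (2 * n) \<inter> antiskew n"
proof -
  let ?S = "gl_space (2 * n) \<inter> antiskew n"
  have unit: "antiskew_unit n i j \<in> ?S" if "i \<in> {1..2 * n}" "j \<in> {1..2 * n}" for i j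
    using that antiskew_unit_in_gl antiskew_unit_in_antiskew by blast
  have 1: "mat_unit i j - mat_unit (2 * n - j + 1) (2 * n - i + 1) \<in> ?S"
    if "i \<in> {1..n}" "j \<in> {1..n}" for i j
    unfolding antiskew_unit_block[OF that, symmetric] by (rule unit) (use that in auto)
  have 2: "mat_unit i j \<in> ?S"
    if "i \<in> {1..2 * n}" "j \<in> {1..2 * n}" "i + j = 2 * n + 1" for i j
  proof -
    have "mat_unit i j = mat_scale (1 / 2) (antiskew_unit n i j)"
      unfolding antiskew_unit_antidiagonal[OF that] by (simp add: mat_scale_def)
    then show ?thesis
      using mat.subspace_scale[OF _ unit[OF that(1,2)]]
        mat.subspace_inter[OF subspace_gl subspace_antiskew] by metis
  qed
  have 3: "mat_unit i j + mat_unit (2 * n - j + 1) (2 * n - i + 1) \<in> ?S"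
    if "i \<in> {1..2 * n}" "j \<in> {1..2 * n}" "i \<le> n \<and> n < j \<or> j \<le> n \<and> n < i" for i j
    unfolding antiskew_unit_off_block[OF that, symmetric] using that unit by blast
  show ?thesis
    unfolding sp_generators_def using 1 2 3 by blast
qed

lemma antiskew_unit_in_sp:
  assumes ij: "i \<in> {1..2 * n}" "j \<in> {1..2 * n}"
  shows "antiskew_unit n i j \<in> sp_space n"
proof -
  have low: "antiskew_unit n i j \<in> sp_space n"
    if ij': "i \<in> {1..2 * n}" "j \<in> {1..2 * n}" "i \<le> n \<and> j \<le> n \<or>
      i + j \<le> 2 * n + 1 \<and> (i \<le> n \<and> n < j \<or> j \<le> n \<and> n < i)" for i j
  proof -
    consider "i \<in> {1..n}" "j \<in> {1..n}" | "i + j = 2 * n + 1"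
      | "i + j < 2 * n + 1" "i \<le> n \<and> n < j \<or> j \<le> n \<and> n < i"
      using ij' unfolding atLeastAtMost_iff le_less by blast
    then show ?thesis
    proof cases
      case 1
      then have "antiskew_unit n i j \<in> sp_generators n"
        unfolding antiskew_unit_block[OF 1] sp_generators_def by blast
      then show ?thesis unfolding sp_space_def by (rule mat.span_base)
    next
      case 2
      have "mat_unit i j \<in> sp_generators n"
        unfolding sp_generators_def using 2 ij'(1,2) by blast
      then show ?thesis
        unfolding antiskew_unit_antidiagonal[OF ij'(1,2) 2] sp_space_def
        by (intro mat.span_scale mat.span_base)
    next
      case 3
      then have "antiskew_unit n i j \<in> sp_generators n"
        unfolding antiskew_unit_off_block[OF ij'(1,2) 3(2)] sp_generators_def
        using ij'(1,2) by blast
      then show ?thesis unfolding sp_space_def by (rule mat.span_base)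
    qed
  qed
  show ?thesis
  proof (cases "i \<le> n \<and> j \<le> n \<or> i + j \<le> 2 * n + 1 \<and> (i \<le> n \<and> n < j \<or> j \<le> n \<and> n < i)")
    case True then show ?thesis using low ij by blast
  next
    case False
    then have "flip n j \<le> n \<and> flip n i \<le> n \<or> flip n j + flip n i \<le> 2 * n + 1 \<and>
        (flip n j \<le> n \<and> n < flip n i \<or> flip n i \<le> n \<and> n < flip n j)"
      using ij unfolding flip_def atLeastAtMost_iff by linarith
    then have "antiskew_unit n (flip n j) (flip n i) \<in> sp_space n"
      using low flip_simps(1) ij by blast
    then show ?thesis
      unfolding antiskew_unit_flip[OF ij] sp_space_def by (rule mat.span_scale)
  qed
qed

lemma antiskew_expand:
  assumes x: "x \<in> gl_space (2 * n)" "x \<in> antiskew n"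
  shows "x = (\<Sum>p\<in>{1..2 * n} \<times> {1..2 * n}.
    mat_scale (x (fst p) (snd p) / 2) (antiskew_unit n (fst p) (snd p)))" (is "x = ?y")
proof (intro ext)
  fix r s
  show "x r s = ?y r s"
  proof (cases "r \<in> {1..2 * n} \<and> s \<in> {1..2 * n}")
    case False
    have "antiskew_unit n i j r s = 0" if "i \<in> {1..2 * n}" "j \<in> {1..2 * n}" for i j
      using antiskew_unit_in_gl[OF that] False unfolding gl_space_def by blast
    then have "?y r s = 0"
      unfolding sum_fun_apply mat_scale_def by (intro sum.neutral) force
    moreover have "x r s = 0" using x False unfolding gl_space_def by blast
    ultimately show ?thesis by simp
  next
    case True
    then have r: "r \<in> {1..2 * n}" and s: "s \<in> {1..2 * n}" by auto
    have pq: "r = flip n (snd p) \<and> s = flip n (fst p) \<longleftrightarrow> p = (flip n s, flip n r)"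
      if "p \<in> {1..2 * n} \<times> {1..2 * n}" for p
      using that flip_simps(2) r s by (metis mem_Times_iff prod.collapse fst_conv snd_conv)
    have "?y r s = (\<Sum>p\<in>{1..2 * n} \<times> {1..2 * n}. (if p = (r, s) then x r s / 2 else 0) +
        (if p = (flip n s, flip n r) then
          - (half_sign n (flip n s) * half_sign n (flip n r) * x (flip n s) (flip n r)) / 2 else 0))"
      unfolding sum_fun_apply
    proof (rule sum.cong[OF refl])
      fix p assume p: "p \<in> {1..2 * n} \<times> {1..2 * n}"
      obtain i j where ij: "p = (i, j)" by (cases p)
      let ?c = "half_sign n i * half_sign n j"
      have 1: "r = i \<and> s = j \<longleftrightarrow> p = (r, s)"
        unfolding ij by auto
      have 2: "r = flip n j \<and> s = flip n i \<longleftrightarrow> p = (flip n s, flip n r)"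
        using pq[OF p] unfolding ij fst_conv snd_conv .
      have "mat_scale (x i j / 2) (antiskew_unit n i j) r s =
          (if p = (r, s) then x i j / 2 else 0) +
          (if p = (flip n s, flip n r) then - (?c * x i j) / 2 else 0)"
        unfolding mat_scale_def antiskew_unit_apply 1 2 if_distrib[of "(*) (x i j / 2)"]
          right_diff_distrib
        by (cases "p = (r, s)"; cases "p = (flip n s, flip n r)") (simp_all only: if_True if_False, simp_all)
      also have "(if p = (r, s) then x i j / 2 else 0) = (if p = (r, s) then x r s / 2 else 0)"
        unfolding ij by (simp only: prod.inject cong: if_cong)
      also have "(if p = (flip n s, flip n r) then - (?c * x i j) / 2 else 0) =
          (if p = (flip n s, flip n r) then
           - (half_sign n (flip n s) * half_sign n (flip n r) * x (flip n s) (flip n r)) / 2 else 0)"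
        unfolding ij by (simp only: prod.inject cong: if_cong)
      finally show "mat_scale (x (fst p) (snd p) / 2) (antiskew_unit n (fst p) (snd p)) r s =
          (if p = (r, s) then x r s / 2 else 0) + (if p = (flip n s, flip n r) then
          - (half_sign n (flip n s) * half_sign n (flip n r) * x (flip n s) (flip n r)) / 2 else 0)"
        unfolding ij fst_conv snd_conv .
    qed
    also have "\<dots> = x r s / 2 -
        half_sign n (flip n s) * half_sign n (flip n r) * x (flip n s) (flip n r) / 2"
      unfolding sum.distrib using r s flip_simps(1)[OF r] flip_simps(1)[OF s]
      by (simp add: sum.delta)
    also have "x (flip n s) (flip n r) = - half_sign n r * half_sign n s * x r s"
      using x r s unfolding antiskew_def by blast
    finally show ?thesis
      using r s by (simp add: flip_simps(3) mult.left_commute mult.assoc)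
  qed
qed

lemma sp_space_eq: "sp_space n = gl_space (2 * n) \<inter> antiskew n"
proof
  show "sp_space n \<subseteq> gl_space (2 * n) \<inter> antiskew n"
    unfolding sp_space_def
    by (intro mat.span_minimal mat.subspace_inter subspace_gl subspace_antiskew
        sp_generators_subset)
  show "gl_space (2 * n) \<inter> antiskew n \<subseteq> sp_space n"
  proof
    fix x assume "x \<in> gl_space (2 * n) \<inter> antiskew n"
    then have x: "x \<in> gl_space (2 * n)" "x \<in> antiskew n" by auto
    have "mat_scale (x (fst p) (snd p) / 2) (antiskew_unit n (fst p) (snd p)) \<in> sp_space n"
      if "p \<in> {1..2 * n} \<times> {1..2 * n}" for p
      using antiskew_unit_in_sp[of "fst p" n "snd p"] that
      unfolding sp_space_def mem_Times_iff by (intro mat.span_scale) blast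
    then show "x \<in> sp_space n"
      unfolding sp_space_def by (subst antiskew_expand[OF x], intro mat.span_sum)
  qed
qed

lemma commutator_antiskew:
  assumes "x \<in> antiskew n" "y \<in> antiskew n"
  shows "mat_commutator (2 * n) x y \<in> antiskew n"
proof -
  have *: "(\<Sum>k=1..2 * n. u (2 * n + 1 - j) k * v k (2 * n + 1 - i)) =
      half_sign n i * half_sign n j * (\<Sum>k=1..2 * n. v i k * u k j)"
    if "u \<in> antiskew n" "v \<in> antiskew n" "i \<in> {1..2 * n}" "j \<in> {1..2 * n}" for u v i j
  proof -
    have "(\<Sum>k=1..2 * n. u (2 * n + 1 - j) k * v k (2 * n + 1 - i)) =
        (\<Sum>k=1..2 * n. u (2 * n + 1 - j) (2 * n + 1 - k) * v (2 * n + 1 - k) (2 * n + 1 - i))"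
      by (rule sum.reindex_bij_witness[of _ "\<lambda>k. 2 * n + 1 - k" "\<lambda>k. 2 * n + 1 - k"]) auto
    also have "\<dots> = (\<Sum>k=1..2 * n. half_sign n i * half_sign n j * (v i k * u k j))"
    proof (rule sum.cong[OF refl])
      fix k assume k: "k \<in> {1..2 * n}"
      have "u (2 * n + 1 - j) (2 * n + 1 - k) = - half_sign n k * half_sign n j * u k j"
        "v (2 * n + 1 - k) (2 * n + 1 - i) = - half_sign n i * half_sign n k * v i k"
        using that k unfolding antiskew_def flip_def by blast+
      then show "u (2 * n + 1 - j) (2 * n + 1 - k) * v (2 * n + 1 - k) (2 * n + 1 - i)
          = half_sign n i * half_sign n j * (v i k * u k j)"
        by (simp add: mult.left_commute mult.assoc)
    qed
    finally show ?thesis by (simp add: sum_distrib_left)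
  qed
  show ?thesis
    unfolding antiskew_def flip_def
  proof (rule CollectI, intro ballI)
    fix i j assume ij: "i \<in> {1..2 * n}" "j \<in> {1..2 * n}"
    show "mat_commutator (2 * n) x y (2 * n + 1 - j) (2 * n + 1 - i) =
        - half_sign n i * half_sign n j * mat_commutator (2 * n) x y i j"
      unfolding mat_simps *[OF assms ij] *[OF assms(2,1) ij]
      by (simp add: algebra_simps)
  qed
qed

theorem seaweed_C_is_lie_algebra: "lie_algebra (seaweed_C n a b)"
proof -
  have *: "seaweed_C n a b = mat_lie (2 * n) (gl_space (2 * n) \<inter> antiskew n \<inter>
      admissible_space (2 * n) (symmetric_blocks n a) (symmetric_blocks n b))"
    by (auto simp: seaweed_C_def admissible_space_def Int_def sp_space_eq)
  show ?thesis
    unfolding *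
    by (intro mat_lie_is_lie_algebra mat.subspace_inter subspace_gl subspace_antiskew
        subspace_admissible IntI commutator_gl commutator_antiskew commutator_admissible) auto
qed

end

theory Submission
  imports
    Defs
    "Jordan_Normal_Form.Determinant"
    "HOL-Computational_Algebra.Fundamental_Theorem_Algebra"
    "HOL-Computational_Algebra.Polynomial_FPS"
begin

text \<open>
  Let \<open>A\<close> be the associative algebra of all matrices supported on the admissible positions,
  and \<open>\<phi>\<close> a functional on \<open>A\<close> supported on the arcs of the meander graph, with coefficients
  that decrease strictly in modulus for nested arcs. Panyushev's reduction of seaweeds shows by
  induction that the associative algebra \<open>S = {x. \<forall>y. \<phi> (x y) = \<phi> (y x)}\<close> has no
  nonzero nilpotent element. In type A the kernel of the Kirillov form of \<open>\<phi>\<close> on the seaweed is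
  the trace-zero part of \<open>S\<close>; in type C, choosing \<open>\<phi>\<close> anti-invariant under the involution
  that defines \<open>sp(2n)\<close>, it is again the intersection with \<open>S\<close>.

  If the index is one, this kernel contains some \<open>x \<noteq> 0\<close>. As \<open>S\<close> is commutative and reduced,
  \<open>[x, z] \<in> S\<close> implies \<open>[x, z] = 0\<close>. This makes the formal differential equation
  \<open>X' = [Y, X]\<close>, \<open>X(0) = x\<close> solvable with \<open>X(t)\<close> in the kernel for \<open>\<phi> + t \<psi>\<close>, where
  \<open>\<psi>\<close> is arbitrary. The first two coefficients of \<open>(\<phi> + t \<psi>) (X(t))\<close> are
  \<open>\<phi> x\<close> and \<open>\<psi> x\<close>, so a suitable line through a functional with one-dimensional kernel
  contains one that does not vanish on its kernel, and this is a contact form.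
\<close>

text \<open>The meander functional \<phi> cannot in general serve as the contact form itself: it has
  no coefficients on the diagonal, so it vanishes on every diagonal matrix in its kernel. Hence the
  passage to neighbouring functionals, whose kernels are not explicit. Nor is the kernel of \<phi>
  claimed to be a line; what is needed is one kernel vector x that extends to the kernels of \<phi>
  + t \<psi>. To first order this asks for \<psi> [x, u] = 0 whenever u lies in the kernel of
  \<phi>, which holds because S is commutative. At higher orders the obstruction is controlled by
  letting X(t) move by infinitesimal conjugation, so that the centralizer of x moves along with it.
  Convergence never arises: if no functional were a contact form, a determinant polynomial in t
  would vanish at every complex t, hence identically, and this is refuted over formal power series.
  Associative products enter because S, unlike the kernel of a Kirillov form in general, is closed
  under them, so that nilpotency can be tested by x x = 0, a condition that block reduction
  transports.\<close>

section \<open>Stabilizers of meander functionals\<close>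

text \<open>The blocks of sizes \<open>c\<close> start after position \<open>p\<close>; the offset lets an induction discard
  initial vertices without renumbering, and blocks of size \<open>0\<close> are allowed.\<close>

fun diag_block :: "nat \<Rightarrow> nat list \<Rightarrow> nat \<Rightarrow> nat \<Rightarrow> bool" where
  "diag_block p [] i j \<longleftrightarrow> False"
| "diag_block p (c # cs) i j \<longleftrightarrow>
     p < i \<and> i \<le> p + c \<and> p < j \<and> j \<le> p + c \<or> diag_block (p + c) cs i j"

fun arc :: "nat \<Rightarrow> nat list \<Rightarrow> nat \<Rightarrow> nat \<Rightarrow> bool" where
  "arc p [] i j \<longleftrightarrow> False"
| "arc p (c # cs) i j \<longleftrightarrow>
     p < i \<and> i \<le> p + c \<and> i + j = 2 * p + c + 1 \<or> arc (p + c) cs i j"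

definition adm :: "nat \<Rightarrow> nat list \<Rightarrow> nat list \<Rightarrow> nat \<Rightarrow> nat \<Rightarrow> bool" where
  "adm p a b i j \<longleftrightarrow> i \<ge> j \<and> diag_block p a i j \<or> i \<le> j \<and> diag_block p b i j"

lemma diag_block_bounds:
  "diag_block p c i j \<Longrightarrow> p < i \<and> i \<le> p + sum_list c \<and> p < j \<and> j \<le> p + sum_list c"
  by (induction p c i j rule: diag_block.induct) auto

lemma arc_bounds:
  "arc p c i j \<Longrightarrow> p < i \<and> i \<le> p + sum_list c \<and> p < j \<and> j \<le> p + sum_list c"
  by (induction p c i j rule: arc.induct) auto

lemma arc_sym: "arc p c i j \<Longrightarrow> arc p c j i"
  by (induction p c i j rule: arc.induct) auto

lemma diag_block_sym: "diag_block p c i j \<Longrightarrow> diag_block p c j i"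
  by (induction p c i j rule: diag_block.induct) auto

text \<open>Nested arcs of a block have strictly decreasing coefficients towards the middle. This survives
  the contraction below, and it makes the eigenvalues of the antidiagonal matrices at which the
  induction ends distinct.\<close>

definition graded_arcs :: "nat \<Rightarrow> nat list \<Rightarrow> (nat \<Rightarrow> nat \<Rightarrow> complex) \<Rightarrow> bool" where
  "graded_arcs p c f \<longleftrightarrow> (\<forall>i j k l. i < j \<longrightarrow> k < l \<longrightarrow> arc p c i j \<longrightarrow> arc p c k l \<longrightarrow>
     diag_block p c i k \<longrightarrow> i < k \<longrightarrow> norm (f k l) < norm (f i j))"

definition meander :: "nat \<Rightarrow> nat list \<Rightarrow> nat list \<Rightarrow> (nat \<Rightarrow> nat \<Rightarrow> complex) \<Rightarrow> bool" where
  "meander p a b f \<longleftrightarrow>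
     (\<forall>i j. f i j \<noteq> 0 \<longleftrightarrow> i > j \<and> arc p a i j \<or> i < j \<and> arc p b i j) \<and>
     graded_arcs p a (\<lambda>i j. f j i) \<and> graded_arcs p b f"

text \<open>For \<open>\<phi> x = (\<Sum>i j. f i j * x i j)\<close>, the equations say \<open>\<phi> (x E) = \<phi> (E x)\<close> for the matrix
  units \<open>E\<close> at the positions in \<open>R\<close>.\<close>

definition stab :: "nat \<Rightarrow> (nat \<Rightarrow> nat \<Rightarrow> bool) \<Rightarrow> (nat \<Rightarrow> nat \<Rightarrow> complex) \<Rightarrow> cmat \<Rightarrow> bool" where
  "stab N R f x \<longleftrightarrow> (\<forall>i j. x i j \<noteq> 0 \<longrightarrow> R i j) \<and>
     (\<forall>k l. R k l \<longrightarrow> (\<Sum>i=1..N. f i l * x i k) = (\<Sum>j=1..N. f k j * x l j))"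

definition reduced :: "nat \<Rightarrow> (nat \<Rightarrow> nat \<Rightarrow> bool) \<Rightarrow> (nat \<Rightarrow> nat \<Rightarrow> complex) \<Rightarrow> bool" where
  "reduced N R f \<longleftrightarrow> (\<forall>x. stab N R f x \<longrightarrow> mat_prod N x x = 0 \<longrightarrow> x = 0)"

lemma adm_bounds:
  assumes "adm p a b i j" "sum_list a = s" "sum_list b = s"
  shows "p < i \<and> i \<le> p + s \<and> p < j \<and> j \<le> p + s"
proof -
  have "diag_block p a i j \<or> diag_block p b i j"
    using assms(1) unfolding adm_def by blast
  then show ?thesis
    using diag_block_bounds[of p a i j] diag_block_bounds[of p b i j] assms(2,3) by auto
qed

lemma adm_swap: "adm p a b i j \<longleftrightarrow> adm p b a j i"
  unfolding adm_def using diag_block_sym by blast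

lemma sum_single:
  assumes "finite A" "i \<in> A" "\<And>j. j \<in> A \<Longrightarrow> j \<noteq> i \<Longrightarrow> g j = 0"
  shows "sum g A = g i"
proof -
  have "sum g A = sum g {i}"
    by (rule sum.mono_neutral_right) (use assms in auto)
  then show ?thesis by simp
qed

lemma meander_swap: "meander p a b f \<Longrightarrow> meander p b a (\<lambda>i j. f j i)"
  unfolding meander_def using arc_sym by blast

text \<open>Transposition reverses products, so it preserves square-zero elements while it exchanges
  the two compositions. With \<open>meander_swap\<close> this lets the induction assume that the
  first block of \<open>a\<close> is no longer than that of \<open>b\<close>.\<close>

lemma reduced_swap:
  assumes "reduced N (adm p a b) f"
  shows "reduced N (adm p b a) (\<lambda>i j. f j i)"
  unfolding reduced_def
proof (intro allI impI)
  fix x assume x: "stab N (adm p b a) (\<lambda>i j. f j i) x" "mat_prod N x x = 0"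
  define y :: cmat where "y = (\<lambda>i j. x j i)"
  have "stab N (adm p a b) f y"
    using x(1) unfolding stab_def y_def adm_swap[of p b a] by auto
  moreover have "mat_prod N y y = 0"
  proof (intro ext)
    fix i j
    have "mat_prod N y y i j = mat_prod N x x j i"
      by (simp add: mat_prod_def y_def mult.commute)
    then show "mat_prod N y y i j = (0::cmat) i j" using x(2) by simp
  qed
  ultimately have "y = 0" using assms unfolding reduced_def by blast
  then show "x = 0" unfolding y_def fun_eq_iff by simp
qed

lemma meander_split:
  assumes "meander p (c # a) (c # b) f"
  shows "meander (p + c) a b (\<lambda>i j. if i > p + c \<and> j > p + c then f i j else 0)"
  (is "meander _ _ _ ?g")
proof -
  have supp: "f i j \<noteq> 0 \<longleftrightarrow> i > j \<and> arc p (c # a) i j \<or> i < j \<and> arc p (c # b) i j" for i j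
    using assms unfolding meander_def by blast
  have ga: "graded_arcs p (c # a) (\<lambda>i j. f j i)" and gb: "graded_arcs p (c # b) f"
    using assms unfolding meander_def by blast+
  have 1: "?g i j \<noteq> 0 \<longleftrightarrow> i > j \<and> arc (p + c) a i j \<or> i < j \<and> arc (p + c) b i j" for i j
    using supp[of i j] arc_bounds[of "p + c" a i j] arc_bounds[of "p + c" b i j] by auto
  have 2: "graded_arcs (p + c) d (\<lambda>i j. g i j)"
    if "graded_arcs p (c # d) h" "\<And>i j. i > p + c \<Longrightarrow> j > p + c \<Longrightarrow> g i j = h i j" for d h g
    unfolding graded_arcs_def
  proof (intro allI impI)
    fix i j k l
    assume *: "i < j" "k < l" "arc (p + c) d i j" "arc (p + c) d k l" "diag_block (p + c) d i k" "i < k"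
    then have "norm (h k l) < norm (h i j)"
      using that(1) unfolding graded_arcs_def by auto
    moreover have "i > p + c" "j > p + c" "k > p + c" "l > p + c"
      using arc_bounds[OF *(3)] arc_bounds[OF *(4)] by auto
    ultimately show "norm (g k l) < norm (g i j)" using that(2) by simp
  qed
  show ?thesis
    unfolding meander_def using 1 2[OF ga, of "\<lambda>i j. ?g j i"] 2[OF gb, of ?g] by simp
qed

text \<open>The equation for \<open>x\<close> says that \<open>x\<close> commutes with the
  antidiagonal matrix whose entry at (l, \<open>\<rho> l\<close>) is \<open>F l\<close>. The square
  of that matrix is diagonal with entries \<open>F l * F (\<rho> l)\<close>, so by \<open>P\<close>
  the matrix \<open>x\<close> is supported on the pairs {l, \<open>\<rho> l\<close>}. On such a pair
  \<open>x\<close> is a scalar plus a multiple of the antidiagonal 2 by 2 block, and its square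
  vanishes only if both summands do.\<close>

lemma meander_antidiagonal_reduced:
  fixes x :: cmat
  assumes \<rho>: "\<And>i. p < i \<Longrightarrow> i \<le> p + c \<Longrightarrow> \<rho> i = 2 * p + c + 1 - i"
    and x: "\<And>k l. k \<in> {p<..p + c} \<Longrightarrow> l \<in> {p<..p + c} \<Longrightarrow> F l * x (\<rho> l) k = F (\<rho> k) * x l (\<rho> k)"
    and F0: "\<And>l. l \<in> {p<..p + c} \<Longrightarrow> \<rho> l \<noteq> l \<Longrightarrow> F l \<noteq> 0"
    and F1: "\<And>l. l \<in> {p<..p + c} \<Longrightarrow> \<rho> l = l \<Longrightarrow> F l = 0"
    and P: "\<And>k l. k \<in> {p<..p + c} \<Longrightarrow> l \<in> {p<..p + c} \<Longrightarrow> F l * F (\<rho> l) = F k * F (\<rho> k) \<Longrightarrow> k = l \<or> k = \<rho> l"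
    and sq: "\<And>i j. i \<in> {p<..p + c} \<Longrightarrow> j \<in> {p<..p + c} \<Longrightarrow> (\<Sum>k\<in>{p<..p + c}. x i k * x k j) = 0"
    and ij: "i \<in> {p<..p + c}" "j \<in> {p<..p + c}"
  shows "x i j = 0"
proof -
  have \<rho>_in: "\<rho> l \<in> {p<..p + c}" "\<rho> (\<rho> l) = l" if "l \<in> {p<..p + c}" for l
    using that \<rho>[of l] \<rho>[of "\<rho> l"] by auto
  have zero: "x l k = 0" if "l \<in> {p<..p + c}" "k \<in> {p<..p + c}" "k \<noteq> l" "k \<noteq> \<rho> l" for k l
  proof -
    let ?l = "\<rho> l"
    have 1: "F ?l * x l k = F (\<rho> k) * x ?l (\<rho> k)"
      using x[of k ?l] \<rho>_in that by simp
    have 2: "F l * x ?l (\<rho> k) = F k * x l k"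
      using x[of "\<rho> k" l] \<rho>_in that by simp
    have "F l * F ?l * x l k = F (\<rho> k) * (F l * x ?l (\<rho> k))"
      using 1 by (simp add: mult.assoc mult.left_commute)
    also have "\<dots> = F k * F (\<rho> k) * x l k" unfolding 2 by simp
    finally have "(F l * F ?l - F k * F (\<rho> k)) * x l k = 0" by (simp add: algebra_simps)
    then show ?thesis using P[of k l] that by auto
  qed
  have main: "x l l = 0 \<and> x l (\<rho> l) = 0" if l: "l \<in> {p<..p + c}" for l
  proof (cases "\<rho> l = l")
    case True
    have "(\<Sum>k\<in>{p<..p + c}. x l k * x k l) = x l l * x l l"
      by (rule sum_single) (use l zero[OF l] True in auto)
    then show ?thesis using sq[OF l l] True by simp
  next
    case False
    note r = \<rho>_in[OF l]
    have s: "(\<Sum>k\<in>{p<..p + c}. x l k * x k j) = x l l * x l j + x l (\<rho> l) * x (\<rho> l) j" for j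
    proof -
      have "(\<Sum>k\<in>{p<..p + c}. x l k * x k j) = (\<Sum>k\<in>{l, \<rho> l}. x l k * x k j)"
        by (rule sum.mono_neutral_right) (use l r zero[OF l] in auto)
      then show ?thesis using False by auto
    qed
    have e1: "x l l * x l l + x l (\<rho> l) * x (\<rho> l) l = 0"
      using s sq[OF l l] by simp
    have e2: "x l l * x l (\<rho> l) + x l (\<rho> l) * x (\<rho> l) (\<rho> l) = 0"
      using s sq[OF l r(1)] by simp
    have e3: "x (\<rho> l) (\<rho> l) = x l l"
      using x[OF r(1) l] F0[OF l False] r by simp
    have e4: "F l * x (\<rho> l) l = F (\<rho> l) * x l (\<rho> l)"
      using x[OF l l] by simp
    have "F (\<rho> l) \<noteq> 0" using F0[OF r(1)] False r by simp
    moreover have "2 * (x l l * x l (\<rho> l)) = 0"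
      using e2 unfolding e3 by (simp add: algebra_simps)
    then have "x l l = 0 \<or> x l (\<rho> l) = 0" by simp
    ultimately show ?thesis using e1 e4 F0[OF l False] by auto
  qed
  show ?thesis using main[OF ij(1)] zero[OF ij] by blast
qed

lemma meander_support:
  "meander p a b f \<Longrightarrow> f i j \<noteq> 0 \<longleftrightarrow> i > j \<and> arc p a i j \<or> i < j \<and> arc p b i j"
  unfolding meander_def by blast

text \<open>Equal first blocks split the algebra into the full matrix algebra on the first
  \<open>c\<close> vertices and the seaweed on the rest, with no arc between them. The induction
  hypothesis clears the second factor; in the first, stabilizer elements commute with an
  antidiagonal matrix.\<close>

lemma reduced_split:
  assumes c: "0 < c" and f: "meander p (c # a) (c # b) f" and sums: "sum_list a = sum_list b"
    and N: "p + c + sum_list a \<le> N"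
    and IH: "reduced N (adm (p + c) a b) (\<lambda>i j. if i > p + c \<and> j > p + c then f i j else 0)"
  shows "reduced N (adm p (c # a) (c # b)) f"
  unfolding reduced_def
proof (intro allI impI)
  fix x assume st: "stab N (adm p (c # a) (c # b)) f x" and sq: "mat_prod N x x = 0"
  define q where "q = p + c"
  let ?g = "\<lambda>i j. if i > q \<and> j > q then f i j else 0"
  have supp: "f i j \<noteq> 0 \<longleftrightarrow> i > j \<and> arc p (c # a) i j \<or> i < j \<and> arc p (c # b) i j" for i j
    by (rule meander_support[OF f])
  have adm_iff: "adm p (c # a) (c # b) i j \<longleftrightarrow>
      p < i \<and> i \<le> q \<and> p < j \<and> j \<le> q \<or> adm q a b i j" for i j
    unfolding adm_def q_def by auto
  have adm_q: "adm q a b i j \<Longrightarrow> i > q \<and> j > q \<and> i \<le> N \<and> j \<le> N" for i j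
    using adm_bounds[of q a b i j] sums N unfolding q_def by auto
  have fq: "f i j \<noteq> 0 \<Longrightarrow> i > q \<longleftrightarrow> j > q" for i j
    unfolding supp using arc_bounds[of q a i j] arc_bounds[of q b i j]
    by (auto simp: q_def)
  have xR: "x i j \<noteq> 0 \<Longrightarrow> adm p (c # a) (c # b) i j"
    and eq: "adm p (c # a) (c # b) k l \<Longrightarrow>
      (\<Sum>i=1..N. f i l * x i k) = (\<Sum>j=1..N. f k j * x l j)" for i j k l
    using st unfolding stab_def by blast+
  have sq': "(\<Sum>k=1..N. x i k * x k j) = 0" for i j
    using fun_cong[OF fun_cong[OF sq], of i j] by (simp add: mat_prod_def)
  define y :: cmat where "y = (\<lambda>i j. if i > q \<and> j > q then x i j else 0)"
  have "stab N (adm q a b) ?g y"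
    unfolding stab_def
  proof (intro conjI allI impI)
    fix i j assume "y i j \<noteq> 0"
    then show "adm q a b i j" using xR[of i j] adm_iff[of i j] by (auto simp: y_def split: if_splits)
  next
    fix k l assume kl: "adm q a b k l"
    then have kl': "k > q" "l > q" using adm_q by blast+
    have "(\<Sum>i=1..N. ?g i l * y i k) = (\<Sum>i=1..N. f i l * x i k)"
      by (rule sum.cong) (use fq kl' in \<open>auto simp: y_def\<close>)
    also have "\<dots> = (\<Sum>j=1..N. f k j * x l j)" using eq adm_iff kl by blast
    also have "\<dots> = (\<Sum>j=1..N. ?g k j * y l j)"
      by (rule sum.cong) (use fq kl' in \<open>auto simp: y_def\<close>)
    finally show "(\<Sum>i=1..N. ?g i l * y i k) = (\<Sum>j=1..N. ?g k j * y l j)" .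
  qed
  moreover have "mat_prod N y y = 0"
  proof (intro ext)
    fix i j
    show "mat_prod N y y i j = (0::cmat) i j"
    proof (cases "i > q \<and> j > q")
      case True
      have "mat_prod N y y i j = (\<Sum>k=1..N. x i k * x k j)"
        unfolding mat_prod_def
      proof (rule sum.cong[OF refl])
        fix k
        have "x i k = 0" if "k \<le> q" using xR[of i k] adm_iff[of i k] adm_q[of i k] True that by force
        then show "y i k * y k j = x i k * x k j" using True by (auto simp: y_def)
      qed
      then show ?thesis using sq' by simp
    next
      case False
      then show ?thesis by (auto simp: y_def mat_prod_def intro!: sum.neutral)
    qed
  qed
  ultimately have "y = 0" using IH unfolding reduced_def q_def by blast
  then have x_high: "x i j = 0" if "i > q" "j > q" for i j
    using that by (auto simp: y_def fun_eq_iff split: if_splits)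
  define \<rho> where "\<rho> = (\<lambda>i. 2 * p + c + 1 - i)"
  define F where "F = (\<lambda>l. f (\<rho> l) l)"
  let ?B = "{p<..p + c}"
  have B: "?B \<subseteq> {1..N}" using N by auto
  have \<rho>_in: "\<rho> l \<in> ?B" "\<rho> (\<rho> l) = l" if "l \<in> ?B" for l
    using that by (auto simp: \<rho>_def)
  have fB: "f i l \<noteq> 0 \<longleftrightarrow> i = \<rho> l \<and> i \<noteq> l" if "l \<in> ?B" for i l
    unfolding supp using that arc_bounds[of q a i l] arc_bounds[of q b i l]
    by (auto simp: \<rho>_def q_def)
  have fB': "f l i \<noteq> 0 \<longleftrightarrow> i = \<rho> l \<and> i \<noteq> l" if "l \<in> ?B" for i l
    unfolding supp using that arc_bounds[of q a l i] arc_bounds[of q b l i]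
    by (auto simp: \<rho>_def q_def)
  have rel: "F l * x (\<rho> l) k = F (\<rho> k) * x l (\<rho> k)" if "k \<in> ?B" "l \<in> ?B" for k l
  proof -
    have "adm p (c # a) (c # b) k l" using that adm_iff by (auto simp: q_def)
    note eq[OF this]
    also have "(\<Sum>i=1..N. f i l * x i k) = f (\<rho> l) l * x (\<rho> l) k"
      by (rule sum_single) (use B \<rho>_in(1)[OF that(2)] fB[OF that(2)] in auto)
    also have "(\<Sum>j=1..N. f k j * x l j) = f k (\<rho> k) * x l (\<rho> k)"
      by (rule sum_single) (use B \<rho>_in(1)[OF that(1)] fB'[OF that(1)] in auto)
    finally show ?thesis using \<rho>_in[OF that(1)] by (simp add: F_def)
  qed
  have ga: "graded_arcs p (c # a) (\<lambda>i j. f j i)" and gb: "graded_arcs p (c # b) f"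
    using f unfolding meander_def by blast+
  \<comment> \<open>\<open>F l * F (\<rho> l)\<close> is the square of an eigenvalue of the
    antidiagonal matrix. Its factors are the coefficients of the lower and of the upper arc joining
    \<open>l\<close> and \<open>\<rho> l\<close>, so both gradings enter; the middle vertex of an
    odd block gives 0.\<close>
  have dec: "norm (F k * F (\<rho> k)) < norm (F l * F (\<rho> l))"
    if "l \<in> ?B" "k \<in> ?B" "l < k" "k \<le> \<rho> k" for k l
  proof -
    have l: "l < \<rho> l" using that by (auto simp: \<rho>_def)
    have nz: "F l \<noteq> 0" "F (\<rho> l) \<noteq> 0"
      using fB[OF that(1)] fB[OF \<rho>_in(1)[OF that(1)]] l \<rho>_in(2)[OF that(1)] by (auto simp: F_def)
    show ?thesis
    proof (cases "k = \<rho> k")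
      case True
      then have "F k = 0" using fB[OF that(2)] by (auto simp: F_def)
      then show ?thesis using nz by simp
    next
      case False
      then have k: "k < \<rho> k" using that by simp
      have "norm (f (\<rho> k) k) < norm (f (\<rho> l) l)"
        using ga k l that unfolding graded_arcs_def by (auto simp: \<rho>_def)
      moreover have "norm (f k (\<rho> k)) < norm (f l (\<rho> l))"
        using gb k l that unfolding graded_arcs_def by (auto simp: \<rho>_def)
      ultimately show ?thesis
        using \<rho>_in(2)[OF that(1)] \<rho>_in(2)[OF that(2)]
        by (simp add: F_def norm_mult mult_strict_mono')
    qed
  qed
  have P: "k = l \<or> k = \<rho> l" if kl: "k \<in> ?B" "l \<in> ?B" and e: "F l * F (\<rho> l) = F k * F (\<rho> k)" for k l
  proof -
    have wlog: "k = l" if "k \<in> ?B" "l \<in> ?B" "k \<le> \<rho> k" "l \<le> \<rho> l"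
      "F l * F (\<rho> l) = F k * F (\<rho> k)" for k l
    proof (rule ccontr)
      assume "k \<noteq> l"
      then have "l < k \<or> k < l" by linarith
      then have "norm (F k * F (\<rho> k)) < norm (F l * F (\<rho> l)) \<or> norm (F l * F (\<rho> l)) < norm (F k * F (\<rho> k))"
        using dec[OF that(2,1) _ that(3)] dec[OF that(1,2) _ that(4)] by blast
      then show False unfolding that(5) by simp
    qed
    \<comment> \<open>The smaller vertex of a pair, to which the ordering argument applies.\<close>
    define m where "m = (\<lambda>k. if k \<le> \<rho> k then k else \<rho> k)"
    have m: "m k \<in> ?B \<and> m k \<le> \<rho> (m k) \<and> F (m k) * F (\<rho> (m k)) = F k * F (\<rho> k)" if "k \<in> ?B" for k
    proof (cases "k \<le> \<rho> k")
      case True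
      then show ?thesis using that by (simp only: m_def if_True)
    next
      case False
      then have "m k = \<rho> k" by (simp only: m_def if_False)
      then show ?thesis using False \<rho>_in[OF that] mult.commute[of "F k"] by (metis nat_le_linear)
    qed
    have "m k = m l"
      using wlog[of "m k" "m l"] m[OF kl(1)] m[OF kl(2)] e by metis
    then show ?thesis using \<rho>_in(2)[OF kl(1)] \<rho>_in(2)[OF kl(2)] unfolding m_def by metis
  qed
  have sqB: "(\<Sum>k\<in>?B. x i k * x k j) = 0" if "i \<in> ?B" "j \<in> ?B" for i j
  proof -
    have "(\<Sum>k\<in>?B. x i k * x k j) = (\<Sum>k=1..N. x i k * x k j)"
    proof (rule sum.mono_neutral_left[OF _ B])
      show "\<forall>k\<in>{1..N} - ?B. x i k * x k j = 0"
      proof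
        fix k assume "k \<in> {1..N} - ?B"
        then have "\<not> adm p (c # a) (c # b) i k"
          using that adm_iff[of i k] adm_q[of i k] by (auto simp: q_def)
        then show "x i k * x k j = 0" using xR by (metis mult_zero_left)
      qed
    qed simp
    then show ?thesis using sq' by simp
  qed
  have F0: "F l \<noteq> 0 \<longleftrightarrow> \<rho> l \<noteq> l" if "l \<in> ?B" for l
    using fB[OF that, of "\<rho> l"] unfolding F_def by blast
  have x_low: "x i j = 0" if "i \<in> ?B" "j \<in> ?B" for i j
    by (rule meander_antidiagonal_reduced[where \<rho> = \<rho> and F = F and x = x and p = p and c = c, OF _ rel _ _ P sqB that])
      (use F0 in \<open>simp_all add: \<rho>_def\<close>)
  show "x = 0"
  proof (intro ext)
    fix i j
    show "x i j = (0::cmat) i j"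
      using xR[of i j] adm_iff[of i j] adm_q[of i j] x_high[of i j] x_low[of i j]
      by (cases "x i j = 0") (auto simp: q_def)
  qed
qed

text \<open>If the first block of size \<open>a1\<close> is shorter than the first block of size \<open>a1 + d\<close> of the other
  composition, the matrices from the remaining part of the longer block to the first \<open>a1\<close> vertices
  form an abelian ideal. Restricting \<open>\<phi>\<close> to this ideal identifies the vertex \<open>i\<close> with its
  reflection \<open>\<beta> i\<close> in the longer block, and the stabilizer embeds into the stabilizer of a meander
  functional on the smaller seaweed \<open>adm p' a' b'\<close>. The vertices \<open>\<beta> i\<close> are those satisfying
  \<open>E\<close>.\<close>

locale contraction =
  fixes N p a1 d :: nat and a b :: "nat list" and f :: "nat \<Rightarrow> nat \<Rightarrow> complex"
  assumes a1: "0 < a1" "0 < d"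
    and sums: "a1 + sum_list a = a1 + d + sum_list b"
    and N: "p + a1 + sum_list a \<le> N"
    and f: "meander p (a1 # a) ((a1 + d) # b) f"
begin

definition \<beta> :: "nat \<Rightarrow> nat" where "\<beta> i = 2 * p + a1 + d + 1 - i"

text \<open>The arcs joining \<open>i\<close> to \<open>\<beta> i\<close> rescale the basis; the value at the vertices that are not
  identified is arbitrary except that \<open>h\<close> must stay monotone.\<close>

definition h :: "nat \<Rightarrow> complex" where
  "h i = (if \<beta> i > p + a1 then f i (\<beta> i) else f (p + d) (\<beta> (p + d)))"

definition E :: "nat \<Rightarrow> bool" where "E i \<longleftrightarrow> p + d < i \<and> i \<le> p + a1 + d"

text \<open>The second summand carries the coefficients among the first \<open>a1\<close> vertices
  to the reflected vertices. Its factor is inverse to the one in \<open>contract\<close>, so that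
  all transported terms of the stabilizer equation at (k, l) share the factor
  \<open>h (\<beta> l) / h (\<beta> k)\<close>.\<close>

definition f' :: "nat \<Rightarrow> nat \<Rightarrow> complex" where
  "f' i j = (if i > p + a1 \<and> j > p + a1 then f i j else 0) +
     (if E i \<and> E j then f (\<beta> i) (\<beta> j) * h (\<beta> j) / h (\<beta> i) else 0)"

text \<open>For identified vertices beyond the short block both clauses make sense;
  \<open>cross_E\<close> shows that they agree on stabilizer elements.\<close>

definition contract :: "cmat \<Rightarrow> cmat" where
  "contract x i j = (if E i \<and> E j then h (\<beta> i) / h (\<beta> j) * x (\<beta> i) (\<beta> j)
     else if i > p + a1 \<and> j > p + a1 then x i j else 0)"

text \<open>Panyushev's rule. If \<open>a1 \<le> d\<close>, the short block disappears and the long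
  one breaks into \<open>d - a1\<close> and \<open>a1\<close>. Otherwise the long block shrinks to
  \<open>a1\<close> and the short one to \<open>a1 - d\<close>, formed by the vertices of the short
  block whose reflections lie in it as well. For \<open>a1 = d\<close> a block of size 0
  arises.\<close>

definition p' :: nat where "p' = (if a1 \<le> d then p + a1 else p + d)"
definition a' :: "nat list" where "a' = (if a1 \<le> d then a else (a1 - d) # a)"
definition b' :: "nat list" where "b' = (if a1 \<le> d then (d - a1) # a1 # b else a1 # b)"

lemma supp:
  "f i j \<noteq> 0 \<longleftrightarrow> i > j \<and> (p < j \<and> i \<le> p + a1 \<and> i + j = 2 * p + a1 + 1 \<or> arc (p + a1) a i j)
     \<or> i < j \<and> (p < i \<and> j \<le> p + a1 + d \<and> i + j = 2 * p + a1 + d + 1 \<or> arc (p + a1 + d) b i j)"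
  unfolding meander_support[OF f] arc.simps add.assoc[symmetric] by auto

lemma arc_a: "arc (p + a1) a i j \<Longrightarrow> p + a1 < i \<and> p + a1 < j"
  using arc_bounds by blast

lemma arc_b: "arc (p + a1 + d) b i j \<Longrightarrow> p + a1 + d < i \<and> p + a1 + d < j"
  using arc_bounds by blast

lemma block_a: "diag_block (p + a1) a i j \<Longrightarrow> p + a1 < i \<and> p + a1 < j"
  using diag_block_bounds by blast

lemma block_b: "diag_block (p + a1 + d) b i j \<Longrightarrow> p + a1 + d < i \<and> p + a1 + d < j"
  using diag_block_bounds by blast

lemma graded:
  "graded_arcs p (a1 # a) (\<lambda>i j. f j i)" "graded_arcs p ((a1 + d) # b) f"
  using f unfolding meander_def by blast+

lemma adm_iff:
  "adm p (a1 # a) ((a1 + d) # b) i j \<longleftrightarrow>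
     i \<ge> j \<and> (p < j \<and> i \<le> p + a1 \<or> diag_block (p + a1) a i j) \<or>
     i \<le> j \<and> (p < i \<and> j \<le> p + a1 + d \<or> diag_block (p + a1 + d) b i j)"
  unfolding adm_def diag_block.simps add.assoc[symmetric] by auto

lemma adm'_iff:
  "adm p' a' b' i j \<longleftrightarrow>
     i \<ge> j \<and> (p + d < j \<and> i \<le> p + a1 \<or> diag_block (p + a1) a i j) \<or>
     i \<le> j \<and> (p + d < i \<and> j \<le> p + a1 + d \<or> p + a1 < i \<and> j \<le> p + d
       \<or> diag_block (p + a1 + d) b i j)"
proof (cases "a1 \<le> d")
  case True
  have e: "p + a1 + (d - a1) = p + d" "p + d + a1 = p + a1 + d"
    using True by auto
  show ?thesis
    unfolding adm_def p'_def a'_def b'_def if_P[OF True] diag_block.simps e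
    using True a1 by auto
next
  case False
  have e: "p + d + (a1 - d) = p + a1" "p + d + a1 = p + a1 + d"
    using False by auto
  show ?thesis
    unfolding adm_def p'_def a'_def b'_def if_not_P[OF False] diag_block.simps e
    using False a1 by auto
qed

lemma sums': "sum_list a' = sum_list b'" "p' + sum_list a' = p + a1 + sum_list a"
  "sum_list a' < sum_list (a1 # a)"
  "length a' + length b' = length (a1 # a) + length ((a1 + d) # b)"
  using sums a1 unfolding p'_def a'_def b'_def by (auto split: if_splits)

lemma \<beta>_simps:
  "E i \<Longrightarrow> p < \<beta> i \<and> \<beta> i \<le> p + a1" "E i \<Longrightarrow> \<beta> (\<beta> i) = i"
  "p < i \<Longrightarrow> i \<le> p + a1 \<Longrightarrow> E (\<beta> i) \<and> \<beta> (\<beta> i) = i"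
  using a1 unfolding E_def \<beta>_def by auto

lemma \<beta>_sum: "E i \<Longrightarrow> i + \<beta> i = 2 * p + a1 + d + 1"
  unfolding E_def \<beta>_def by auto

lemma supp_low:
  assumes "p < i" "i \<le> p + a1" "p < j" "j \<le> p + a1"
  shows "f i j \<noteq> 0 \<longleftrightarrow> i > j \<and> i + j = 2 * p + a1 + 1 \<or> i < j \<and> i + j = 2 * p + a1 + d + 1"
  using assms arc_a[of i j] arc_b[of i j] unfolding supp by auto

lemma supp_cross:
  assumes "p < i" "i \<le> p + a1" "p + a1 < j"
  shows "f i j \<noteq> 0 \<longleftrightarrow> j = \<beta> i"
  using assms arc_a[of i j] arc_b[of i j] unfolding supp \<beta>_def by auto

lemma h_nonzero:
  assumes "p < i" "i \<le> p + a1"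
  shows "h i \<noteq> 0"
proof (cases "\<beta> i > p + a1")
  case True
  then show ?thesis using supp_cross[OF assms True] by (simp add: h_def)
next
  case False
  have "p < p + d" "p + d \<le> p + a1" "p + a1 < \<beta> (p + d)"
    using False assms a1 unfolding \<beta>_def by auto
  then show ?thesis using False supp_cross[of "p + d" "\<beta> (p + d)"] by (simp add: h_def)
qed

text \<open>For arcs leaving the short block this is the grading of the long block. When the short
  block contains \<open>p + d\<close>, that is the last vertex whose reflection leaves it, so
  continuing its value as a constant keeps \<open>h\<close> monotone. In \<open>graded_b'\<close>
  this ensures that the modulus of \<open>h (\<beta> j) / h (\<beta> i)\<close> does not grow
  towards inner arcs.\<close>

lemma h_mono:
  assumes "p < i" "i < j" "j \<le> p + a1"
  shows "norm (h j) \<le> norm (h i)"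
proof -
  have less: "norm (f j (\<beta> j)) < norm (f i (\<beta> i))" if "p < i" "i < j" "j < \<beta> j" for i j
  proof -
    have "i < \<beta> i" "arc p ((a1 + d) # b) i (\<beta> i)" "arc p ((a1 + d) # b) j (\<beta> j)" "diag_block p ((a1 + d) # b) i j"
      using that unfolding \<beta>_def by auto
    then show ?thesis using graded(2) that unfolding graded_arcs_def by blast
  qed
  show ?thesis
  proof (cases "\<beta> j > p + a1")
    case True
    then have "\<beta> i > p + a1" using assms unfolding \<beta>_def by auto
    then show ?thesis using less[of i j] True assms unfolding h_def by simp
  next
    case j: False
    show ?thesis
    proof (cases "\<beta> i > p + a1")
      case True
      have "i = p + d \<or> i < p + d \<and> p + d < \<beta> (p + d)"
        using True j a1 assms unfolding \<beta>_def by auto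
      then show ?thesis using less[of i "p + d"] True j assms unfolding h_def by auto
    next
      case False
      then show ?thesis using j unfolding h_def by simp
    qed
  qed
qed

text \<open>Off the diagonal the two summands of \<open>f'\<close> never meet: two distinct
  identified vertices beyond the short block have a sum larger than
  \<open>2 * p + a1 + d + 1\<close>, the sum along arcs of the long block, and their reflections a
  smaller one. So above the diagonal only the transported summand survives, and below it, beyond the
  short block, only the original one (\<open>f'_lower_high\<close>).\<close>

lemma f'_upper_E:
  assumes "E i" "E j" "i < j"
  shows "f' i j = f (\<beta> i) (\<beta> j) * h (\<beta> j) / h (\<beta> i)"
proof -
  have "f i j = 0" if "i > p + a1"
    using supp[of i j] arc_b[of i j] assms a1 that unfolding E_def by auto
  then show ?thesis using assms unfolding f'_def by auto
qed

lemma f'_lower_high: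
  assumes "i > p + a1" "j > p + a1" "j < i"
  shows "f' i j = f i j"
proof -
  have "f (\<beta> i) (\<beta> j) = 0" if "E i" "E j"
  proof -
    note \<beta> = \<beta>_simps(1)[OF that(1)] \<beta>_simps(1)[OF that(2)] \<beta>_sum[OF that(1)] \<beta>_sum[OF that(2)]
    have "\<not> (\<beta> i > \<beta> j)" "\<beta> i + \<beta> j \<noteq> 2 * p + a1 + d + 1"
      using \<beta> assms that unfolding E_def by linarith+
    then show ?thesis using \<beta> supp_low[of "\<beta> i" "\<beta> j"] by blast
  qed
  then show ?thesis using assms unfolding f'_def by auto
qed

lemma f'_outside:
  assumes "\<not> (E i \<and> E j)"
  shows "f' i j = (if i > p + a1 \<and> j > p + a1 then f i j else 0)"
  using assms unfolding f'_def by auto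

text \<open>Arcs of the long block with both ends in the short block reappear as lower arcs of the
  first block of \<open>a'\<close>: reflection interchanges their ends, and the factor is 1 because
  \<open>h\<close> is constant there.\<close>

lemma f'_lower_low:
  assumes "p + d < j" "j < i" "i \<le> p + a1" "i + j = 2 * p + a1 + d + 1"
  shows "f' i j = f j i"
proof -
  have E: "E i" "E j" using assms a1 unfolding E_def by auto
  have \<beta>: "\<beta> i = j" "\<beta> j = i" using assms unfolding \<beta>_def by auto
  have "h i = h j" using assms \<beta> unfolding h_def by auto
  moreover have "h j \<noteq> 0" using h_nonzero[of j] assms a1 by simp
  ultimately show ?thesis using E \<beta> assms unfolding f'_def by auto
qed

lemma supp':
  "f' i j \<noteq> 0 \<longleftrightarrow> i > j \<and> (arc (p + a1) a i j \<or>
        p + d < j \<and> i \<le> p + a1 \<and> i + j = 2 * p + a1 + d + 1)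
     \<or> i < j \<and> (arc (p + a1 + d) b i j \<or> E i \<and> E j \<and> i + j = 2 * p + a1 + 2 * d + 1 \<or>
        p + a1 < i \<and> j \<le> p + d \<and> i + j = 2 * p + a1 + d + 1)"
proof -
  consider "i = j" | "i < j" "E i" "E j" | "i < j" "\<not> (E i \<and> E j)"
    | "j < i" "i > p + a1" "j > p + a1" | "j < i" "\<not> (i > p + a1 \<and> j > p + a1)" "\<not> (E i \<and> E j)"
    | "j < i" "\<not> (i > p + a1 \<and> j > p + a1)" "E i" "E j" by linarith
  then show ?thesis
  proof cases
    case 1
    then show ?thesis using supp[of i j] supp[of "\<beta> i" "\<beta> j"] unfolding f'_def by auto
  next
    case 2
    have h: "h (\<beta> i) \<noteq> 0" "h (\<beta> j) \<noteq> 0" using h_nonzero \<beta>_simps 2 by blast+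
    note \<beta> = \<beta>_simps(1)[OF 2(2)] \<beta>_simps(1)[OF 2(3)] \<beta>_sum[OF 2(2)] \<beta>_sum[OF 2(3)]
    \<comment> \<open>The sum along arcs of the short block is \<open>2 * p + a1 + 1\<close>;
      reflecting both ends subtracts it from twice \<open>2 * p + a1 + d + 1\<close>.\<close>
    have "\<beta> i > \<beta> j" "\<beta> i + \<beta> j = 2 * p + a1 + 1 \<longleftrightarrow> i + j = 2 * p + a1 + 2 * d + 1"
      using \<beta> 2 by linarith+
    then have "f (\<beta> i) (\<beta> j) \<noteq> 0 \<longleftrightarrow> i + j = 2 * p + a1 + 2 * d + 1"
      using \<beta> supp_low[of "\<beta> i" "\<beta> j"] by auto
    then show ?thesis
      using 2 h f'_upper_E[OF 2(2,3,1)] arc_b[of i j] unfolding E_def by auto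
  next
    case 3
    then show ?thesis using f'_outside[OF 3(2)] supp[of i j] arc_b[of i j] a1 unfolding E_def by auto
  next
    case 4
    then show ?thesis using f'_lower_high[OF 4(2,3,1)] supp[of i j] by auto
  next
    case 5
    then show ?thesis using f'_outside[OF 5(3)] arc_a[of i j] a1 unfolding E_def by auto
  next
    case 6
    have h: "h (\<beta> i) \<noteq> 0" "h (\<beta> j) \<noteq> 0" using h_nonzero \<beta>_simps 6 by blast+
    note \<beta> = \<beta>_simps(1)[OF 6(3)] \<beta>_simps(1)[OF 6(4)] \<beta>_sum[OF 6(3)] \<beta>_sum[OF 6(4)]
    have "\<beta> i < \<beta> j"
      "\<beta> i + \<beta> j = 2 * p + a1 + d + 1 \<longleftrightarrow> i \<le> p + a1 \<and> i + j = 2 * p + a1 + d + 1"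
      using \<beta> 6 by linarith+
    then have "f (\<beta> i) (\<beta> j) \<noteq> 0 \<longleftrightarrow> i \<le> p + a1 \<and> i + j = 2 * p + a1 + d + 1"
      using \<beta> supp_low[of "\<beta> i" "\<beta> j"] by auto
    moreover have "f' i j = f (\<beta> i) (\<beta> j) * h (\<beta> j) / h (\<beta> i)"
      using 6 unfolding f'_def by auto
    ultimately show ?thesis using 6 h arc_a[of i j] unfolding E_def by auto
  qed
qed

end

section \<open>The contracted coefficients form a graded meander\<close>

context contraction begin

lemma arc_a'_iff:
  "arc p' a' i j \<longleftrightarrow> arc (p + a1) a i j \<or>
     p + d < i \<and> i \<le> p + a1 \<and> i + j = 2 * p + a1 + d + 1"
proof (cases "a1 \<le> d")
  case False
  have e: "p + d + (a1 - d) = p + a1" "2 * (p + d) + (a1 - d) + 1 = 2 * p + a1 + d + 1"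
    using False by auto
  show ?thesis unfolding p'_def a'_def if_not_P[OF False] arc.simps e by auto
qed (auto simp: p'_def a'_def)

lemma block_a'_iff:
  "diag_block p' a' i j \<longleftrightarrow> diag_block (p + a1) a i j \<or>
     p + d < i \<and> i \<le> p + a1 \<and> p + d < j \<and> j \<le> p + a1"
proof (cases "a1 \<le> d")
  case False
  have e: "p + d + (a1 - d) = p + a1" using False by auto
  show ?thesis unfolding p'_def a'_def if_not_P[OF False] diag_block.simps e by auto
qed (auto simp: p'_def a'_def)

lemma arc_b'_iff:
  "arc p' b' i j \<longleftrightarrow> arc (p + a1 + d) b i j \<or>
     p + d < i \<and> i \<le> p + a1 + d \<and> i + j = 2 * p + a1 + 2 * d + 1 \<or>
     p + a1 < i \<and> i \<le> p + d \<and> i + j = 2 * p + a1 + d + 1"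
proof (cases "a1 \<le> d")
  case True
  have e: "p + a1 + (d - a1) = p + d" "2 * (p + a1) + (d - a1) + 1 = 2 * p + a1 + d + 1"
    "p + d + a1 = p + a1 + d" "2 * (p + d) + a1 + 1 = 2 * p + a1 + 2 * d + 1"
    using True by auto
  show ?thesis unfolding p'_def b'_def if_P[OF True] arc.simps e by blast
next
  case False
  have e: "p + d + a1 = p + a1 + d" "2 * (p + d) + a1 + 1 = 2 * p + a1 + 2 * d + 1"
    by auto
  have "\<not> (p + a1 < i \<and> i \<le> p + d)" using False by linarith
  then show ?thesis unfolding p'_def b'_def if_not_P[OF False] arc.simps e by blast
qed

lemma block_b'_iff:
  "diag_block p' b' i j \<longleftrightarrow> diag_block (p + a1 + d) b i j \<or>
     p + d < i \<and> i \<le> p + a1 + d \<and> p + d < j \<and> j \<le> p + a1 + d \<or>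
     p + a1 < i \<and> i \<le> p + d \<and> p + a1 < j \<and> j \<le> p + d"
proof (cases "a1 \<le> d")
  case True
  have e: "p + a1 + (d - a1) = p + d" "p + d + a1 = p + a1 + d"
    using True by auto
  show ?thesis unfolding p'_def b'_def if_P[OF True] diag_block.simps e by blast
next
  case False
  have e: "p + d + a1 = p + a1 + d" by auto
  have "\<not> (p + a1 < i \<and> i \<le> p + d)" using False by linarith
  then show ?thesis unfolding p'_def b'_def if_not_P[OF False] diag_block.simps e by blast
qed

lemma graded_a': "graded_arcs p' a' (\<lambda>i j. f' j i)"
  unfolding graded_arcs_def
proof (intro allI impI)
  fix i j k l
  assume *: "i < j" "k < l" "arc p' a' i j" "arc p' a' k l" "diag_block p' a' i k" "i < k"
  consider "diag_block (p + a1) a i k" | "p + d < i" "i \<le> p + a1" "p + d < k" "k \<le> p + a1"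
    using *(5) unfolding block_a'_iff by blast
  then show "norm (f' l k) < norm (f' j i)"
  proof cases
    case 1
    have gt: "i > p + a1" "k > p + a1" using block_a[OF 1] by auto
    then have arcs: "arc (p + a1) a i j" "arc (p + a1) a k l"
      using *(3,4) unfolding arc_a'_iff by auto
    then have "norm (f l k) < norm (f j i)"
      using graded(1) 1 * unfolding graded_arcs_def by (meson arc.simps(2) diag_block.simps(2))
    moreover have "f' j i = f j i" "f' l k = f l k"
      using f'_lower_high gt arc_a[OF arcs(1)] arc_a[OF arcs(2)] * by blast+
    ultimately show ?thesis by simp
  next
    case 2
    then have s: "i + j = 2 * p + a1 + d + 1" "k + l = 2 * p + a1 + d + 1"
      using *(3,4) arc_a[of i j] arc_a[of k l] unfolding arc_a'_iff by auto
    have "f' j i = f i j" "f' l k = f k l"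
      using f'_lower_low 2 s * by auto
    moreover have "arc p ((a1 + d) # b) i j" "arc p ((a1 + d) # b) k l" "diag_block p ((a1 + d) # b) i k"
      using s 2 by auto
    then have "norm (f k l) < norm (f i j)"
      using graded(2) * unfolding graded_arcs_def by blast
    ultimately show ?thesis by simp
  qed
qed

lemma graded_b': "graded_arcs p' b' f'"
  unfolding graded_arcs_def
proof (intro allI impI)
  fix i j k l
  assume *: "i < j" "k < l" "arc p' b' i j" "arc p' b' k l" "diag_block p' b' i k" "i < k"
  consider "diag_block (p + a1 + d) b i k"
    | "p + d < i" "i \<le> p + a1 + d" "p + d < k" "k \<le> p + a1 + d"
    | "p + a1 < i" "i \<le> p + d" "p + a1 < k" "k \<le> p + d"
    using *(5) unfolding block_b'_iff by blast
  then show "norm (f' k l) < norm (f' i j)"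
  proof cases
    case 1
    have gt: "i > p + a1 + d" "k > p + a1 + d" using block_b[OF 1] by auto
    then have arcs: "arc (p + a1 + d) b i j" "arc (p + a1 + d) b k l"
      using *(3,4) unfolding arc_b'_iff by auto
    then have "arc p ((a1 + d) # b) i j" "arc p ((a1 + d) # b) k l" "diag_block p ((a1 + d) # b) i k"
      using 1 by (simp_all add: add.assoc)
    then have "norm (f k l) < norm (f i j)"
      using graded(2) * unfolding graded_arcs_def by blast
    moreover have "f' i j = f i j" "f' k l = f k l"
      using f'_outside[of i j] f'_outside[of k l] gt arc_b[OF arcs(1)] arc_b[OF arcs(2)] by (auto simp: E_def)
    ultimately show ?thesis by simp
  next
    case 2
    then have s: "i + j = 2 * p + a1 + 2 * d + 1" "k + l = 2 * p + a1 + 2 * d + 1"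
      using *(3,4) arc_b[of i j] arc_b[of k l] unfolding arc_b'_iff by auto
    have E: "E i" "E j" "E k" "E l" using 2 s * unfolding E_def by auto
    note \<beta> = E[THEN \<beta>_sum] E[THEN \<beta>_simps(1)]
    have less: "\<beta> j < \<beta> l" "\<beta> k < \<beta> i" "\<beta> j < \<beta> i" "\<beta> l < \<beta> k"
      "\<beta> i + \<beta> j = 2 * p + a1 + 1" "\<beta> k + \<beta> l = 2 * p + a1 + 1"
      using \<beta> s * by linarith+
    have "arc p (a1 # a) (\<beta> j) (\<beta> i)" "arc p (a1 # a) (\<beta> l) (\<beta> k)" "diag_block p (a1 # a) (\<beta> j) (\<beta> l)"
      using \<beta> less by auto
    then have 1: "norm (f (\<beta> k) (\<beta> l)) < norm (f (\<beta> i) (\<beta> j))"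
      using graded(1) less unfolding graded_arcs_def by blast
    have 2: "norm (h (\<beta> l)) \<le> norm (h (\<beta> j))" "norm (h (\<beta> i)) \<le> norm (h (\<beta> k))"
      using h_mono \<beta> less by blast+
    have 3: "norm (h (\<beta> l)) > 0" "norm (h (\<beta> i)) > 0"
      using h_nonzero \<beta> by simp_all
    have "norm (f (\<beta> k) (\<beta> l)) * norm (h (\<beta> l)) < norm (f (\<beta> i) (\<beta> j)) * norm (h (\<beta> j))"
      using 1 2(1) 3(1) by (intro mult_less_le_imp_less) auto
    then have "norm (f (\<beta> k) (\<beta> l)) * norm (h (\<beta> l)) / norm (h (\<beta> k)) <
        norm (f (\<beta> i) (\<beta> j)) * norm (h (\<beta> j)) / norm (h (\<beta> i))"
      using 2(2) 3(2) by (intro frac_less) auto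
    then show ?thesis
      unfolding f'_upper_E[OF E(1,2) *(1)] f'_upper_E[OF E(3,4) *(2)]
      by (simp add: norm_mult norm_divide)
  next
    case 3
    then have s: "i + j = 2 * p + a1 + d + 1" "k + l = 2 * p + a1 + d + 1"
      using *(3,4) arc_b[of i j] arc_b[of k l] unfolding arc_b'_iff by auto
    have "f' i j = f i j" "f' k l = f k l"
      using f'_outside[of i j] f'_outside[of k l] 3 s * by (auto simp: E_def)
    moreover have "arc p ((a1 + d) # b) i j" "arc p ((a1 + d) # b) k l" "diag_block p ((a1 + d) # b) i k"
      using s 3 by auto
    then have "norm (f k l) < norm (f i j)"
      using graded(2) * unfolding graded_arcs_def by blast
    ultimately show ?thesis by simp
  qed
qed

lemma meander': "meander p' a' b' f'"
  unfolding meander_def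
proof (intro conjI allI graded_a' graded_b')
  fix i j
  show "f' i j \<noteq> 0 \<longleftrightarrow> i > j \<and> arc p' a' i j \<or> i < j \<and> arc p' b' i j"
    unfolding supp' arc_a'_iff arc_b'_iff using a1 by (auto simp: E_def)
qed

end

section \<open>Stabilizer elements under contraction\<close>

context contraction begin

abbreviation R :: "nat \<Rightarrow> nat \<Rightarrow> bool" where "R \<equiv> adm p (a1 # a) ((a1 + d) # b)"

lemma R_bounds: "R i j \<Longrightarrow> p < i \<and> i \<le> N \<and> p < j \<and> j \<le> N"
  using adm_bounds[of p "a1 # a" "(a1 + d) # b" i j "a1 + sum_list a"] sums N by auto

lemma R_col_low: "R i j \<Longrightarrow> j \<le> p + a1 \<Longrightarrow> i \<le> p + a1"
  unfolding adm_iff using block_a[of i j] by auto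

lemma R_row_low: "R i j \<Longrightarrow> i \<le> p + a1 \<Longrightarrow> j \<le> p + a1 + d"
  unfolding adm_iff using block_a[of i j] block_b[of i j] by auto

lemma R_row_mid: "R i j \<Longrightarrow> p + a1 < i \<Longrightarrow> i \<le> p + a1 + d \<Longrightarrow> p + a1 < j \<and> j \<le> p + a1 + d"
  unfolding adm_iff using block_a[of i j] block_b[of i j] by auto

lemma R_row_high: "R i j \<Longrightarrow> p + a1 < i \<Longrightarrow> p + a1 < j"
  unfolding adm_iff using block_a[of i j] block_b[of i j] by auto

lemma R_low: "p < i \<Longrightarrow> i \<le> p + a1 \<Longrightarrow> p < j \<Longrightarrow> j \<le> p + a1 \<Longrightarrow> R i j"
  unfolding adm_iff by auto

lemma adm'_high: "adm p' a' b' i j \<Longrightarrow> p + a1 < i \<Longrightarrow> p + a1 < j"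
  unfolding adm'_iff using block_a[of i j] by auto

lemma adm'_R: "adm p' a' b' i j \<Longrightarrow> p + a1 < i \<Longrightarrow> p + a1 < j \<Longrightarrow> R i j"
  unfolding adm'_iff adm_iff by auto

lemma adm'_col_E: "adm p' a' b' k l \<Longrightarrow> E l \<Longrightarrow> \<not> E k \<Longrightarrow> k > p + a1 + d"
  unfolding adm'_iff E_def using block_a[of k l] block_b[of k l] by auto

lemma adm'_row_E: "adm p' a' b' k l \<Longrightarrow> E k \<Longrightarrow> \<not> E l \<Longrightarrow> p + a1 < l \<and> l \<le> p + d"
  unfolding adm'_iff E_def using block_a[of k l] block_b[of k l] by auto

lemma f_low_high: "f i l \<noteq> 0 \<Longrightarrow> i \<le> p + a1 \<Longrightarrow> p + a1 < l \<Longrightarrow> p < i \<and> l = \<beta> i"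
  using supp[of i l] arc_a[of i l] arc_b[of i l] supp_cross[of i l] by auto

lemma sum_E: "(\<Sum>i=1..N. if E i then g (\<beta> i) else 0) = (\<Sum>i\<in>{p<..p + a1}. g i :: complex)"
proof -
  have "(\<Sum>i=1..N. if E i then g (\<beta> i) else 0) = (\<Sum>i\<in>{i \<in> {1..N}. E i}. g (\<beta> i))"
    by (rule sum.inter_filter[symmetric]) simp
  also have "\<dots> = (\<Sum>i\<in>{p<..p + a1}. g i)"
  proof (rule sum.reindex_bij_witness[of _ \<beta> \<beta>])
    fix i assume "i \<in> {p<..p + a1}"
    then have "E (\<beta> i)" "\<beta> (\<beta> i) = i" using \<beta>_simps(3) by auto
    moreover from this(1) have "1 \<le> \<beta> i" "\<beta> i \<le> N" using sums N unfolding E_def by auto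
    ultimately show "\<beta> (\<beta> i) = i" "\<beta> i \<in> {i \<in> {1..N}. E i}" by auto
  qed (use \<beta>_simps(1,2) in auto)
  finally show ?thesis .
qed

context
  fixes x :: cmat
  assumes st: "stab N R f x"
begin

lemma stab_support: "x i j \<noteq> 0 \<Longrightarrow> R i j"
  using st unfolding stab_def by blast

lemma stab_eq: "R k l \<Longrightarrow> (\<Sum>i=1..N. f i l * x i k) = (\<Sum>j=1..N. f k j * x l j)"
  using st unfolding stab_def by blast

text \<open>The stabilizer equation at a position of the abelian ideal. The block-triangular shape
  of \<open>x\<close> leaves on each side at most one term, that of an arc joining the short block
  to the rest of the long one.\<close>

lemma cross_eq:
  assumes k: "p < k" "k \<le> p + a1" and l: "p + a1 < l" "l \<le> p + a1 + d"
  shows "(if E l then f (\<beta> l) l * x (\<beta> l) k else 0) =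
    (if \<beta> k > p + a1 then f k (\<beta> k) * x l (\<beta> k) else 0)"
proof -
  have "R k l" using k l unfolding adm_iff by auto
  note stab_eq[OF this]
  moreover have L: "f i l * x i k = 0" if "\<not> (E l \<and> i = \<beta> l)" for i
  proof (rule ccontr)
    assume "f i l * x i k \<noteq> 0"
    then have nz: "f i l \<noteq> 0" "x i k \<noteq> 0" by auto
    have "i \<le> p + a1" using R_col_low[OF stab_support[OF nz(2)] k(2)] .
    then have "p < i" "l = \<beta> i" using f_low_high[OF nz(1)] l(1) by blast+
    then have "E l" "\<beta> l = i" using \<beta>_simps(3)[of i] \<open>i \<le> p + a1\<close> by auto
    then show False using that by auto
  qed
  moreover have "(\<Sum>i=1..N. f i l * x i k) = (if E l then f (\<beta> l) l * x (\<beta> l) k else 0)"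
  proof (cases "E l")
    case True
    have "(\<Sum>i=1..N. f i l * x i k) = f (\<beta> l) l * x (\<beta> l) k"
      by (rule sum_single) (use L True \<beta>_simps(1)[OF True] N in auto)
    then show ?thesis using True by simp
  next
    case False
    have "(\<Sum>i=1..N. f i l * x i k) = 0" by (rule sum.neutral) (use L False in blast)
    then show ?thesis using False by simp
  qed
  moreover have U: "f k j * x l j = 0" if "\<not> (\<beta> k > p + a1 \<and> j = \<beta> k)" for j
  proof (rule ccontr)
    assume "f k j * x l j \<noteq> 0"
    then have nz: "f k j \<noteq> 0" "x l j \<noteq> 0" by auto
    have "p + a1 < j" using R_row_mid[OF stab_support[OF nz(2)] l] by blast
    then show False using that f_low_high[OF nz(1) k(2)] by auto
  qed
  moreover have "(\<Sum>j=1..N. f k j * x l j) = (if \<beta> k > p + a1 then f k (\<beta> k) * x l (\<beta> k) else 0)"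
  proof (cases "\<beta> k > p + a1")
    case True
    have "E (\<beta> k)" using \<beta>_simps(3) k by blast
    then have "\<beta> k \<in> {1..N}" using sums N unfolding E_def by auto
    then have "(\<Sum>j=1..N. f k j * x l j) = f k (\<beta> k) * x l (\<beta> k)"
      by (intro sum_single) (use U True in auto)
    then show ?thesis using True by simp
  next
    case False
    have "(\<Sum>j=1..N. f k j * x l j) = 0" by (rule sum.neutral) (use U False in blast)
    then show ?thesis using False by simp
  qed
  ultimately show ?thesis by simp
qed

text \<open>This and the next two lemmas read off \<open>cross_eq\<close>: if both sides have an
  arc, the two entries agree up to \<open>h\<close>; if only one side has an arc, the entry on that
  side vanishes (\<open>mid_zero\<close>, \<open>low_zero\<close>).\<close>

lemma cross_E:
  assumes "E i" "E k" "i > p + a1" "k > p + a1"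
  shows "x i k = h (\<beta> i) / h (\<beta> k) * x (\<beta> i) (\<beta> k)"
proof -
  note \<beta> = \<beta>_simps(1,2)[OF assms(1)] \<beta>_simps(1,2)[OF assms(2)]
  have "f (\<beta> i) i * x (\<beta> i) (\<beta> k) = f (\<beta> k) k * x i k"
    using cross_eq[of "\<beta> k" i] \<beta> assms unfolding E_def by auto
  moreover have "h (\<beta> i) = f (\<beta> i) i" "h (\<beta> k) = f (\<beta> k) k"
    using \<beta> assms unfolding h_def by auto
  ultimately show ?thesis using h_nonzero[of "\<beta> k"] \<beta> by (simp add: field_simps)
qed

lemma mid_zero:
  assumes "p + a1 < l" "l \<le> p + d" "E j" "j > p + a1"
  shows "x l j = 0"
proof -
  note \<beta> = \<beta>_simps(1,2)[OF assms(3)]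
  have "f (\<beta> j) j * x l j = 0"
    using cross_eq[of "\<beta> j" l] \<beta> assms unfolding E_def by auto
  moreover have "f (\<beta> j) j \<noteq> 0" using supp_cross[of "\<beta> j" j] \<beta> assms by auto
  ultimately show ?thesis by simp
qed

lemma low_zero:
  assumes "p < i" "i \<le> p + a1" "p < k" "k \<le> p + a1" "\<beta> i > p + a1" "\<beta> k \<le> p + a1"
  shows "x i k = 0"
proof -
  have \<beta>: "E (\<beta> i)" "\<beta> (\<beta> i) = i" using \<beta>_simps(3) assms by auto
  have "f i (\<beta> i) * x i k = 0"
    using cross_eq[of k "\<beta> i"] \<beta> assms unfolding E_def by auto
  moreover have "f i (\<beta> i) \<noteq> 0" using supp_cross assms by auto
  ultimately show ?thesis by simp
qed

abbreviation "y \<equiv> contract x"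

lemma y_E: "E i \<Longrightarrow> E j \<Longrightarrow> y i j = h (\<beta> i) / h (\<beta> j) * x (\<beta> i) (\<beta> j)"
  unfolding contract_def by simp

lemma y_high: "i > p + a1 \<Longrightarrow> j > p + a1 \<Longrightarrow> y i j = x i j"
  unfolding contract_def using cross_E by auto

lemma y_zero: "\<not> (E i \<and> E j) \<Longrightarrow> \<not> (i > p + a1 \<and> j > p + a1) \<Longrightarrow> y i j = 0"
  unfolding contract_def by auto

text \<open>\<open>mid_zero\<close> and \<open>low_zero\<close> supply the zeros that the smaller
  seaweed demands beyond those of the larger one.\<close>

lemma y_adm': assumes nz: "y i j \<noteq> 0" shows "adm p' a' b' i j"
proof (cases "i > p + a1 \<and> j > p + a1")
  case True
  then have xnz: "x i j \<noteq> 0" using nz y_high by simp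
  then have "R i j" by (rule stab_support)
  moreover have "\<not> (i \<le> p + d \<and> E j)" using mid_zero[of i j] xnz True by blast
  ultimately show ?thesis using True block_b[of i j] unfolding adm'_iff adm_iff E_def by auto
next
  case False
  then have E: "E i" "E j" using nz y_zero by blast+
  have "\<not> (i > p + a1 \<and> j \<le> p + a1)"
  proof
    assume *: "i > p + a1 \<and> j \<le> p + a1"
    have "x (\<beta> i) (\<beta> j) = 0"
      by (rule low_zero) (use * \<beta>_simps(1,2)[OF E(1)] \<beta>_simps(1,2)[OF E(2)] in auto)
    then show False using nz y_E[OF E] by simp
  qed
  then show ?thesis using E False unfolding adm'_iff E_def by auto
qed

lemma y_col_low: "i > p + a1 \<Longrightarrow> j \<le> p + a1 \<Longrightarrow> y i j = 0"
  using y_adm'[of i j] adm'_high[of i j] by fastforce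

text \<open>Here and in the next three lemmas each side of the stabilizer equation for
  \<open>f'\<close> is split along the two summands of \<open>f'\<close>. The transported summand
  reproduces the equation of \<open>x\<close> at (\<open>\<beta> k\<close>,
  \<open>\<beta> l\<close>), the other one that at (k, l); in each of the two equations one side
  lacks the term of an arc between the short block and the rest.\<close>

lemma left_low:
  assumes kl: "adm p' a' b' k l"
  shows "(\<Sum>i=1..N. (if E i \<and> E l then f (\<beta> i) (\<beta> l) * h (\<beta> l) / h (\<beta> i) else 0) * y i k) =
    (if E k \<and> E l then h (\<beta> l) / h (\<beta> k) * (\<Sum>i=1..N. f i (\<beta> l) * x i (\<beta> k)) else 0)"
proof (cases "E l")
  case El: True
  show ?thesis
  proof (cases "E k")
    case Ek: True
    have "(\<Sum>i=1..N. (if E i \<and> E l then f (\<beta> i) (\<beta> l) * h (\<beta> l) / h (\<beta> i) else 0) * y i k) =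
        (\<Sum>i=1..N. if E i then h (\<beta> l) / h (\<beta> k) * (f (\<beta> i) (\<beta> l) * x (\<beta> i) (\<beta> k)) else 0)"
    proof (rule sum.cong[OF refl])
      fix i
      have "h (\<beta> i) \<noteq> 0" if "E i" using h_nonzero \<beta>_simps(1)[OF that] by blast
      then show "(if E i \<and> E l then f (\<beta> i) (\<beta> l) * h (\<beta> l) / h (\<beta> i) else 0) * y i k =
          (if E i then h (\<beta> l) / h (\<beta> k) * (f (\<beta> i) (\<beta> l) * x (\<beta> i) (\<beta> k)) else 0)"
        using El Ek y_E[of i k] by simp
    qed
    also have "\<dots> = (\<Sum>i\<in>{p<..p + a1}. h (\<beta> l) / h (\<beta> k) * (f i (\<beta> l) * x i (\<beta> k)))"
      by (rule sum_E)
    also have "\<dots> = h (\<beta> l) / h (\<beta> k) * (\<Sum>i\<in>{p<..p + a1}. f i (\<beta> l) * x i (\<beta> k))"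
      by (simp add: sum_distrib_left)
    also have "(\<Sum>i\<in>{p<..p + a1}. f i (\<beta> l) * x i (\<beta> k)) = (\<Sum>i=1..N. f i (\<beta> l) * x i (\<beta> k))"
    proof (rule sum.mono_neutral_left)
      show "\<forall>i\<in>{1..N} - {p<..p + a1}. f i (\<beta> l) * x i (\<beta> k) = 0"
      proof
        fix i assume i: "i \<in> {1..N} - {p<..p + a1}"
        have "x i (\<beta> k) = 0"
        proof (rule ccontr)
          assume "x i (\<beta> k) \<noteq> 0"
          then have "R i (\<beta> k)" by (rule stab_support)
          then show False using i R_col_low[of i "\<beta> k"] R_bounds[of i "\<beta> k"] \<beta>_simps(1)[OF Ek] by auto
        qed
        then show "f i (\<beta> l) * x i (\<beta> k) = 0" by simp
      qed
    qed (use N in auto)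
    finally show ?thesis using Ek El by simp
  next
    case Ek: False
    then have k: "k > p + a1 + d" using adm'_col_E kl El by blast
    have "y i k = 0" if "E i" for i
    proof (rule ccontr)
      assume nz: "y i k \<noteq> 0"
      then have "i > p + a1" using y_zero[of i k] Ek by blast
      then have "x i k \<noteq> 0" using nz y_high k by simp
      then show False using R_row_mid[OF stab_support, of i k] \<open>i > p + a1\<close> k that unfolding E_def by auto
    qed
    then have "(\<Sum>i=1..N. (if E i \<and> E l then f (\<beta> i) (\<beta> l) * h (\<beta> l) / h (\<beta> i) else 0) * y i k) = 0"
      by (intro sum.neutral) auto
    then show ?thesis using Ek by simp
  qed
qed simp

lemma left_high:
  assumes kl: "adm p' a' b' k l"
  shows "(\<Sum>i=1..N. (if i > p + a1 \<and> l > p + a1 then f i l else 0) * y i k) =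
    (if k > p + a1 \<and> l > p + a1 then
      (\<Sum>i=1..N. f i l * x i k) - (if E l then f (\<beta> l) l * x (\<beta> l) k else 0) else 0)"
proof (cases "k > p + a1 \<and> l > p + a1")
  case True
  have "(\<Sum>i=1..N. f i l * x i k) =
      (\<Sum>i=1..N. (if i > p + a1 \<and> l > p + a1 then f i l else 0) * y i k) +
      (\<Sum>i=1..N. if i \<le> p + a1 then f i l * x i k else 0)"
    unfolding sum.distrib[symmetric] by (rule sum.cong) (use True y_high in auto)
  also have "(\<Sum>i=1..N. if i \<le> p + a1 then f i l * x i k else 0) =
      (if E l then f (\<beta> l) l * x (\<beta> l) k else 0)"
  proof -
    have z: "E l \<and> i = \<beta> l" if "i \<le> p + a1" "f i l * x i k \<noteq> 0" for i
    proof -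
      have "p < i" "l = \<beta> i" using f_low_high[of i l] that True by auto
      then show ?thesis using \<beta>_simps(3)[of i] that by auto
    qed
    show ?thesis
    proof (cases "E l")
      case El: True
      have "(\<Sum>i=1..N. if i \<le> p + a1 then f i l * x i k else 0) =
          (if \<beta> l \<le> p + a1 then f (\<beta> l) l * x (\<beta> l) k else 0)"
        by (rule sum_single) (use z \<beta>_simps(1)[OF El] N in auto)
      then show ?thesis using El \<beta>_simps(1)[OF El] by simp
    next
      case False
      then have "(\<Sum>i=1..N. if i \<le> p + a1 then f i l * x i k else 0) = 0"
        by (intro sum.neutral) (use z in auto)
      then show ?thesis using False by simp
    qed
  qed
  finally show ?thesis using True by simp
next
  case False
  have "(\<Sum>i=1..N. (if i > p + a1 \<and> l > p + a1 then f i l else 0) * y i k) = 0"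
    by (rule sum.neutral) (use False y_col_low in auto)
  then show ?thesis using False by auto
qed

lemma right_high:
  assumes kl: "adm p' a' b' k l"
  shows "(\<Sum>j=1..N. (if k > p + a1 \<and> j > p + a1 then f k j else 0) * y l j) =
    (if k > p + a1 \<and> l > p + a1 then (\<Sum>j=1..N. f k j * x l j) else 0)"
proof (cases "k > p + a1")
  case True
  then have l: "l > p + a1" using adm'_high kl by blast
  have "(\<Sum>j=1..N. (if k > p + a1 \<and> j > p + a1 then f k j else 0) * y l j) = (\<Sum>j=1..N. f k j * x l j)"
  proof (rule sum.cong[OF refl])
    fix j
    have "x l j = 0" if "j \<le> p + a1" using R_row_high[OF stab_support, of l j] l that by fastforce
    then show "(if k > p + a1 \<and> j > p + a1 then f k j else 0) * y l j = f k j * x l j"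
      using True l y_high by auto
  qed
  then show ?thesis using True l by simp
qed simp

lemma right_low:
  assumes kl: "adm p' a' b' k l"
  shows "(\<Sum>j=1..N. (if E k \<and> E j then f (\<beta> k) (\<beta> j) * h (\<beta> j) / h (\<beta> k) else 0) * y l j) =
    (if E k \<and> E l then h (\<beta> l) / h (\<beta> k) * ((\<Sum>j=1..N. f (\<beta> k) j * x (\<beta> l) j) -
      (if k > p + a1 then f (\<beta> k) k * x (\<beta> l) k else 0)) else 0)"
proof (cases "E k")
  case Ek: True
  note \<beta>k = \<beta>_simps(1,2)[OF Ek]
  show ?thesis
  proof (cases "E l")
    case El: True
    have "(\<Sum>j=1..N. (if E k \<and> E j then f (\<beta> k) (\<beta> j) * h (\<beta> j) / h (\<beta> k) else 0) * y l j) =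
        (\<Sum>j=1..N. if E j then h (\<beta> l) / h (\<beta> k) * (f (\<beta> k) (\<beta> j) * x (\<beta> l) (\<beta> j)) else 0)"
    proof (rule sum.cong[OF refl])
      fix j
      have "h (\<beta> j) \<noteq> 0" if "E j" using h_nonzero \<beta>_simps(1)[OF that] by blast
      then show "(if E k \<and> E j then f (\<beta> k) (\<beta> j) * h (\<beta> j) / h (\<beta> k) else 0) * y l j =
          (if E j then h (\<beta> l) / h (\<beta> k) * (f (\<beta> k) (\<beta> j) * x (\<beta> l) (\<beta> j)) else 0)"
        using El Ek y_E[of l j] by simp
    qed
    also have "\<dots> = (\<Sum>j\<in>{p<..p + a1}. h (\<beta> l) / h (\<beta> k) * (f (\<beta> k) j * x (\<beta> l) j))"
      by (rule sum_E)
    also have "\<dots> = h (\<beta> l) / h (\<beta> k) * (\<Sum>j\<in>{p<..p + a1}. f (\<beta> k) j * x (\<beta> l) j)"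
      by (simp add: sum_distrib_left)
    also have "(\<Sum>j\<in>{p<..p + a1}. f (\<beta> k) j * x (\<beta> l) j) =
        (\<Sum>j=1..N. f (\<beta> k) j * x (\<beta> l) j) - (if k > p + a1 then f (\<beta> k) k * x (\<beta> l) k else 0)"
    proof -
      have k: "k \<in> {1..N}" using Ek sums N unfolding E_def by auto
      have "(\<Sum>j=1..N. f (\<beta> k) j * x (\<beta> l) j) =
          (\<Sum>j\<in>{p<..p + a1}. f (\<beta> k) j * x (\<beta> l) j) + (\<Sum>j\<in>{1..N} - {p<..p + a1}. f (\<beta> k) j * x (\<beta> l) j)"
        using N by (subst add.commute, intro sum.subset_diff) auto
      also have "(\<Sum>j\<in>{1..N} - {p<..p + a1}. f (\<beta> k) j * x (\<beta> l) j) =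
          (if k > p + a1 then f (\<beta> k) k * x (\<beta> l) k else 0)"
      proof -
        have z: "k > p + a1 \<and> j = k" if "j \<notin> {p<..p + a1}" "f (\<beta> k) j * x (\<beta> l) j \<noteq> 0" for j
        proof -
          have "R (\<beta> l) j" using stab_support that(2) by auto
          then have "j > p + a1" using R_bounds that(1) by fastforce
          then show ?thesis using f_low_high[of "\<beta> k" j] \<beta>k that by auto
        qed
        show ?thesis
        proof (cases "k > p + a1")
          case True
          have "(\<Sum>j\<in>{1..N} - {p<..p + a1}. f (\<beta> k) j * x (\<beta> l) j) = f (\<beta> k) k * x (\<beta> l) k"
            by (rule sum_single) (use z k True in auto)
          then show ?thesis using True by simp
        next
          case False
          then have "f (\<beta> k) j * x (\<beta> l) j = 0" if "j \<notin> {p<..p + a1}" for j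
            using z that by blast
          then have "(\<Sum>j\<in>{1..N} - {p<..p + a1}. f (\<beta> k) j * x (\<beta> l) j) = 0"
            by (intro sum.neutral) blast
          then show ?thesis using False by simp
        qed
      qed
      finally show ?thesis by simp
    qed
    finally show ?thesis using Ek El by simp
  next
    case El: False
    then have l: "p + a1 < l" "l \<le> p + d" using adm'_row_E kl Ek by blast+
    have "y l j = 0" if "E j" for j
      using y_zero[of l j] y_high[of l j] mid_zero[OF l that] El by (cases "j > p + a1") auto
    then have "(\<Sum>j=1..N. (if E k \<and> E j then f (\<beta> k) (\<beta> j) * h (\<beta> j) / h (\<beta> k) else 0) * y l j) = 0"
      by (intro sum.neutral) auto
    then show ?thesis using El by simp
  qed
qed simp

lemma stab_contract: "stab N (adm p' a' b') f' y"
  unfolding stab_def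
proof (intro conjI allI impI)
  show "adm p' a' b' i j" if "y i j \<noteq> 0" for i j using y_adm' that .
next
  fix k l assume kl: "adm p' a' b' k l"
  have L: "(\<Sum>i=1..N. f' i l * y i k) = (if k > p + a1 \<and> l > p + a1 then
      (\<Sum>i=1..N. f i l * x i k) - (if E l then f (\<beta> l) l * x (\<beta> l) k else 0) else 0) +
      (if E k \<and> E l then h (\<beta> l) / h (\<beta> k) * (\<Sum>i=1..N. f i (\<beta> l) * x i (\<beta> k)) else 0)"
    unfolding f'_def ring_distribs(2) sum.distrib left_low[OF kl] left_high[OF kl] ..
  have U: "(\<Sum>j=1..N. f' k j * y l j) = (if k > p + a1 \<and> l > p + a1 then (\<Sum>j=1..N. f k j * x l j) else 0) +
      (if E k \<and> E l then h (\<beta> l) / h (\<beta> k) * ((\<Sum>j=1..N. f (\<beta> k) j * x (\<beta> l) j) -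
      (if k > p + a1 then f (\<beta> k) k * x (\<beta> l) k else 0)) else 0)"
    unfolding f'_def ring_distribs(2) sum.distrib right_low[OF kl] right_high[OF kl] ..
  have high: "(\<Sum>i=1..N. f i l * x i k) = (\<Sum>j=1..N. f k j * x l j)" if "k > p + a1" "l > p + a1"
    using stab_eq adm'_R[OF kl that] by blast
  show "(\<Sum>i=1..N. f' i l * y i k) = (\<Sum>j=1..N. f' k j * y l j)"
  proof (cases "E k \<and> E l")
    case False
    have "x (\<beta> l) k = 0" if "E l" "k > p + a1"
    proof (rule ccontr)
      assume "x (\<beta> l) k \<noteq> 0"
      then have "k \<le> p + a1 + d" using R_row_low[OF stab_support] \<beta>_simps(1)[OF that(1)] by blast
      moreover have "k > p + a1 + d" using adm'_col_E[OF kl that(1)] False that(1) by blast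
      ultimately show False by simp
    qed
    then show ?thesis unfolding L U using False high by auto
  next
    case True
    then have Ek: "E k" and El: "E l" by auto
    note \<beta> = \<beta>_simps(1,2)[OF Ek] \<beta>_simps(1,2)[OF El]
    have low: "(\<Sum>i=1..N. f i (\<beta> l) * x i (\<beta> k)) = (\<Sum>j=1..N. f (\<beta> k) j * x (\<beta> l) j)"
      using stab_eq R_low \<beta> by blast
    have hk: "h (\<beta> k) \<noteq> 0" using h_nonzero \<beta> by blast
    show ?thesis
    proof (cases "k > p + a1")
      case k: True
      then have l: "l > p + a1" using adm'_high kl by blast
      \<comment> \<open>Here \<open>h\<close> takes the coefficients of the arcs leaving the short
        block, so the term missing on the left in \<open>left_high\<close> equals the scaled term
        missing on the right in \<open>right_low\<close>.\<close>
      have "h (\<beta> l) = f (\<beta> l) l" "h (\<beta> k) = f (\<beta> k) k"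
        using \<beta> k l unfolding h_def by auto
      then show ?thesis unfolding L U using True k l high low hk by (simp add: algebra_simps)
    next
      case False
      then show ?thesis unfolding L U using True low by simp
    qed
  qed
qed

text \<open>Each entry of the square of \<open>y\<close> either is an entry of the square of
  \<open>x\<close> up to a factor or has only zero summands. Between vertices in \<open>E\<close>, a
  path through a vertex outside \<open>E\<close> contributes nothing by \<open>mid_zero\<close>; the
  remaining mixed positions admit no path.\<close>

lemma square_contract:
  assumes sq: "mat_prod N x x = 0"
  shows "mat_prod N y y = 0"
proof (intro ext)
  fix i j
  have sq': "(\<Sum>k=1..N. x i k * x k j) = 0" for i j
    using fun_cong[OF fun_cong[OF sq], of i j] by (simp add: mat_prod_def)
  consider "E i" "E j" | "\<not> (E i \<and> E j)" "i > p + a1" "j > p + a1"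
    | "\<not> (E i \<and> E j)" "\<not> (i > p + a1 \<and> j > p + a1)" by blast
  then have "(\<Sum>k=1..N. y i k * y k j) = 0"
  proof cases
    case 1
    note \<beta> = \<beta>_simps(1,2)[OF 1(1)] \<beta>_simps(1,2)[OF 1(2)]
    have "(\<Sum>k=1..N. y i k * y k j) =
        (\<Sum>k=1..N. if E k then h (\<beta> i) / h (\<beta> j) * (x (\<beta> i) (\<beta> k) * x (\<beta> k) (\<beta> j)) else 0)"
    proof (rule sum.cong[OF refl])
      fix k
      show "y i k * y k j = (if E k then h (\<beta> i) / h (\<beta> j) * (x (\<beta> i) (\<beta> k) * x (\<beta> k) (\<beta> j)) else 0)"
      proof (cases "E k")
        case True
        then show ?thesis using y_E 1 h_nonzero[of "\<beta> k"] \<beta>_simps(1)[OF True] by simp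
      next
        case False
        have "y i k = 0 \<or> y k j = 0"
        proof (rule ccontr)
          assume nz: "\<not> ?thesis"
          then have high: "i > p + a1" "k > p + a1" "j > p + a1"
            using y_zero[of i k] y_zero[of k j] False by blast+
          then have "x i k \<noteq> 0" "x k j \<noteq> 0" using nz y_high by auto
          then have "k \<le> p + a1 + d" using R_row_mid[OF stab_support, of i k] high 1 unfolding E_def by blast
          then show False using mid_zero[of k j] high False 1 \<open>x k j \<noteq> 0\<close> unfolding E_def by auto
        qed
        then show ?thesis using False by auto
      qed
    qed
    also have "\<dots> = (\<Sum>k\<in>{p<..p + a1}. h (\<beta> i) / h (\<beta> j) * (x (\<beta> i) k * x k (\<beta> j)))"
      by (rule sum_E)
    also have "\<dots> = h (\<beta> i) / h (\<beta> j) * (\<Sum>k\<in>{p<..p + a1}. x (\<beta> i) k * x k (\<beta> j))"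
      by (simp add: sum_distrib_left)
    also have "(\<Sum>k\<in>{p<..p + a1}. x (\<beta> i) k * x k (\<beta> j)) = (\<Sum>k=1..N. x (\<beta> i) k * x k (\<beta> j))"
    proof (rule sum.mono_neutral_left)
      show "\<forall>k\<in>{1..N} - {p<..p + a1}. x (\<beta> i) k * x k (\<beta> j) = 0"
      proof
        fix k assume k: "k \<in> {1..N} - {p<..p + a1}"
        have "x k (\<beta> j) = 0"
        proof (rule ccontr)
          assume "x k (\<beta> j) \<noteq> 0"
          then have "R k (\<beta> j)" by (rule stab_support)
          then show False using k R_col_low[of k "\<beta> j"] R_bounds[of k "\<beta> j"] \<beta> by auto
        qed
        then show "x (\<beta> i) k * x k (\<beta> j) = 0" by simp
      qed
    qed (use N in auto)
    finally show ?thesis using sq' by simp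
  next
    case 2
    have "(\<Sum>k=1..N. y i k * y k j) = (\<Sum>k=1..N. x i k * x k j)"
    proof (rule sum.cong[OF refl])
      fix k
      have "x i k = 0 \<and> y i k = 0" if "k \<le> p + a1"
        using R_row_high[OF stab_support, of i k] y_col_low[of i k] 2 that by fastforce
      then show "y i k * y k j = x i k * x k j" using y_high 2 by (cases "k > p + a1") auto
    qed
    then show ?thesis using sq' by simp
  next
    case 3
    have "y i k = 0 \<or> y k j = 0" for k
    proof (rule ccontr)
      assume nz: "\<not> ?thesis"
      show False
      proof (cases "i > p + a1")
        case True
        then have "j \<le> p + a1" using 3 by simp
        then have E: "E k" "E j" using nz y_zero[of k j] by auto
        then have "k > p + a1" using nz y_zero[of i k] 3 by blast
        then show False using nz y_col_low \<open>j \<le> p + a1\<close> by blast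
      next
        case False
        then have E: "E i" "E k" using nz y_zero[of i k] by auto
        then have kj: "k > p + a1" "j > p + a1" "\<not> E j" using nz y_zero[of k j] 3 by blast+
        then have "x k j \<noteq> 0" using nz y_high by simp
        then have "j \<le> p + a1 + d" using R_row_mid[OF stab_support, of k j] kj E unfolding E_def by blast
        then show False using E kj False unfolding E_def by auto
      qed
    qed
    then show ?thesis by (intro sum.neutral) auto
  qed
  then show "mat_prod N y y i j = (0::cmat) i j" by (simp add: mat_prod_def)
qed

text \<open>If \<open>y\<close> vanishes, only the part of \<open>x\<close> in the abelian ideal can
  survive. The stabilizer equations at positions inside the short block clear its columns in
  \<open>E\<close>, and those at positions in the rest of the long block clear what remains, since
  each equation retains a single arc with nonzero coefficient.\<close>

lemma contract_injective:
  assumes y0: "y = 0"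
  shows "x = 0"
proof (intro ext)
  have low: "x i j = 0" if "p < i" "i \<le> p + a1" "p < j" "j \<le> p + a1" for i j
  proof -
    have "y (\<beta> i) (\<beta> j) = h i / h j * x i j" using y_E \<beta>_simps(3) that by metis
    then show ?thesis using y0 h_nonzero that by simp
  qed
  have high: "x i j = 0" if "i > p + a1" for i j
    using y_high[of i j] y0 R_row_high[OF stab_support, of i j] that by fastforce
  have col_low: "x i j = 0" if "j \<le> p + a1" for i j
    using low[of i j] R_col_low[OF stab_support, of i j] R_bounds[OF stab_support, of i j] that by fastforce
  have right: "x l j = 0" if "E j" "j > p + a1" for l j
  proof (rule ccontr)
    assume nz: "x l j \<noteq> 0"
    then have l: "p < l" "l \<le> p + a1" using R_bounds[OF stab_support] high[of l j] by fastforce+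
    note \<beta> = \<beta>_simps(1,2)[OF that(1)]
    have "(\<Sum>i=1..N. f i l * x i (\<beta> j)) = 0" by (rule sum.neutral) (use col_low \<beta> in auto)
    then have "0 = (\<Sum>k=1..N. f (\<beta> j) k * x l k)" using stab_eq[of "\<beta> j" l] R_low \<beta> l by metis
    also have "\<dots> = f (\<beta> j) j * x l j"
    proof (rule sum_single)
      show "j \<in> {1..N}" using that sums N unfolding E_def by auto
      fix k assume "k \<noteq> j"
      then show "f (\<beta> j) k * x l k = 0"
        using col_low[of k l] f_low_high[of "\<beta> j" k] \<beta> by fastforce
    qed simp
    finally show False using supp_cross[of "\<beta> j" j] \<beta> that nz by auto
  qed
  have left: "x i k = 0" if "p < i" "i \<le> p + a1" "\<beta> i > p + a1" "p + a1 < k" "k \<le> \<beta> i" for i k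
  proof -
    have \<beta>: "E (\<beta> i)" "\<beta> (\<beta> i) = i" using \<beta>_simps(3) that by auto
    have "R k (\<beta> i)" using that \<beta> unfolding adm_iff E_def by auto
    then have "(\<Sum>m=1..N. f m (\<beta> i) * x m k) = (\<Sum>j=1..N. f k j * x (\<beta> i) j)" by (rule stab_eq)
    also have "\<dots> = 0" by (rule sum.neutral) (use high that in auto)
    also have "(\<Sum>m=1..N. f m (\<beta> i) * x m k) = f i (\<beta> i) * x i k"
    proof (rule sum_single)
      show "i \<in> {1..N}" using that N by auto
      fix m assume "m \<noteq> i"
      have "f m (\<beta> i) = 0" if m: "m \<le> p + a1"
      proof (rule ccontr)
        assume "f m (\<beta> i) \<noteq> 0"
        then have "p < m" "\<beta> i = \<beta> m" using f_low_high m \<open>\<beta> i > p + a1\<close> by blast+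
        then show False using \<beta>_simps(3)[of m] m \<beta>(2) \<open>m \<noteq> i\<close> by metis
      qed
      then show "f m (\<beta> i) * x m k = 0" using high[of m k] by (cases "m \<le> p + a1") auto
    qed simp
    finally show ?thesis using supp_cross[of i "\<beta> i"] that by auto
  qed
  fix i j
  show "x i j = (0::cmat) i j"
  proof (rule ccontr)
    assume nz: "x i j \<noteq> (0::cmat) i j"
    then have R: "R i j" using stab_support by simp
    have i: "p < i" "i \<le> p + a1" using high[of i j] nz R_bounds[OF R] by fastforce+
    have j: "p + a1 < j" "j \<le> p + a1 + d" using col_low[of j i] nz R_row_low[OF R i(2)] by fastforce+
    have "\<not> E j" using right j nz by auto
    then have "j \<le> p + d" using j unfolding E_def by auto
    moreover have "p + d < \<beta> i" using \<beta>_simps(3)[OF i] unfolding E_def by blast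
    ultimately show False using left[OF i] j nz by auto
  qed
qed

end

lemma reduced_contract:
  assumes "reduced N (adm p' a' b') f'"
  shows "reduced N R f"
  unfolding reduced_def
proof (intro allI impI)
  fix x assume st: "stab N R f x" and sq: "mat_prod N x x = 0"
  have "contract x = 0"
    using assms stab_contract[OF st] square_contract[OF st sq] unfolding reduced_def by blast
  then show "x = 0" by (rule contract_injective[OF st])
qed

end

text \<open>Contraction keeps the total number of blocks and lowers the sum; dropping a block of
  size 0 or a pair of equal blocks lowers the number of blocks. Hence the induction measure.\<close>

theorem meander_reduced:
  assumes "sum_list a = sum_list b" "p + sum_list a \<le> N" "meander p a b f"
  shows "reduced N (adm p a b) f"
  using assms
proof (induction "sum_list a + length a + length b" arbitrary: p a b f rule: less_induct)
  case less
  have trivial: "reduced N (adm p a b) f" if "a = [] \<or> b = []"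
  proof -
    have "\<not> adm p a b i j" for i j
    proof
      assume "adm p a b i j"
      moreover have "sum_list a = 0" "sum_list b = 0" using that less.prems(1) by auto
      ultimately show False using adm_bounds[of p a b i j 0] by auto
    qed
    then show ?thesis unfolding reduced_def stab_def by (auto simp: fun_eq_iff)
  qed
  \<comment> \<open>Stated for arbitrary data with its own induction hypothesis, so that it also
    serves for the exchanged pair when the first block of \<open>b\<close> is the shorter
    one.\<close>
  have step: "reduced N (adm p a b) f"
    if IH: "\<And>p a' b' f. sum_list a' + length a' + length b' < sum_list a + length a + length b \<Longrightarrow>
        sum_list a' = sum_list b' \<Longrightarrow> p + sum_list a' \<le> N \<Longrightarrow> meander p a' b' f \<Longrightarrow> reduced N (adm p a' b') f"
      and prems: "sum_list a = sum_list b" "p + sum_list a \<le> N" "meander p a b f"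
      and le: "a = a1 # as" "b = b1 # bs" "a1 \<le> b1" for p a b f a1 b1 as bs
  proof -
    consider "a1 = 0" | "0 < a1" "a1 = b1" | "0 < a1" "a1 < b1" using le(3) by linarith
    then show ?thesis
    proof cases
      case 1
      have arc0: "arc p (0 # as) = arc p as" and block0: "diag_block p (0 # as) = diag_block p as"
        by (auto simp: fun_eq_iff)
      have "meander p as b f"
        using prems(3) unfolding le 1 meander_def graded_arcs_def arc0 block0 .
      then have "reduced N (adm p as b) f"
        using IH[of as b p f] prems unfolding le 1 by simp
      then show ?thesis unfolding le 1 adm_def block0 .
    next
      case 2
      let ?f = "\<lambda>i j. if i > p + a1 \<and> j > p + a1 then f i j else 0"
      have "meander (p + a1) as bs ?f"
        using meander_split prems(3) unfolding le 2(2)[symmetric] by blast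
      then have "reduced N (adm (p + a1) as bs) ?f"
        using IH[of as bs "p + a1" ?f] prems 2 unfolding le by simp
      then show ?thesis
        using reduced_split[OF 2(1), of p as bs f N] prems unfolding le 2(2)[symmetric] by simp
    next
      case 3
      define d where "d = b1 - a1"
      have b1: "b1 = a1 + d" "0 < d" using 3 by (auto simp: d_def)
      interpret contraction N p a1 d as bs f
        by unfold_locales (use 3 prems b1 in \<open>auto simp: le\<close>)
      have "reduced N (adm p' a' b') f'"
        by (rule IH) (use sums' meander' prems in \<open>auto simp: le b1\<close>)
      then show ?thesis using reduced_contract unfolding le b1(1) by blast
    qed
  qed
  show ?case
  proof (cases "a = [] \<or> b = []")
    case False
    then obtain a1 as b1 bs where ab: "a = a1 # as" "b = b1 # bs"
      by (meson neq_Nil_conv)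
    show ?thesis
    proof (cases "a1 \<le> b1")
      case True
      show ?thesis
        by (rule step[OF less.hyps less.prems ab True]) assumption+
    next
      case ge: False
      have "reduced N (adm p b a) (\<lambda>i j. f j i)"
        by (rule step[OF less.hyps _ _ meander_swap[OF less.prems(3)] ab(2,1)])
          (use ge less.prems in auto)
      from reduced_swap[OF this] show ?thesis by simp
    qed
  qed (rule trivial)
qed

section \<open>Reduced stabilizers\<close>

context vector_space
begin

text \<open>Families rather than sets, since iterates of an operator on a vector may coincide; two
  equal members give the relation at once.\<close>

lemma dependent_family:
  fixes f :: "nat \<Rightarrow> 'b"
  assumes B: "finite B" "card B \<le> m" and f: "\<And>i. i \<le> m \<Longrightarrow> f i \<in> span B"
  obtains c where "\<exists>i\<le>m. c i \<noteq> 0" "(\<Sum>i\<le>m. c i *s f i) = 0"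
proof (cases "inj_on f {..m}")
  case True
  have "dependent (f ` {..m})"
  proof (rule ccontr)
    assume "independent (f ` {..m})"
    then have "card (f ` {..m}) \<le> card B"
      using independent_span_bound[OF B(1)] f by (simp add: image_subset_iff)
    then show False using card_image[OF True] B(2) by simp
  qed
  then obtain u v where uv: "(\<Sum>v\<in>f ` {..m}. u v *s v) = 0" "v \<in> f ` {..m}" "u v \<noteq> 0"
    by (subst (asm) dependent_finite) auto
  have "(\<Sum>i\<le>m. u (f i) *s f i) = 0"
    using uv(1) sum.reindex[OF True, of "\<lambda>v. u v *s v"] by (simp add: comp_def)
  then show thesis using that[of "\<lambda>i. u (f i)"] uv(2,3) by auto
next
  case False
  then obtain i j where ij: "i \<le> m" "j \<le> m" "i \<noteq> j" "f i = f j" by (auto simp: inj_on_def)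
  define c where "c k = (if k = i then 1 else if k = j then - 1 else (0::'a))" for k
  have "(\<Sum>k\<le>m. c k *s f k) = (\<Sum>k\<in>{i, j}. c k *s f k)"
    by (rule sum.mono_neutral_right) (use ij in \<open>auto simp: c_def\<close>)
  also have "\<dots> = 0" using ij by (simp add: c_def)
  finally show thesis using that[of c] ij(1) by (force simp: c_def)
qed

end

definition poly_act :: "('k::field \<Rightarrow> 'a \<Rightarrow> 'a::ab_group_add) \<Rightarrow> ('a \<Rightarrow> 'a) \<Rightarrow> 'k poly \<Rightarrow> 'a \<Rightarrow> 'a" where
  "poly_act scale T p v = (\<Sum>i\<le>degree p. scale (coeff p i) ((T ^^ i) v))"

text \<open>A linear relation among the iterates of \<open>T\<close> on \<open>v\<close> is a
  nonzero polynomial p with p(T) v = 0. Splitting off a root r, either the cofactor already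
  annihilates \<open>v\<close> and the degree drops, or the cofactor applied to \<open>v\<close> is
  an eigenvector for r.\<close>

lemma (in vector_space) eigenvector_exists:
  fixes T :: "'b \<Rightarrow> 'b"
  assumes alg_closed: "\<And>p :: 'a poly. degree p \<noteq> 0 \<Longrightarrow> \<exists>r. poly p r = 0"
    and T: "\<And>x y. T (x + y) = T x + T y" "\<And>c x. T (c *s x) = c *s T x"
    and W: "subspace W" "\<And>x. x \<in> W \<Longrightarrow> T x \<in> W" "finite B" "W \<subseteq> span B"
    and v: "v \<in> W" "v \<noteq> 0"
  obtains c u where "u \<in> W" "u \<noteq> 0" "T u = c *s u"
proof -
  let ?P = "poly_act scale T"
  have P_eq: "?P p w = (\<Sum>i\<le>n. coeff p i *s (T ^^ i) w)" if "degree p \<le> n" for p w n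
    unfolding poly_act_def
    by (rule sum.mono_neutral_left) (use that in \<open>auto simp: coeff_eq_0\<close>)
  have T0: "T 0 = 0" using T(2)[of 0 0] by simp
  have T_sum: "T (\<Sum>i\<in>I. g i) = (\<Sum>i\<in>I. T (g i))" for g :: "nat \<Rightarrow> 'b" and I
    by (induction I rule: infinite_finite_induct) (auto simp: T T0)
  have P_in: "?P p w \<in> W" if "w \<in> W" for p w
  proof -
    have "(T ^^ i) w \<in> W" for i by (induction i) (use that W(2) in auto)
    then show ?thesis
      unfolding poly_act_def by (intro subspace_sum[OF W(1)] subspace_scale[OF W(1)])
  qed
  have P_linear_factor: "?P ([:- r, 1:] * q) w = T (?P q w) - r *s ?P q w" for r q w
  proof -
    let ?n = "Suc (degree q)"
    have "degree ([:- r, 1:] * q) \<le> ?n" by (rule order_trans[OF degree_mult_le]) simp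
    then have "?P ([:- r, 1:] * q) w = (\<Sum>i\<le>?n. coeff ([:- r, 1:] * q) i *s (T ^^ i) w)" by (rule P_eq)
    also have "\<dots> = (\<Sum>i\<le>?n. coeff (pCons 0 q) i *s (T ^^ i) w) - r *s (\<Sum>i\<le>?n. coeff q i *s (T ^^ i) w)"
      unfolding scale_sum_right sum_subtractf[symmetric]
      by (rule sum.cong) (simp_all add: scale_left_diff_distrib)
    also have "(\<Sum>i\<le>?n. coeff (pCons 0 q) i *s (T ^^ i) w) = T (?P q w)"
      unfolding sum.atMost_Suc_shift poly_act_def T_sum by (simp add: T)
    also have "(\<Sum>i\<le>?n. coeff q i *s (T ^^ i) w) = ?P q w"
      by (rule P_eq[symmetric]) simp
    finally show ?thesis .
  qed
  have main: "\<exists>c u. u \<in> W \<and> u \<noteq> 0 \<and> T u = c *s u" if "p \<noteq> 0" "?P p v = 0" for p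
    using that
  proof (induction "degree p" arbitrary: p rule: less_induct)
    case less
    show ?case
    proof (cases "degree p = 0")
      case True
      then obtain a where "p = [:a:]" by (rule degree_eq_zeroE)
      then show ?thesis using less.prems v(2) by (simp add: poly_act_def)
    next
      case False
      then obtain r where "poly p r = 0" using alg_closed by blast
      then obtain q where q: "p = [:- r, 1:] * q" unfolding poly_eq_0_iff_dvd by (rule dvdE)
      have "q \<noteq> 0" using less.prems(1) q by auto
      show ?thesis
      proof (cases "?P q v = 0")
        case True
        have "degree q < degree p" unfolding q using \<open>q \<noteq> 0\<close> by (subst degree_mult_eq) auto
        then show ?thesis using less.hyps \<open>q \<noteq> 0\<close> True by blast
      next
        case False
        have "T (?P q v) = r *s ?P q v"
          using less.prems(2) unfolding q P_linear_factor by simp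
        then show ?thesis using False P_in v(1) by blast
      qed
    qed
  qed
  have "(T ^^ i) v \<in> W" for i by (induction i) (use v W(2) in auto)
  then obtain c where c: "\<exists>i\<le>card B. c i \<noteq> 0" "(\<Sum>i\<le>card B. c i *s (T ^^ i) v) = 0"
    using dependent_family[OF W(3) order_refl, of "\<lambda>i. (T ^^ i) v"] W(4) by blast
  define p where "p = (\<Sum>i\<le>card B. monom (c i) i)"
  have p: "coeff p i = (if i \<le> card B then c i else 0)" for i
    by (auto simp: p_def coeff_sum)
  have "p \<noteq> 0" using c(1) p by (metis coeff_0)
  moreover have "degree p \<le> card B" using p by (auto intro: degree_le)
  then have "?P p v = 0" using c(2) by (simp add: P_eq p)
  ultimately show thesis using main that by blast
qed

lemma complex_poly_root: "degree (p :: complex poly) \<noteq> 0 \<Longrightarrow> \<exists>r. poly p r = 0"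
  using fundamental_theorem_of_algebra[of p] constant_degree[of p] by auto

text \<open>The last assumption is \<open>reduced\<close> freed from coordinates. Everything in this
  locale is ring theory; seaweeds enter only through the instances.\<close>

locale reduced_stabilizer =
  fixes N :: nat and A :: "cmat set" and \<phi> :: "cmat \<Rightarrow> complex" and e :: cmat
  assumes A: "mat.subspace A" "A \<subseteq> gl_space N"
    "\<And>x y. x \<in> A \<Longrightarrow> y \<in> A \<Longrightarrow> mat_prod N x y \<in> A"
    and e: "e \<in> A" "\<And>x. x \<in> A \<Longrightarrow> mat_prod N e x = x \<and> mat_prod N x e = x"
    and \<phi>: "\<And>x y. \<phi> (x + y) = \<phi> x + \<phi> y" "\<And>c x. \<phi> (mat_scale c x) = c * \<phi> x"
    and red: "\<And>x. x \<in> A \<Longrightarrow> (\<And>y. y \<in> A \<Longrightarrow> \<phi> (mat_prod N x y) = \<phi> (mat_prod N y x)) \<Longrightarrow>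
      mat_prod N x x = 0 \<Longrightarrow> x = 0"
begin

abbreviation mul (infixl "\<star>" 70) where "x \<star> y \<equiv> mat_prod N x y"

definition S :: "cmat set" where "S = {x \<in> A. \<forall>y\<in>A. \<phi> (x \<star> y) = \<phi> (y \<star> x)}"

lemma \<phi>_diff: "\<phi> (x - y) = \<phi> x - \<phi> y"
  using \<phi>(1)[of "x - y" y] by (simp add: algebra_simps)

lemma mul_0 [simp]: "0 \<star> x = 0" "x \<star> 0 = 0"
  by (auto simp: mat_prod_def fun_eq_iff)

lemma S_A: "x \<in> S \<Longrightarrow> x \<in> A" unfolding S_def by blast

lemma S_reduced: "x \<in> S \<Longrightarrow> x \<star> x = 0 \<Longrightarrow> x = 0"
  unfolding S_def using red by blast

lemma e_S: "e \<in> S" unfolding S_def using e by simp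

text \<open>Inside \<open>\<phi>\<close> the factor \<open>x\<close> may be rotated to the other
  end, and after it \<open>y\<close>.\<close>

lemma S_mul: assumes "x \<in> S" "y \<in> S" shows "x \<star> y \<in> S"
  unfolding S_def
proof (intro CollectI conjI ballI)
  show "x \<star> y \<in> A" using assms S_A A(3) by blast
  fix z assume z: "z \<in> A"
  have yz: "y \<star> z \<in> A" and zx: "z \<star> x \<in> A" using assms z A(3) S_A by auto
  have "\<phi> (x \<star> (y \<star> z)) = \<phi> (y \<star> z \<star> x)" using assms(1) yz unfolding S_def by blast
  moreover have "\<phi> (y \<star> (z \<star> x)) = \<phi> (z \<star> x \<star> y)" using assms(2) zx unfolding S_def by blast
  ultimately show "\<phi> (x \<star> y \<star> z) = \<phi> (z \<star> (x \<star> y))" by (simp only: mat_prod_assoc)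
qed

lemma S_subspace: "mat.subspace S"
proof (rule mat.subspaceI)
  show "0 \<in> S" unfolding S_def using mat.subspace_0[OF A(1)] by simp
  show "x + y \<in> S" if "x \<in> S" "y \<in> S" for x y
    using that mat.subspace_add[OF A(1)] unfolding S_def by (auto simp: mat_prod_simps \<phi>)
  show "mat_scale c x \<in> S" if "x \<in> S" for c x
    using that mat.subspace_scale[OF A(1)] unfolding S_def by (auto simp: mat_prod_simps \<phi>)
qed

lemma S_diff: "x \<in> S \<Longrightarrow> y \<in> S \<Longrightarrow> x - y \<in> S"
  by (rule mat.subspace_diff[OF S_subspace])

text \<open>If u v = 0, the square of v u contains u v and vanishes, so v u = 0; the square of u r v
  in turn contains v u.\<close>

lemma S_insert:
  assumes "u \<in> S" "v \<in> S" "r \<in> S" "u \<star> v = 0"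
  shows "u \<star> r \<star> v = 0" "v \<star> u = 0"
proof -
  have "v \<star> u \<star> (v \<star> u) = v \<star> (u \<star> v) \<star> u" by (simp only: mat_prod_assoc)
  then have "v \<star> u \<star> (v \<star> u) = 0" by (simp only: assms(4) mul_0)
  then show vu: "v \<star> u = 0" by (rule S_reduced[OF S_mul[OF assms(2,1)]])
  have "u \<star> r \<star> v \<star> (u \<star> r \<star> v) = u \<star> r \<star> (v \<star> u) \<star> (r \<star> v)" by (simp only: mat_prod_assoc)
  then have "u \<star> r \<star> v \<star> (u \<star> r \<star> v) = 0" by (simp only: vu mul_0)
  then show "u \<star> r \<star> v = 0" by (rule S_reduced[OF S_mul[OF S_mul[OF assms(1,3)] assms(2)]])
qed

text \<open>Left multiplication by \<open>x\<close> preserves the left ideal of multiples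
  \<open>s \<star> w\<close>. It is nonzero, as it contains the square of \<open>w\<close>, so it
  contains an eigenvector; subtracting the eigenvalue from \<open>x\<close> gives an
  annihilator.\<close>

lemma eigen:
  assumes x: "x \<in> S" and w: "w \<in> S" "w \<noteq> 0"
  obtains a s c where "a = x - mat_scale c e" "a \<in> S" "s \<in> S" "s \<star> w \<noteq> 0" "a \<star> (s \<star> w) = 0"
proof -
  define W where "W = (\<lambda>s. s \<star> w) ` S"
  have "S \<subseteq> gl_space N" using S_A A(2) by auto
  from finite_span_of_subspace[OF S_subspace this]
  obtain B where B: "finite B" "S = mat.span B" by blast
  have WS: "W \<subseteq> S" unfolding W_def using S_mul w by blast
  have W1: "mat.subspace W"
  proof (rule mat.subspaceI)
    show "0 \<in> W" unfolding W_def using mat.subspace_0[OF S_subspace] by (force simp: image_iff)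
    show "p + q \<in> W" if "p \<in> W" "q \<in> W" for p q
      using that mat.subspace_add[OF S_subspace] unfolding W_def
      by (auto simp: image_iff) (metis mat_prod_simps(1))
    show "mat_scale c p \<in> W" if "p \<in> W" for c p
      using that mat.subspace_scale[OF S_subspace] unfolding W_def
      by (auto simp: image_iff) (metis mat_prod_simps(5))
  qed
  have W2: "x \<star> p \<in> W" if "p \<in> W" for p
    using that x S_mul unfolding W_def by (auto simp: image_iff) (metis mat_prod_assoc)
  have W3: "w \<star> w \<in> W" "w \<star> w \<noteq> 0" using w S_reduced unfolding W_def by auto
  have W4: "W \<subseteq> mat.span B" using B(2) WS by simp
  obtain c u where u: "u \<in> W" "u \<noteq> 0" "x \<star> u = mat_scale c u"
    by (rule mat.eigenvector_exists[OF complex_poly_root mat_prod_simps(2,6) W1 W2 B(1) W4 W3])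
  obtain s where s: "s \<in> S" "u = s \<star> w" using u(1) unfolding W_def by blast
  define a where "a = x - mat_scale c e"
  have "a \<star> u = x \<star> u - mat_scale c (e \<star> u)" by (simp add: a_def mat_prod_simps)
  also have "e \<star> u = u" using e(2) u(1) WS S_A by blast
  finally have "a \<star> u = 0" by (simp only: u(3) diff_self)
  moreover have "a \<in> S" unfolding a_def using x e_S S_diff mat.subspace_scale[OF S_subspace] by blast
  ultimately show thesis using that[OF a_def _ s(1)] s(2) u(2) by simp
qed

text \<open>If \<open>t = [x, w] \<noteq> 0\<close>, some nonzero \<open>s t\<close> is an eigenvector for multiplication by \<open>x\<close>, so
  \<open>a s t = 0\<close> for a translate \<open>a\<close> of \<open>x\<close>; in a reduced ring every product containing
  \<open>a\<close> and \<open>s t\<close> then vanishes, hence so does \<open>(s t)\<^sup>2 = s [a, w] s t\<close>.\<close>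

lemma S_commute:
  assumes x: "x \<in> S" and w: "w \<in> S"
  shows "x \<star> w = w \<star> x"
proof (rule ccontr)
  assume "x \<star> w \<noteq> w \<star> x"
  define t where "t = x \<star> w - w \<star> x"
  have t: "t \<in> S" "t \<noteq> 0"
    unfolding t_def using S_diff[OF S_mul[OF x w] S_mul[OF w x]] \<open>x \<star> w \<noteq> w \<star> x\<close> by simp_all
  obtain a s c where a: "a = x - mat_scale c e" "a \<in> S" "s \<in> S" "s \<star> t \<noteq> 0" "a \<star> (s \<star> t) = 0"
    by (rule eigen[OF x t])
  have "e \<star> w = w" "w \<star> e = w" using e(2) S_A w by auto
  then have t': "t = a \<star> w - w \<star> a" unfolding t_def a(1) by (simp add: mat_prod_simps)
  have "s \<star> t \<in> S" by (rule S_mul[OF a(3) t(1)])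
  then have "a \<star> w \<star> (s \<star> t) = 0" by (rule S_insert(1)[OF a(2) _ w a(5)])
  then have "s \<star> t \<star> (s \<star> t) = 0"
    using a(5) by (subst (1) t') (simp add: mat_prod_simps mat_prod_assoc)
  then show False using S_reduced \<open>s \<star> t \<in> S\<close> a(4) by blast
qed

text \<open>Put w = [x, z] = [a, z] for a translate a of x that annihilates v = u w. Commutativity
  of \<open>S\<close> gives v = w u, and v a = 0 as well, so both halves of v (a z - z a) v vanish.
  Thus v w v = 0, and reducedness yields v w = 0, v v = 0 and finally v = 0. Unlike in
  \<open>S_commute\<close>, z is only in \<open>A\<close>, so w has to be assumed to lie in
  \<open>S\<close>.\<close>

lemma S_image_trivial:
  assumes x: "x \<in> S" and z: "z \<in> A" and w: "x \<star> z - z \<star> x \<in> S"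
  shows "x \<star> z - z \<star> x = 0"
proof (rule ccontr)
  define w where "w = x \<star> z - z \<star> x"
  assume "x \<star> z - z \<star> x \<noteq> 0"
  then have wS: "w \<in> S" "w \<noteq> 0" using w unfolding w_def by auto
  obtain a u c where a: "a = x - mat_scale c e" "a \<in> S" "u \<in> S" "u \<star> w \<noteq> 0" "a \<star> (u \<star> w) = 0"
    by (rule eigen[OF x wS])
  define v where "v = u \<star> w"
  have v: "v \<in> S" "v = w \<star> u" unfolding v_def using S_mul S_commute a wS by auto
  have "e \<star> z = z" "z \<star> e = z" using e(2) z by auto
  then have w': "w = a \<star> z - z \<star> a" unfolding w_def a(1) by (simp add: mat_prod_simps)
  have va: "v \<star> a = 0" using S_insert(2)[OF a(2) v(1) v(1)] a(5) unfolding v_def by blast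
  have awu: "a \<star> (w \<star> u) = 0" using a(5) v v_def by simp
  have uaw: "u \<star> (a \<star> w) = 0"
    using a(5) S_commute[OF a(2,3)] by (simp add: mat_prod_assoc[symmetric])
  have "w \<star> u \<star> w \<star> w \<star> u = w \<star> u \<star> (a \<star> z - z \<star> a) \<star> w \<star> u" using w' by simp
  also have "\<dots> = (v \<star> a) \<star> z \<star> w \<star> u - w \<star> u \<star> z \<star> (a \<star> (w \<star> u))"
    unfolding v(2) by (simp add: mat_prod_simps mat_prod_assoc)
  also have "\<dots> = 0" unfolding va awu by simp
  finally have "v \<star> w \<star> v = 0" unfolding v(2) by (simp add: mat_prod_assoc)
  then have "v \<star> w \<star> (v \<star> w) = 0" by (simp add: mat_prod_assoc[symmetric])
  then have "v \<star> w = 0" using S_reduced S_mul v(1) wS(1) by blast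
  then have "v \<star> v = 0" using S_insert(1)[OF v(1) wS(1) a(3)] unfolding v_def by (simp add: mat_prod_assoc)
  then show False using S_reduced v(1) a(4) v_def by blast
qed

end

section \<open>Deforming a kernel vector along a line of functionals\<close>

lemma triangle_swap:
  fixes g :: "nat \<Rightarrow> nat \<Rightarrow> 'a::comm_monoid_add"
  shows "(\<Sum>i\<le>n. \<Sum>j\<le>n - i. g i j) = (\<Sum>j\<le>n. \<Sum>i\<le>n - j. g i j)"
proof -
  have "(\<Sum>i\<le>n. \<Sum>j\<le>n - i. g i j) = (\<Sum>(i, j)\<in>Sigma {..n} (\<lambda>i. {..n - i}). g i j)"
    by (rule sum.Sigma) auto
  also have "\<dots> = (\<Sum>(j, i)\<in>Sigma {..n} (\<lambda>j. {..n - j}). g i j)"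
    by (rule sum.reindex_bij_witness[of _ prod.swap prod.swap]) auto
  also have "\<dots> = (\<Sum>j\<le>n. \<Sum>i\<le>n - j. g i j)"
    by (rule sum.Sigma[symmetric]) auto
  finally show ?thesis .
qed

lemma triangle_assoc:
  fixes g :: "nat \<Rightarrow> nat \<Rightarrow> nat \<Rightarrow> 'a::comm_monoid_add"
  shows "(\<Sum>j\<le>n. \<Sum>i\<le>j. g i (j - i) (n - j)) = (\<Sum>i\<le>n. \<Sum>j\<le>n - i. g i j (n - i - j))"
  using fps_mult_assoc_lemma[of g n n] by (simp add: atMost_atLeast0)

text \<open>The identities are imposed on the whole ambient space, where the matrix commutator
  satisfies them; only closure and finite dimension concern \<open>G\<close>. Computations with
  coefficients of power series are then free of membership conditions.\<close>

locale bilinear_lie_algebra = vector_space scale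
  for scale :: "complex \<Rightarrow> 'a::ab_group_add \<Rightarrow> 'a" (infixr "*s" 75) +
  fixes br :: "'a \<Rightarrow> 'a \<Rightarrow> 'a" and G :: "'a set"
  assumes br_add: "br (x + y) z = br x z + br y z" "br x (y + z) = br x y + br x z"
    and br_scale: "br (c *s x) y = c *s br x y" "br x (c *s y) = c *s br x y"
    and br_self: "br x x = 0"
    and jacobi: "br x (br y z) = br (br x y) z + br y (br x z)"
    and G: "subspace G" "\<exists>B. finite B \<and> G = span B"
    and G_br: "x \<in> G \<Longrightarrow> y \<in> G \<Longrightarrow> br x y \<in> G"
begin

definition functional :: "('a \<Rightarrow> complex) \<Rightarrow> bool" where
  "functional \<phi> \<longleftrightarrow> (\<forall>x y. \<phi> (x + y) = \<phi> x + \<phi> y) \<and> (\<forall>c x. \<phi> (c *s x) = c * \<phi> x)"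

lemma functional_add: "functional \<phi> \<Longrightarrow> \<phi> (x + y) = \<phi> x + \<phi> y"
  and functional_scale: "functional \<phi> \<Longrightarrow> \<phi> (c *s x) = c * \<phi> x"
  unfolding functional_def by blast+

lemma functional_0: "functional \<phi> \<Longrightarrow> \<phi> 0 = 0"
  using functional_scale[of \<phi> 0 0] by simp

lemma functional_sum: "functional \<phi> \<Longrightarrow> \<phi> (\<Sum>i\<in>I. g i) = (\<Sum>i\<in>I. \<phi> (g i))"
  by (induction I rule: infinite_finite_induct) (auto simp: functional_0 functional_add)

lemma functional_minus: "functional \<phi> \<Longrightarrow> \<phi> (- x) = - \<phi> x"
  using functional_add[of \<phi> x "- x"] functional_0[of \<phi>] by (simp add: eq_neg_iff_add_eq_0 add.commute)

lemma functional_diff: "functional \<phi> \<Longrightarrow> \<phi> (x - y) = \<phi> x - \<phi> y"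
  using functional_add[of \<phi> x "- y"] functional_minus[of \<phi> y] by simp

lemma br_0: "br 0 x = 0" "br x 0 = 0"
  using br_scale(1)[of 0 0 x] br_scale(2)[of x 0 0] by simp_all

lemma br_sum: "br (\<Sum>i\<in>I. g i) x = (\<Sum>i\<in>I. br (g i) x)" "br x (\<Sum>i\<in>I. g i) = (\<Sum>i\<in>I. br x (g i))"
  by (induction I rule: infinite_finite_induct) (auto simp: br_0 br_add)

lemma br_anti: "br y x = - br x y"
proof -
  have "br (x + y) (x + y) = br x y + br y x" unfolding br_add by (simp add: br_self)
  then have "br y x + br x y = 0" by (simp only: br_self add.commute)
  then show ?thesis by (simp only: eq_neg_iff_add_eq_0)
qed

text \<open>A functional that vanishes on the common zeros of finitely many functionals is a
  combination of them.\<close>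

lemma functional_combination:
  assumes "finite I" "subspace W" "functional \<rho>" "\<And>i. i \<in> I \<Longrightarrow> functional (\<gamma> i)"
    and "\<And>z. z \<in> W \<Longrightarrow> (\<And>i. i \<in> I \<Longrightarrow> \<gamma> i z = 0) \<Longrightarrow> \<rho> z = 0"
  shows "\<exists>c. \<forall>z\<in>W. \<rho> z = (\<Sum>i\<in>I. c i * \<gamma> i z)"
  using assms
proof (induction I arbitrary: W \<rho> rule: finite_induct)
  case empty
  then show ?case by auto
next
  case (insert k I)
  note \<gamma> = insert.prems(3)
  define W' where "W' = {z \<in> W. \<gamma> k z = 0}"
  have "subspace W'"
  proof (rule subspaceI)
    show "0 \<in> W'" unfolding W'_def using subspace_0[OF insert.prems(1)] functional_0[OF \<gamma>] by simp
    show "x + y \<in> W'" if "x \<in> W'" "y \<in> W'" for x y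
      using that subspace_add[OF insert.prems(1)] functional_add[OF \<gamma>] unfolding W'_def by simp
    show "c *s x \<in> W'" if "x \<in> W'" for c x
      using that subspace_scale[OF insert.prems(1)] functional_scale[OF \<gamma>] unfolding W'_def by simp
  qed
  moreover have "\<rho> z = 0" if "z \<in> W'" "\<And>i. i \<in> I \<Longrightarrow> \<gamma> i z = 0" for z
    by (rule insert.prems(4)) (use that in \<open>auto simp: W'_def\<close>)
  ultimately obtain c where c: "\<forall>z\<in>W'. \<rho> z = (\<Sum>i\<in>I. c i * \<gamma> i z)"
    using insert.IH[of W' \<rho>] insert.prems(2) \<gamma> by blast
  define \<sigma> where "\<sigma> z = \<rho> z - (\<Sum>i\<in>I. c i * \<gamma> i z)" for z
  have \<sigma>: "functional \<sigma>"
    unfolding functional_def \<sigma>_def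
    using \<gamma> functional_add[OF insert.prems(2)] functional_scale[OF insert.prems(2)]
    by (simp add: functional_add functional_scale algebra_simps sum.distrib sum_distrib_left)
  obtain b where b: "\<forall>z\<in>W. \<sigma> z = b * \<gamma> k z"
  proof (cases "\<forall>z\<in>W. \<gamma> k z = 0")
    case True
    then have "\<forall>z\<in>W. \<sigma> z = 0 * \<gamma> k z" using c unfolding W'_def \<sigma>_def by simp
    then show ?thesis by (rule that)
  next
    case False
    then obtain u where u: "u \<in> W" "\<gamma> k u \<noteq> 0" by blast
    have "\<sigma> z = \<sigma> u / \<gamma> k u * \<gamma> k z" if z: "z \<in> W" for z
    proof -
      let ?w = "z - (\<gamma> k z / \<gamma> k u) *s u"
      have "?w \<in> W'"
        unfolding W'_def using z u subspace_diff[OF insert.prems(1)] subspace_scale[OF insert.prems(1)]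
          functional_diff[OF \<gamma>] functional_scale[OF \<gamma>] by simp
      then have "\<sigma> ?w = 0" using c unfolding \<sigma>_def by simp
      then show ?thesis using functional_diff[OF \<sigma>] functional_scale[OF \<sigma>] by simp
    qed
    then show ?thesis using that by blast
  qed
  have "(\<Sum>i\<in>insert k I. (c(k := b)) i * \<gamma> i z) = b * \<gamma> k z + (\<Sum>i\<in>I. c i * \<gamma> i z)" for z
  proof -
    have "(\<Sum>i\<in>I. (c(k := b)) i * \<gamma> i z) = (\<Sum>i\<in>I. c i * \<gamma> i z)"
      by (rule sum.cong) (use insert.hyps(2) in auto)
    then show ?thesis using insert.hyps by simp
  qed
  then have "\<forall>z\<in>W. \<rho> z = (\<Sum>i\<in>insert k I. (c(k := b)) i * \<gamma> i z)"
    using b unfolding \<sigma>_def by (metis diff_eq_eq)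
  then show ?case by blast
qed

text \<open>Coefficient of t^k in the bracket of the power series with coefficients \<open>u\<close>
  and \<open>v\<close>.\<close>

definition conv :: "(nat \<Rightarrow> 'a) \<Rightarrow> (nat \<Rightarrow> 'a) \<Rightarrow> nat \<Rightarrow> 'a" where
  "conv u v k = (\<Sum>i\<le>k. br (u i) (v (k - i)))"

lemma conv_jacobi: "conv u (conv v w) k = conv (conv u v) w k + conv v (conv u w) k"
proof -
  have l: "conv a (conv b c) k = (\<Sum>i\<le>k. \<Sum>j\<le>k - i. br (a i) (br (b j) (c (k - i - j))))" for a b c
    by (simp add: conv_def br_sum)
  have "conv (conv u v) w k = (\<Sum>j\<le>k. \<Sum>i\<le>j. br (br (u i) (v (j - i))) (w (k - j)))"
    by (simp add: conv_def br_sum)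
  also have "\<dots> = (\<Sum>i\<le>k. \<Sum>j\<le>k - i. br (br (u i) (v j)) (w (k - i - j)))"
    by (rule triangle_assoc)
  finally have 1: "conv (conv u v) w k = (\<Sum>i\<le>k. \<Sum>j\<le>k - i. br (br (u i) (v j)) (w (k - i - j)))" .
  have "conv v (conv u w) k = (\<Sum>i\<le>k. \<Sum>j\<le>k - i. br (v j) (br (u i) (w (k - j - i))))"
    unfolding l by (rule triangle_swap)
  also have "\<dots> = (\<Sum>i\<le>k. \<Sum>j\<le>k - i. br (v j) (br (u i) (w (k - i - j))))"
    by (simp add: add.commute)
  finally have 2: "conv v (conv u w) k = (\<Sum>i\<le>k. \<Sum>j\<le>k - i. br (v j) (br (u i) (w (k - i - j))))" .
  show ?thesis
    unfolding 1 2 l[of u v w] sum.distrib[symmetric] by (intro sum.cong refl jacobi)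
qed

text \<open>The formal solution of \<open>X' = [Y, X]\<close> with initial value \<open>x\<close>.\<close>

fun transport :: "(nat \<Rightarrow> 'a) \<Rightarrow> 'a \<Rightarrow> nat \<Rightarrow> 'a" where
  "transport Y x 0 = x"
| "transport Y x (Suc k) = (1 / of_nat (Suc k)) *s (\<Sum>i\<le>k. br (Y i) (transport Y x (k - i)))"

declare transport.simps(2) [simp del]

lemma transport_Suc: "of_nat (Suc k) *s transport Y x (Suc k) = conv Y (transport Y x) k"
  unfolding transport.simps(2) conv_def scale_scale by (simp del: of_nat_Suc)

lemma transport_G:
  assumes "\<And>i. i < k \<Longrightarrow> Y i \<in> G" "x \<in> G"
  shows "transport Y x k \<in> G"
  using assms(1)
proof (induction k rule: less_induct)
  case (less k)
  show ?case
  proof (cases k)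
    case (Suc j)
    have "br (Y i) (transport Y x (j - i)) \<in> G" if "i \<le> j" for i
      using that less Suc by (intro G_br) auto
    then show ?thesis unfolding Suc transport.simps(2)
      by (intro subspace_scale[OF G(1)] subspace_sum[OF G(1)]) auto
  qed (use assms in simp)
qed

text \<open>Coefficient \<open>k\<close> of the solution depends only on earlier coefficients of
  \<open>Y\<close>; this makes the successive choice of \<open>Y\<close> in
  \<open>defect_free_transport\<close> well founded.\<close>

lemma transport_cong:
  assumes "\<And>i. i < k \<Longrightarrow> Y i = Y' i"
  shows "transport Y x k = transport Y' x k"
  using assms
proof (induction k rule: less_induct)
  case (less k)
  show ?case
  proof (cases k)
    case (Suc j)
    have "br (Y i) (transport Y x (j - i)) = br (Y' i) (transport Y' x (j - i))" if "i \<le> j" for i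
    proof -
      have "transport Y x (j - i) = transport Y' x (j - i)"
        by (rule less.IH) (use Suc less.prems in auto)
      then show ?thesis using less.prems[of i] Suc that by simp
    qed
    then show ?thesis unfolding Suc transport.simps(2) by simp
  qed simp
qed

text \<open>The Leibniz rule: if X' = [Y, X] and Z' = [Y, Z], the Jacobi identity gives [X, Z]' =
  [Y, [X, Z]]. A zero initial bracket therefore stays zero.\<close>

lemma conv_transport_Suc:
  fixes Y x z
  defines "X \<equiv> transport Y x" and "Z \<equiv> transport Y z"
  shows "of_nat (Suc k) *s conv X Z (Suc k) = conv Y (conv X Z) k"
proof -
  have "of_nat (Suc k) *s conv X Z (Suc k) =
      (\<Sum>i\<le>Suc k. br (of_nat i *s X i) (Z (Suc k - i)) + br (X i) (of_nat (Suc k - i) *s Z (Suc k - i)))"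
    unfolding conv_def scale_sum_right
  proof (rule sum.cong[OF refl])
    fix i assume "i \<in> {..Suc k}"
    then have "of_nat (Suc k) = of_nat i + (of_nat (Suc k - i) :: complex)"
      by (simp flip: of_nat_add)
    then show "of_nat (Suc k) *s br (X i) (Z (Suc k - i)) =
        br (of_nat i *s X i) (Z (Suc k - i)) + br (X i) (of_nat (Suc k - i) *s Z (Suc k - i))"
      by (simp only: br_scale scale_left_distrib)
  qed
  also have "\<dots> = (\<Sum>i\<le>Suc k. br (of_nat i *s X i) (Z (Suc k - i))) +
      (\<Sum>i\<le>Suc k. br (X i) (of_nat (Suc k - i) *s Z (Suc k - i)))"
    by (rule sum.distrib)
  also have "(\<Sum>i\<le>Suc k. br (of_nat i *s X i) (Z (Suc k - i))) = conv (conv Y X) Z k"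
    unfolding sum.atMost_Suc_shift X_def conv_def[of "conv Y (transport Y x)"]
    by (simp del: of_nat_Suc add: transport_Suc br_0)
  also have "(\<Sum>i\<le>Suc k. br (X i) (of_nat (Suc k - i) *s Z (Suc k - i))) =
      (\<Sum>i\<le>k. br (X i) (of_nat (Suc k - i) *s Z (Suc k - i)))"
    by (simp add: br_0)
  also have "\<dots> = conv X (conv Y Z) k"
    unfolding conv_def[of X "conv Y Z"]
  proof (rule sum.cong[OF refl])
    fix i assume "i \<in> {..k}"
    then have "Suc k - i = Suc (k - i)" by auto
    then show "br (X i) (of_nat (Suc k - i) *s Z (Suc k - i)) = br (X i) (conv Y Z (k - i))"
      by (simp only: Z_def transport_Suc)
  qed
  finally show ?thesis unfolding conv_jacobi[of Y X Z] .
qed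

lemma conv_transport_zero:
  assumes "br x z = 0"
  shows "conv (transport Y x) (transport Y z) k = 0"
proof (induction k rule: less_induct)
  case (less k)
  show ?case
  proof (cases k)
    case 0
    then show ?thesis using assms by (simp add: conv_def)
  next
    case (Suc j)
    have "of_nat (Suc j) *s conv (transport Y x) (transport Y z) (Suc j) = 0"
      unfolding conv_transport_Suc conv_def[of Y] using less.IH Suc by (simp add: br_0)
    then show ?thesis using Suc by (simp del: of_nat_Suc)
  qed
qed

text \<open>If \<open>\<phi> (br b (br x z))\<close> vanishes for all b in a spanning set, then
  [x, z] is in the kernel, hence zero by \<open>img\<close>, hence \<open>\<rho> z = 0\<close> by
  \<open>van\<close>. So \<rho> is a combination of these functionals of z, and the coefficients
  assemble to \<open>y\<close>.\<close>

lemma deformation_equation_solvable: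
  assumes \<phi>: "functional \<phi>" and \<rho>: "functional \<rho>" and x: "x \<in> G"
    and img: "\<And>z. z \<in> G \<Longrightarrow> (\<And>y. y \<in> G \<Longrightarrow> \<phi> (br (br x z) y) = 0) \<Longrightarrow> br x z = 0"
    and van: "\<And>z. z \<in> G \<Longrightarrow> br x z = 0 \<Longrightarrow> \<rho> z = 0"
  shows "\<exists>y\<in>G. \<forall>z\<in>G. \<phi> (br y (br x z)) = \<rho> z"
proof -
  obtain B where B: "finite B" "G = span B" using G(2) by blast
  define \<gamma> where "\<gamma> b z = \<phi> (br b (br x z))" for b z
  have \<gamma>: "functional (\<gamma> b)" for b
    unfolding functional_def \<gamma>_def
    by (simp add: br_add br_scale functional_add[OF \<phi>] functional_scale[OF \<phi>])
  have "\<rho> z = 0" if z: "z \<in> G" "\<And>b. b \<in> B \<Longrightarrow> \<gamma> b z = 0" for z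
  proof -
    have "\<phi> (br y (br x z)) = 0" if "y \<in> span B" for y
      using that
    proof (induction rule: span_induct_alt)
      case base
      then show ?case by (simp add: br_0 functional_0[OF \<phi>])
    next
      case (step c b y)
      then show ?case using z(2)[of b]
        by (simp add: br_add br_scale functional_add[OF \<phi>] functional_scale[OF \<phi>] \<gamma>_def)
    qed
    then have "\<phi> (br (br x z) y) = 0" if "y \<in> G" for y
      using that B br_anti[of "br x z" y] functional_minus[OF \<phi>] by simp
    then show ?thesis using img van z(1) by blast
  qed
  then obtain c where c: "\<forall>z\<in>G. \<rho> z = (\<Sum>b\<in>B. c b * \<gamma> b z)"
    using functional_combination[OF B(1) G(1) \<rho>, of \<gamma>] \<gamma> by blast
  have "(\<Sum>b\<in>B. c b *s b) \<in> G"
    unfolding B(2) by (intro span_sum span_scale span_base)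
  moreover have "\<phi> (br (\<Sum>b\<in>B. c b *s b) (br x z)) = \<rho> z" if "z \<in> G" for z
    using c that by (simp add: br_sum br_scale functional_sum[OF \<phi>] functional_scale[OF \<phi>] \<gamma>_def)
  ultimately show ?thesis by blast
qed

text \<open>Coefficient \<open>k\<close> of \<open>(\<psi> + Y \<cdot> (\<phi> + t \<psi>)) [X, u]\<close>, where \<open>Y \<cdot> \<omega> = \<omega> \<circ> [Y, \<sqdot>]\<close>: if
  this vanishes and \<open>X' = [Y, X]\<close>, then the \<open>t\<close>-derivative of \<open>(\<phi> + t \<psi>) [X, u]\<close> is
  \<open>- (\<phi> + t \<psi>) [X, [Y, u]]\<close>.\<close>

definition defect :: "('a \<Rightarrow> complex) \<Rightarrow> ('a \<Rightarrow> complex) \<Rightarrow> (nat \<Rightarrow> 'a) \<Rightarrow> (nat \<Rightarrow> 'a) \<Rightarrow> 'a \<Rightarrow> nat \<Rightarrow> complex"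
  where "defect \<phi> \<psi> Y X u k = \<psi> (br (X k) u) + (\<Sum>i\<le>k. \<phi> (br (Y i) (br (X (k - i)) u))) +
     (\<Sum>i<k. \<psi> (br (Y i) (br (X (k - 1 - i)) u)))"

text \<open>The sum is the coefficient of the defect with the series Z in place of the constant
  \<open>u\<close>. Regrouped, every part contains a coefficient of [X, Z], which is zero.\<close>

lemma sum_defect_transport:
  fixes Y x z
  assumes \<phi>: "functional \<phi>" and \<psi>: "functional \<psi>" and xz: "br x z = 0"
  defines "X \<equiv> transport Y x" and "Z \<equiv> transport Y z"
  shows "(\<Sum>l\<le>k. defect \<phi> \<psi> Y X (Z l) (k - l)) = 0"
proof -
  have conv0: "(\<Sum>l\<le>k. br (X (k - l)) (Z l)) = 0" for k
  proof -
    have "(\<Sum>l\<le>k. br (X (k - l)) (Z l)) = conv X Z k"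
      unfolding conv_def
      by (rule sum.reindex_bij_witness[of _ "\<lambda>i. k - i" "\<lambda>i. k - i"]) auto
    then show ?thesis using conv_transport_zero[OF xz] by (simp add: X_def Z_def)
  qed
  have pair: "(\<Sum>l\<le>k. \<Sum>i\<le>k - l. \<omega> (br (Y i) (br (X (k - l - i)) (Z l)))) = 0"
    if \<omega>: "functional \<omega>" for \<omega> k
  proof -
    have "(\<Sum>l\<le>k. \<Sum>i\<le>k - l. \<omega> (br (Y i) (br (X (k - l - i)) (Z l)))) =
        (\<Sum>i\<le>k. \<Sum>l\<le>k - i. \<omega> (br (Y i) (br (X (k - l - i)) (Z l))))"
      by (rule triangle_swap)
    also have "\<dots> = (\<Sum>i\<le>k. \<omega> (br (Y i) (\<Sum>l\<le>k - i. br (X (k - i - l)) (Z l))))"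
      by (simp add: br_sum functional_sum[OF \<omega>] add.commute)
    finally show ?thesis unfolding conv0 br_0 functional_0[OF \<omega>] by simp
  qed
  have 1: "(\<Sum>l\<le>k. \<psi> (br (X (k - l)) (Z l))) = 0"
    using functional_sum[OF \<psi>, of "\<lambda>l. br (X (k - l)) (Z l)" "{..k}"] conv0 functional_0[OF \<psi>] by simp
  have 3: "(\<Sum>l\<le>k. \<Sum>i<k - l. \<psi> (br (Y i) (br (X (k - l - 1 - i)) (Z l)))) = 0"
  proof (cases k)
    case (Suc m)
    have "(\<Sum>l\<le>k. \<Sum>i<k - l. \<psi> (br (Y i) (br (X (k - l - 1 - i)) (Z l)))) =
        (\<Sum>l\<le>m. \<Sum>i<k - l. \<psi> (br (Y i) (br (X (k - l - 1 - i)) (Z l))))"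
      unfolding Suc by simp
    also have "\<dots> = (\<Sum>l\<le>m. \<Sum>i\<le>m - l. \<psi> (br (Y i) (br (X (m - l - i)) (Z l))))"
    proof (intro sum.cong refl)
      fix l assume "l \<in> {..m}"
      then show "{..<k - l} = {..m - l}" unfolding Suc by auto
    next
      fix l i
      have "k - l - 1 - i = m - l - i" unfolding Suc by simp
      then show "\<psi> (br (Y i) (br (X (k - l - 1 - i)) (Z l))) = \<psi> (br (Y i) (br (X (m - l - i)) (Z l)))"
        by simp
    qed
    finally show ?thesis using pair[OF \<psi>] by simp
  qed simp
  show ?thesis
    unfolding defect_def sum.distrib using 1 pair[OF \<phi>, of k] 3 by simp
qed

text \<open>The coefficients of \<open>Y\<close> are chosen one by one. The equation for \<open>Y k\<close> is solvable because its
  right-hand side vanishes on the centralizer of \<open>x\<close>: an element \<open>z\<close> of it is transported to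
  \<open>Z\<close> with \<open>[X, Z] = 0\<close>.\<close>

lemma defect_free_transport:
  assumes \<phi>: "functional \<phi>" and \<psi>: "functional \<psi>" and x: "x \<in> G"
    and img: "\<And>z. z \<in> G \<Longrightarrow> (\<And>y. y \<in> G \<Longrightarrow> \<phi> (br (br x z) y) = 0) \<Longrightarrow> br x z = 0"
  obtains Y :: "nat \<Rightarrow> 'a" where "\<And>k. Y k \<in> G" "\<And>k u. u \<in> G \<Longrightarrow> defect \<phi> \<psi> Y (transport Y x) u k = 0"
proof -
  \<comment> \<open>The defect without its summand for \<open>Y k\<close>, so the condition on
    \<open>Y k\<close> is a linear equation whose right-hand side depends on earlier coefficients
    alone.\<close>
  define D where "D f k u = \<psi> (br (transport f x k) u) + (\<Sum>i<k. \<phi> (br (f i) (br (transport f x (k - i)) u))) +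
     (\<Sum>i<k. \<psi> (br (f i) (br (transport f x (k - 1 - i)) u)))" for f k u
  define P where "P f k y \<longleftrightarrow> y \<in> G \<and> (\<forall>u\<in>G. D f k u + \<phi> (br y (br x u)) = 0)" for f k y
  have defect: "defect \<phi> \<psi> f (transport f x) u k = D f k u + \<phi> (br (f k) (br x u))" for f u k
    unfolding defect_def D_def by (simp add: lessThan_Suc_atMost[symmetric])
  have "\<exists>Y. \<forall>k. P Y k (Y k)"
  proof (rule dependent_wf_choice[OF wf_less_than])
    fix f g :: "nat \<Rightarrow> 'a" and k y
    assume "\<And>i. (i, k) \<in> less_than \<Longrightarrow> f i = g i"
    then have fg: "f i = g i" if "i < k" for i using that by simp
    then have "transport f x j = transport g x j" if "j \<le> k" for j
      using that by (intro transport_cong) auto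
    then have "D f k u = D g k u" for u
      unfolding D_def using fg by simp
    then show "P f k y = P g k y" unfolding P_def by simp
  next
    fix k and f :: "nat \<Rightarrow> 'a"
    assume "\<And>i. (i, k) \<in> less_than \<Longrightarrow> P f i (f i)"
    then have prev: "P f i (f i)" if "i < k" for i using that by simp
    then have fG: "f i \<in> G" if "i < k" for i using that unfolding P_def by blast
    have D: "functional (D f k)"
      unfolding functional_def D_def
      by (simp add: br_add br_scale functional_add[OF \<phi>] functional_scale[OF \<phi>] functional_add[OF \<psi>]
          functional_scale[OF \<psi>] sum.distrib sum_distrib_left algebra_simps)
    \<comment> \<open>In \<open>sum_defect_transport\<close> the summands with positive index vanish
      by the equations already solved, since the coefficients of Z lie in \<open>G\<close>. The one
      left over is the defect at z itself, and its summand for \<open>f k\<close> contains [x, z] =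
      0.\<close>
    have D0: "D f k z = 0" if z: "z \<in> G" "br x z = 0" for z
    proof -
      let ?Z = "transport f z"
      have "defect \<phi> \<psi> f (transport f x) (?Z l) (k - l) = 0" if "0 < l" "l \<le> k" for l
      proof -
        have "?Z l \<in> G" using transport_G fG z(1) that by auto
        then show ?thesis using prev[of "k - l"] that unfolding defect P_def by simp
      qed
      then have "(\<Sum>l\<le>k. defect \<phi> \<psi> f (transport f x) (?Z l) (k - l)) = defect \<phi> \<psi> f (transport f x) z k"
        unfolding atMost_atLeast0 by (subst sum.atLeast_Suc_atMost) (auto intro!: sum.neutral)
      then have "defect \<phi> \<psi> f (transport f x) z k = 0"
        using sum_defect_transport[OF \<phi> \<psi> z(2)] by simp
      then show ?thesis unfolding defect z(2) by (simp add: br_0 functional_0[OF \<phi>])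
    qed
    have "functional (\<lambda>z. - D f k z)"
      using D unfolding functional_def by simp
    then have "\<exists>y\<in>G. \<forall>z\<in>G. \<phi> (br y (br x z)) = - D f k z"
      by (rule deformation_equation_solvable[OF \<phi> _ x img]) (simp_all add: D0)
    then obtain y where "y \<in> G" "\<forall>z\<in>G. \<phi> (br y (br x z)) = - D f k z" by blast
    then show "\<exists>y. P f k y" unfolding P_def by auto
  qed
  then obtain Y where "\<forall>k. P Y k (Y k)" by blast
  then have "Y k \<in> G" and "u \<in> G \<Longrightarrow> defect \<phi> \<psi> Y (transport Y x) u k = 0" for k u
    unfolding defect P_def by blast+
  then show thesis by (rule that)
qed

text \<open>Let K(u) be the series (\<phi> + t \<psi>) [X, u]. By X' = [Y, X] and the Jacobi
  identity, K(u)' is the defect minus the series obtained from u by bracketing with Y; the defect is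
  zero, so all coefficients vanish successively, starting from \<phi> [x, u] = 0. Moreover X 1 =
  [Y 0, x], on which \<phi> vanishes because x is in its kernel.\<close>

lemma kernel_deformation:
  assumes \<phi>: "functional \<phi>" and \<psi>: "functional \<psi>" and x: "x \<in> G"
    and ker: "\<And>z. z \<in> G \<Longrightarrow> \<phi> (br x z) = 0"
    and img: "\<And>z. z \<in> G \<Longrightarrow> (\<And>y. y \<in> G \<Longrightarrow> \<phi> (br (br x z) y) = 0) \<Longrightarrow> br x z = 0"
  obtains X :: "nat \<Rightarrow> 'a" where "X 0 = x" "\<And>k. X k \<in> G" "\<phi> (X 1) = 0"
    "\<And>k u. u \<in> G \<Longrightarrow> \<phi> (br (X k) u) + (if k = 0 then 0 else \<psi> (br (X (k - 1)) u)) = 0"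
proof -
  obtain Y where Y: "\<And>k. Y k \<in> G" "\<And>k u. u \<in> G \<Longrightarrow> defect \<phi> \<psi> Y (transport Y x) u k = 0"
    using defect_free_transport[OF \<phi> \<psi> x img] by blast
  define X where "X = transport Y x"
  have X_G: "X k \<in> G" for k unfolding X_def by (rule transport_G) (use Y x in auto)
  define K where "K u k = \<phi> (br (X k) u) + (if k = 0 then 0 else \<psi> (br (X (k - 1)) u))" for u k
  have br_Suc: "of_nat (Suc k) * \<omega> (br (X (Suc k)) u) =
      (\<Sum>i\<le>k. \<omega> (br (Y i) (br (X (k - i)) u))) - (\<Sum>i\<le>k. \<omega> (br (X (k - i)) (br (Y i) u)))"
    if \<omega>: "functional \<omega>" for \<omega> k u
  proof -
    have "of_nat (Suc k) * \<omega> (br (X (Suc k)) u) = \<omega> (br (conv Y X k) u)"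
      unfolding X_def transport_Suc[symmetric] br_scale functional_scale[OF \<omega>] ..
    also have "\<dots> = (\<Sum>i\<le>k. \<omega> (br (br (Y i) (X (k - i))) u))"
      by (simp add: conv_def br_sum functional_sum[OF \<omega>])
    also have "\<dots> = (\<Sum>i\<le>k. \<omega> (br (Y i) (br (X (k - i)) u)) - \<omega> (br (X (k - i)) (br (Y i) u)))"
      by (rule sum.cong) (simp_all add: jacobi[of "Y _"] functional_add[OF \<omega>])
    finally show ?thesis by (simp only: sum_subtractf)
  qed
  have K: "K u k = 0" if "u \<in> G" for u k
    using that
  proof (induction k arbitrary: u rule: less_induct)
    case (less k)
    show ?case
    proof (cases k)
      case 0
      then show ?thesis using ker less.prems by (simp add: K_def X_def)
    next
      case (Suc m)
      \<comment> \<open>Coefficient form of the product rule for t \<psi> [X, u]; the extra summand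
        comes from differentiating t.\<close>
      have \<psi>m: "of_nat (Suc m) * \<psi> (br (X m) u) = \<psi> (br (X m) u) +
          ((\<Sum>i<m. \<psi> (br (Y i) (br (X (m - 1 - i)) u))) - (\<Sum>i<m. \<psi> (br (X (m - 1 - i)) (br (Y i) u))))"
      proof (cases m)
        case (Suc j)
        show ?thesis using br_Suc[OF \<psi>, of j u] unfolding Suc
          by (simp add: algebra_simps lessThan_Suc_atMost)
      qed simp
      have "(\<Sum>i\<le>m. K (br (Y i) u) (m - i)) =
          (\<Sum>i\<le>m. \<phi> (br (X (m - i)) (br (Y i) u))) + (\<Sum>i<m. \<psi> (br (X (m - 1 - i)) (br (Y i) u)))"
      proof -
        have "(\<Sum>i\<le>m. if m - i = 0 then 0 else \<psi> (br (X (m - i - 1)) (br (Y i) u))) =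
            (\<Sum>i<m. if m - i = 0 then 0 else \<psi> (br (X (m - i - 1)) (br (Y i) u)))"
          unfolding lessThan_Suc_atMost[symmetric] by simp
        also have "\<dots> = (\<Sum>i<m. \<psi> (br (X (m - 1 - i)) (br (Y i) u)))"
          by (rule sum.cong) (auto simp: diff_commute)
        finally show ?thesis unfolding K_def sum.distrib by simp
      qed
      moreover have "of_nat k * K u k = of_nat (Suc m) * \<phi> (br (X (Suc m)) u) + of_nat (Suc m) * \<psi> (br (X m) u)"
        unfolding Suc K_def by (simp add: algebra_simps)
      ultimately have "of_nat k * K u k = defect \<phi> \<psi> Y X u m - (\<Sum>i\<le>m. K (br (Y i) u) (m - i))"
        unfolding br_Suc[OF \<phi>] \<psi>m defect_def by (simp add: algebra_simps)
      also have "(\<Sum>i\<le>m. K (br (Y i) u) (m - i)) = 0"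
        by (rule sum.neutral) (use less Suc Y(1) G_br in auto)
      also have "defect \<phi> \<psi> Y X u m = 0" using Y(2) less.prems unfolding X_def by blast
      finally show ?thesis using Suc by (simp del: of_nat_Suc)
    qed
  qed
  have "\<phi> (X 1) = 0"
  proof -
    have "X 1 = br (Y 0) x"
      using transport_Suc[of 0 Y x] by (simp add: conv_def X_def)
    then show ?thesis using ker[OF Y(1)[of 0]] br_anti[of "Y 0" x] functional_minus[OF \<phi>] by simp
  qed
  then show thesis using that[of X] X_G K unfolding K_def by (simp add: X_def)
qed

end

section \<open>Contact forms\<close>

text \<open>Each permutation of the last q arguments, shifted past the first p, can be absorbed into
  the outer permutation without changing signs. The inner sum thus repeats one value q! times, which
  cancels \<open>fact q\<close> in the definition of \<open>wedge\<close>.\<close>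

lemma wedge_antisymmetrized:
  fixes B :: "'a form"
  assumes \<beta>: "\<And>z. \<beta> z = c * (\<Sum>\<tau> | \<tau> permutes {..<q}. of_int (sign \<tau>) * B (\<lambda>i. z (\<tau> i)))"
    and \<alpha>: "\<And>y z. (\<And>i. i < p \<Longrightarrow> y i = z i) \<Longrightarrow> \<alpha> y = \<alpha> z"
    and B: "\<And>y z. (\<And>i. i < q \<Longrightarrow> y i = z i) \<Longrightarrow> B y = B z"
  shows "wedge p q \<alpha> \<beta> x = c / fact p *
    (\<Sum>\<sigma> | \<sigma> permutes {..<p + q}. of_int (sign \<sigma>) * (\<alpha> (\<lambda>i. x (\<sigma> i)) * B (\<lambda>i. x (\<sigma> (p + i)))))"
proof -
  let ?P = "\<lambda>n. {\<sigma> :: nat \<Rightarrow> nat. \<sigma> permutes {..<n}}"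
  define Q where "Q \<sigma> = \<alpha> (\<lambda>i. x (\<sigma> i)) * B (\<lambda>i. x (\<sigma> (p + i)))" for \<sigma> :: "nat \<Rightarrow> nat"
  define shift where "shift \<tau> = map_permutation {..<q} (\<lambda>i. p + i) \<tau>" for \<tau>
  have inj: "inj_on (\<lambda>i. p + i) {..<q}" by simp
  have bij: "bij_betw (\<lambda>i. p + i) {..<q} {p..<p + q}"
    by (rule bij_betw_byWitness[where f' = "\<lambda>i. i - p"]) auto
  have perm: "shift \<tau> permutes {p..<p + q}" if "\<tau> permutes {..<q}" for \<tau>
    unfolding shift_def by (rule map_permutation_permutes[OF bij that])
  have perm': "shift \<tau> permutes {..<p + q}" if "\<tau> permutes {..<q}" for \<tau>
    by (rule permutes_subset[OF perm[OF that]]) auto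
  have sgn: "sign (shift \<tau>) = sign \<tau>" if "\<tau> permutes {..<q}" for \<tau>
    using evenperm_map_permutation[OF inj that] unfolding shift_def sign_def by simp
  have "(\<Sum>\<sigma>\<in>?P (p + q). of_int (sign \<sigma>) * \<alpha> (\<lambda>i. x (\<sigma> i)) * \<beta> (\<lambda>i. x (\<sigma> (p + i)))) =
      (\<Sum>\<sigma>\<in>?P (p + q). \<Sum>\<tau>\<in>?P q. c * (of_int (sign \<sigma>) * of_int (sign \<tau>) *
        (\<alpha> (\<lambda>i. x (\<sigma> i)) * B (\<lambda>i. x (\<sigma> (p + \<tau> i))))))"
    by (simp add: \<beta> sum_distrib_left mult_ac)
  also have "\<dots> = (\<Sum>\<sigma>\<in>?P (p + q). \<Sum>\<tau>\<in>?P q. c * (of_int (sign (\<sigma> \<circ> shift \<tau>)) * Q (\<sigma> \<circ> shift \<tau>)))"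
  proof (intro sum.cong refl)
    fix \<sigma> \<tau> assume *: "\<sigma> \<in> ?P (p + q)" "\<tau> \<in> ?P q"
    have "permutation \<sigma>" "permutation (shift \<tau>)"
      using * perm' permutation_permutes by blast+
    from sign_compose[OF this] have s: "sign (\<sigma> \<circ> shift \<tau>) = sign \<sigma> * sign \<tau>"
      using sgn[of \<tau>] * by simp
    have "shift \<tau> i = i" if "i < p" for i
      using permutes_not_in[OF perm] * that by auto
    then have a: "\<alpha> (\<lambda>i. x (\<sigma> i)) = \<alpha> (\<lambda>i. x ((\<sigma> \<circ> shift \<tau>) i))"
      by (intro \<alpha>) simp
    have "shift \<tau> (p + i) = p + \<tau> i" if "i < q" for i
      unfolding shift_def using map_permutation_apply[OF inj, of i \<tau>] that by simp
    then have b: "B (\<lambda>i. x (\<sigma> (p + \<tau> i))) = B (\<lambda>i. x ((\<sigma> \<circ> shift \<tau>) (p + i)))"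
      by (intro B) simp
    show "c * (of_int (sign \<sigma>) * of_int (sign \<tau>) * (\<alpha> (\<lambda>i. x (\<sigma> i)) * B (\<lambda>i. x (\<sigma> (p + \<tau> i))))) =
        c * (of_int (sign (\<sigma> \<circ> shift \<tau>)) * Q (\<sigma> \<circ> shift \<tau>))"
      unfolding Q_def s a b by simp
  qed
  also have "\<dots> = (\<Sum>\<tau>\<in>?P q. \<Sum>\<sigma>\<in>?P (p + q). c * (of_int (sign (\<sigma> \<circ> shift \<tau>)) * Q (\<sigma> \<circ> shift \<tau>)))"
    by (rule sum.swap)
  also have "\<dots> = (\<Sum>\<tau>\<in>?P q. \<Sum>\<sigma>\<in>?P (p + q). c * (of_int (sign \<sigma>) * Q \<sigma>))"
  proof (rule sum.cong[OF refl])
    fix \<tau> assume "\<tau> \<in> ?P q"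
    then have "shift \<tau> permutes {..<p + q}" using perm' by blast
    from sum_permutations_compose_right[OF this, of "\<lambda>\<sigma>. c * (of_int (sign \<sigma>) * Q \<sigma>)"]
    show "(\<Sum>\<sigma>\<in>?P (p + q). c * (of_int (sign (\<sigma> \<circ> shift \<tau>)) * Q (\<sigma> \<circ> shift \<tau>))) =
        (\<Sum>\<sigma>\<in>?P (p + q). c * (of_int (sign \<sigma>) * Q \<sigma>))" by simp
  qed
  also have "\<dots> = fact q * (c * (\<Sum>\<sigma>\<in>?P (p + q). of_int (sign \<sigma>) * Q \<sigma>))"
    using card_permutations[of "{..<q}" q] by (simp add: sum_distrib_left)
  finally show ?thesis unfolding wedge_def Q_def by simp
qed

text \<open>The summand of \<phi> \<and> \<omega>^k for one ordering of the arguments: the 1-form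
  takes slot 0, the 2-forms the pairs (1, 2), (3, 4) and so on.\<close>

definition contact_term ::
    "('a \<Rightarrow> complex) \<Rightarrow> ('a \<Rightarrow> 'a \<Rightarrow> complex) \<Rightarrow> nat \<Rightarrow> (nat \<Rightarrow> 'a) \<Rightarrow> complex" where
  "contact_term \<phi> \<omega> k z = \<phi> (z 0) * (\<Prod>i<k. \<omega> (z (1 + 2 * i)) (z (2 + 2 * i)))"

text \<open>By \<open>wedge_antisymmetrized\<close> each new factor contributes only 1 / 2!, which
  gives the power of 2.\<close>

lemma wedge_power_2:
  "wedge_power 2 (\<lambda>z. \<omega> (z 0) (z 1)) k x = 1 / 2 ^ k *
     (\<Sum>\<sigma> | \<sigma> permutes {..<2 * k}. of_int (sign \<sigma>) * (\<Prod>i<k. \<omega> (x (\<sigma> (2 * i))) (x (\<sigma> (1 + 2 * i)))))"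
proof (induction k arbitrary: x)
  case 0
  have "{\<sigma> :: nat \<Rightarrow> nat. \<sigma> permutes {..<2 * 0}} = {id}" by auto
  then show ?case by simp
next
  case (Suc k)
  have "wedge_power 2 (\<lambda>z. \<omega> (z 0) (z 1)) (Suc k) x = 1 / 2 ^ k / fact 2 *
      (\<Sum>\<sigma> | \<sigma> permutes {..<2 + 2 * k}. of_int (sign \<sigma>) *
        (\<omega> (x (\<sigma> 0)) (x (\<sigma> 1)) * (\<Prod>i<k. \<omega> (x (\<sigma> (2 + 2 * i))) (x (\<sigma> (2 + (1 + 2 * i)))))))"
    unfolding wedge_power.simps
    by (rule wedge_antisymmetrized[where B = "\<lambda>z. \<Prod>i<k. \<omega> (z (2 * i)) (z (1 + 2 * i))", OF Suc.IH])
      (auto intro!: prod.cong)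
  also have "(\<lambda>\<sigma>. of_int (sign \<sigma>) *
        (\<omega> (x (\<sigma> 0)) (x (\<sigma> 1)) * (\<Prod>i<k. \<omega> (x (\<sigma> (2 + 2 * i))) (x (\<sigma> (2 + (1 + 2 * i))))))) =
      (\<lambda>\<sigma>. of_int (sign \<sigma>) * (\<Prod>i<Suc k. \<omega> (x (\<sigma> (2 * i))) (x (\<sigma> (1 + 2 * i)))))"
    by (simp only: prod.lessThan_Suc_shift) simp
  finally show ?case by simp
qed

lemma wedge_contact:
  "wedge 1 (2 * k) (one_form \<phi>) (wedge_power 2 (\<lambda>z. \<omega> (z 0) (z 1)) k) x = 1 / 2 ^ k *
     (\<Sum>\<sigma> | \<sigma> permutes {..<1 + 2 * k}. of_int (sign \<sigma>) * contact_term \<phi> \<omega> k (\<lambda>i. x (\<sigma> i)))"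
  by (subst wedge_antisymmetrized[where B = "\<lambda>z. \<Prod>i<k. \<omega> (z (2 * i)) (z (1 + 2 * i))"
        and c = "1 / 2 ^ k"])
    (auto intro!: prod.cong sum.cong simp: one_form_def contact_term_def wedge_power_2 simp del: One_nat_def)

text \<open>A permutation that maps each pair \<open>{1 + 2 i, 2 + 2 i}\<close> onto such a pair is even up to
  the reversals inside the pairs, because it acts in the same way on the first and on the second
  members.\<close>

lemma sign_pair_permutation:
  fixes \<sigma> :: "nat \<Rightarrow> nat" and k :: nat
  assumes "\<sigma> permutes {..<1 + 2 * k}" "\<sigma> 0 = 0"
    and "\<And>i. i < k \<Longrightarrow> odd (\<sigma> (1 + 2 * i)) \<and> \<sigma> (2 + 2 * i) = \<sigma> (1 + 2 * i) + 1 \<or>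
      odd (\<sigma> (2 + 2 * i)) \<and> \<sigma> (1 + 2 * i) = \<sigma> (2 + 2 * i) + 1"
  shows "sign \<sigma> = (\<Prod>i<k. if odd (\<sigma> (1 + 2 * i)) then 1 else - 1)"
  using assms
proof (induction "card {i. i < k \<and> even (\<sigma> (1 + 2 * i))}" arbitrary: \<sigma>)
  case 0
  note \<sigma> = 0(2,3,4)
  have odd: "odd (\<sigma> (1 + 2 * i))" if "i < k" for i
    using 0(1) that by auto
  then have next_eq: "\<sigma> (2 + 2 * i) = \<sigma> (1 + 2 * i) + 1" if "i < k" for i
    using \<sigma>(3)[OF that] odd[OF that] by auto
  define \<pi> where "\<pi> i = (if i < k then \<sigma> (1 + 2 * i) div 2 else i)" for i
  have \<sigma>1: "\<sigma> (1 + 2 * i) = 1 + 2 * \<pi> i" if "i < k" for i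
    using odd[OF that] that by (simp add: \<pi>_def odd_two_times_div_two_succ)
  have \<pi>_less: "\<pi> i < k" if "i < k" for i
  proof -
    have "\<sigma> (2 + 2 * i) < 1 + 2 * k" using permutes_in_image[OF \<sigma>(1), of "2 + 2 * i"] that by simp
    then show ?thesis using next_eq[OF that] \<sigma>1[OF that] by simp
  qed
  have \<pi>: "\<pi> permutes {..<k}"
  proof (rule bij_imp_permutes)
    have "inj_on \<pi> {..<k}"
    proof (rule inj_onI)
      fix i j assume "i \<in> {..<k}" "j \<in> {..<k}" "\<pi> i = \<pi> j"
      then have "\<sigma> (1 + 2 * i) = \<sigma> (1 + 2 * j)" using \<sigma>1 by simp
      from injD[OF permutes_inj[OF \<sigma>(1)] this] show "i = j" by simp
    qed
    moreover have "\<pi> ` {..<k} \<subseteq> {..<k}" using \<pi>_less by auto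
    ultimately show "bij_betw \<pi> {..<k} {..<k}"
      unfolding bij_betw_def using endo_inj_surj[of "{..<k}" \<pi>] by blast
  qed (simp add: \<pi>_def)
  let ?f = "\<lambda>i::nat. 1 + 2 * i" and ?g = "\<lambda>i::nat. 2 + 2 * i"
  let ?a = "map_permutation {..<k} ?f \<pi>" and ?b = "map_permutation {..<k} ?g \<pi>"
  have inj: "inj_on ?f {..<k}" "inj_on ?g {..<k}" by (auto simp: inj_on_def)
  have a: "?a permutes ?f ` {..<k}" and b: "?b permutes ?g ` {..<k}"
    using inj by (auto intro!: map_permutation_permutes[OF _ \<pi>] simp: bij_betw_def)
  have "\<sigma> = ?a \<circ> ?b"
  proof
    fix j
    consider "j = 0" | "j \<ge> 1 + 2 * k" | i where "i < k" "j = ?f i" | i where "i < k" "j = ?g i"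
    proof -
      have "j = 0 \<or> j = ?f ((j - 1) div 2) \<or> j = ?g ((j - 1) div 2)" by presburger
      moreover have "(j - 1) div 2 < k" if "j < 1 + 2 * k" "j \<noteq> 0" using that by auto
      moreover have "j = 0 \<or> j \<ge> 1 + 2 * k \<or> j < 1 + 2 * k \<and> j \<noteq> 0" by linarith
      ultimately show thesis using that by metis
    qed
    then show "\<sigma> j = (?a \<circ> ?b) j"
    proof cases
      case 1
      have "?a 0 = 0" "?b 0 = 0" using permutes_not_in[OF a] permutes_not_in[OF b] by auto
      then show ?thesis using 1 \<sigma>(2) by simp
    next
      case 2
      have "j \<notin> ?f ` {..<k}" "j \<notin> ?g ` {..<k}" using 2 by auto
      then have "?a j = j" "?b j = j" using permutes_not_in[OF a] permutes_not_in[OF b] by auto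
      then show ?thesis using permutes_not_in[OF \<sigma>(1)] 2 by simp
    next
      case 3
      have "j \<notin> ?g ` {..<k}" using 3 by (auto, presburger)
      then have "?b j = j" using permutes_not_in[OF b] by auto
      then show ?thesis using map_permutation_apply[OF inj(1), of i \<pi>] \<sigma>1 3 by simp
    next
      case 4
      have e: "?b j = ?g (\<pi> i)" using map_permutation_apply[OF inj(2), of i \<pi>] 4 by simp
      have "?g (\<pi> i) \<notin> ?f ` {..<k}" by (auto, presburger)
      then have "?a (?g (\<pi> i)) = ?g (\<pi> i)" using permutes_not_in[OF a] by auto
      then show ?thesis using e 4 next_eq \<sigma>1 by simp
    qed
  qed
  moreover have "permutation ?a" "permutation ?b"
    using a b permutation_permutes by (metis finite_imageI finite_lessThan)+
  moreover have "sign ?a = sign \<pi>" "sign ?b = sign \<pi>"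
    using evenperm_map_permutation[OF inj(1) \<pi>] evenperm_map_permutation[OF inj(2) \<pi>]
    unfolding sign_def by auto
  ultimately have "sign \<sigma> = 1" by (simp add: sign_compose)
  then show ?case using odd by simp
next
  case (Suc n)
  have "{i. i < k \<and> even (\<sigma> (1 + 2 * i))} \<noteq> {}"
  proof
    assume "{i. i < k \<and> even (\<sigma> (1 + 2 * i))} = {}"
    then show False using Suc.hyps(2) by (simp only: card.empty nat.distinct)
  qed
  then obtain i where i: "i < k" "even (\<sigma> (1 + 2 * i))" by blast
  \<comment> \<open>Undoing one reversed pair changes both the sign of the permutation and one
    factor of the product.\<close>
  define t where "t = transpose (1 + 2 * i) (2 + 2 * i)"
  define \<sigma>' where "\<sigma>' = \<sigma> \<circ> t"
  have t: "t permutes {..<1 + 2 * k}"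
    unfolding t_def by (rule permutes_swap_id) (use i in auto)
  have \<sigma>'_i: "\<sigma>' (1 + 2 * i) = \<sigma> (2 + 2 * i)" "\<sigma>' (2 + 2 * i) = \<sigma> (1 + 2 * i)"
    by (auto simp: \<sigma>'_def t_def)
  have \<sigma>'_j: "\<sigma>' (1 + 2 * j) = \<sigma> (1 + 2 * j)" "\<sigma>' (2 + 2 * j) = \<sigma> (2 + 2 * j)" if "j \<noteq> i" for j
  proof -
    have "1 + 2 * j \<noteq> 1 + 2 * i" "1 + 2 * j \<noteq> 2 + 2 * i" "2 + 2 * j \<noteq> 1 + 2 * i" "2 + 2 * j \<noteq> 2 + 2 * i"
      using that by presburger+
    then show "\<sigma>' (1 + 2 * j) = \<sigma> (1 + 2 * j)" "\<sigma>' (2 + 2 * j) = \<sigma> (2 + 2 * j)"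
      unfolding \<sigma>'_def t_def transpose_def by simp_all
  qed
  have odd_i: "odd (\<sigma> (2 + 2 * i))" "\<sigma> (1 + 2 * i) = \<sigma> (2 + 2 * i) + 1"
    using Suc.prems(3)[OF i(1)] i(2) by auto
  have "{j. j < k \<and> even (\<sigma>' (1 + 2 * j))} = {j. j < k \<and> even (\<sigma> (1 + 2 * j))} - {i}"
  proof (rule Set.set_eqI)
    fix j
    show "j \<in> {j. j < k \<and> even (\<sigma>' (1 + 2 * j))} \<longleftrightarrow> j \<in> {j. j < k \<and> even (\<sigma> (1 + 2 * j))} - {i}"
      using \<sigma>'_i(1) \<sigma>'_j(1)[of j] odd_i(1) by (cases "j = i") auto
  qed
  then have "n = card {j. j < k \<and> even (\<sigma>' (1 + 2 * j))}"
    using Suc.hyps(2) i by (simp add: card_Diff_singleton)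
  moreover have "\<sigma>' permutes {..<1 + 2 * k}"
    unfolding \<sigma>'_def by (rule permutes_compose[OF t Suc.prems(1)])
  moreover have "\<sigma>' 0 = 0" using Suc.prems(2) by (simp add: \<sigma>'_def t_def)
  moreover have "odd (\<sigma>' (1 + 2 * j)) \<and> \<sigma>' (2 + 2 * j) = \<sigma>' (1 + 2 * j) + 1 \<or>
      odd (\<sigma>' (2 + 2 * j)) \<and> \<sigma>' (1 + 2 * j) = \<sigma>' (2 + 2 * j) + 1" if "j < k" for j
    using Suc.prems(3)[OF that] \<sigma>'_i \<sigma>'_j[of j] odd_i by (cases "j = i") metis+
  ultimately have IH: "sign \<sigma>' = (\<Prod>j<k. if odd (\<sigma>' (1 + 2 * j)) then 1 else - 1)"
    by (rule Suc.hyps(1))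
  have "permutation \<sigma>" "permutation t"
    using Suc.prems(1) t permutation_permutes by blast+
  then have "sign \<sigma>' = sign \<sigma> * sign t" unfolding \<sigma>'_def by (rule sign_compose)
  moreover have "sign t = - 1" unfolding t_def sign_swap_id by simp
  ultimately have "sign \<sigma> = - sign \<sigma>'" by simp
  also have "\<dots> = (\<Prod>j<k. if odd (\<sigma> (1 + 2 * j)) then 1 else - 1)"
  proof -
    have "(\<Prod>j\<in>{..<k} - {i}. if odd (\<sigma>' (1 + 2 * j)) then 1 else - 1 :: int) =
        (\<Prod>j\<in>{..<k} - {i}. if odd (\<sigma> (1 + 2 * j)) then 1 else - 1)"
      by (rule prod.cong) (use \<sigma>'_j(1) in auto)
    then show ?thesis
      unfolding IH using i \<sigma>'_i(1) odd_i(1)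
      by (simp add: prod.remove[of "{..<k}" i])
  qed
  finally show ?case .
qed

text \<open>Gram matrix of a standard symplectic basis in which partners stand next to each other,
  at indices 2 i and 2 i + 1.\<close>

definition symp_sign :: "nat \<Rightarrow> nat \<Rightarrow> complex" where
  "symp_sign a b = (if even a \<and> b = Suc a then 1 else if even b \<and> a = Suc b then - 1 else 0)"

section \<open>Symplectic bases of skew forms\<close>

context bilinear_lie_algebra
begin

definition symplectic :: "('a \<Rightarrow> 'a \<Rightarrow> complex) \<Rightarrow> 'a set \<Rightarrow> nat \<Rightarrow> (nat \<Rightarrow> 'a) \<Rightarrow> bool" where
  "symplectic \<omega> W k z \<longleftrightarrow> (\<forall>a<2 * k. z a \<in> W \<and> (\<forall>b<2 * k. \<omega> (z a) (z b) = symp_sign a b))"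

context
  fixes \<omega> :: "'a \<Rightarrow> 'a \<Rightarrow> complex"
  assumes \<omega>_left: "\<And>y. functional (\<lambda>x. \<omega> x y)" and \<omega>_anti: "\<And>x y. \<omega> y x = - \<omega> x y"
begin

lemma \<omega>_right: "functional (\<omega> x)"
  using \<omega>_left[of x] unfolding functional_def \<omega>_anti[of x] by simp

text \<open>Projection onto the span of the symplectic family along its \<omega>-orthogonal
  complement.\<close>

definition symp_proj :: "nat \<Rightarrow> (nat \<Rightarrow> 'a) \<Rightarrow> 'a \<Rightarrow> 'a" where
  "symp_proj k z u = (\<Sum>i<k. \<omega> u (z (2 * i + 1)) *s z (2 * i) - \<omega> u (z (2 * i)) *s z (2 * i + 1))"

lemma symp_proj:
  assumes z: "symplectic \<omega> W k z" and a: "a < 2 * k"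
  shows "\<omega> (symp_proj k z u) (z a) = \<omega> u (z a)"
proof -
  have "\<omega> (symp_proj k z u) (z a) =
      (\<Sum>i<k. \<omega> u (z (2 * i + 1)) * \<omega> (z (2 * i)) (z a) - \<omega> u (z (2 * i)) * \<omega> (z (2 * i + 1)) (z a))"
    unfolding symp_proj_def
    by (simp add: functional_sum[OF \<omega>_left] functional_diff[OF \<omega>_left] functional_scale[OF \<omega>_left])
  also have "\<dots> = (\<Sum>i<k. \<omega> u (z (2 * i + 1)) * symp_sign (2 * i) a - \<omega> u (z (2 * i)) * symp_sign (2 * i + 1) a)"
    by (rule sum.cong) (use z a in \<open>auto simp: symplectic_def\<close>)
  also have "\<dots> = (\<Sum>i<k. if i = a div 2 then \<omega> u (z a) else 0)"
  proof (rule sum.cong[OF refl])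
    fix i
    consider "a = 2 * i" | "a = 2 * i + 1" | "a div 2 \<noteq> i" by fastforce
    then show "\<omega> u (z (2 * i + 1)) * symp_sign (2 * i) a - \<omega> u (z (2 * i)) * symp_sign (2 * i + 1) a =
        (if i = a div 2 then \<omega> u (z a) else 0)"
      by cases (auto simp: symp_sign_def)
  qed
  also have "\<dots> = \<omega> u (z a)" using a by (simp add: less_mult_imp_div_less mult.commute)
  finally show ?thesis .
qed

lemma symplectic_independent:
  assumes z: "symplectic \<omega> W k z" and c: "(\<Sum>a<2 * k. c a *s z a) = 0" and b: "b < 2 * k"
  shows "c b = 0"
proof -
  have eq: "(\<Sum>a<2 * k. c a * symp_sign a m) = 0" if "m < 2 * k" for m
  proof -
    have "\<omega> (\<Sum>a<2 * k. c a *s z a) (z m) = (\<Sum>a<2 * k. c a * \<omega> (z a) (z m))"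
      by (simp add: functional_sum[OF \<omega>_left] functional_scale[OF \<omega>_left])
    also have "\<dots> = (\<Sum>a<2 * k. c a * symp_sign a m)"
      by (rule sum.cong) (use z that in \<open>auto simp: symplectic_def\<close>)
    finally show ?thesis using c functional_0[OF \<omega>_left] by simp
  qed
  show ?thesis
  proof (cases "even b")
    case True
    then have m: "Suc b < 2 * k" using b by presburger
    have "(\<Sum>a<2 * k. c a * symp_sign a (Suc b)) = (\<Sum>a<2 * k. if a = b then c b else 0)"
      by (rule sum.cong) (use True in \<open>auto simp: symp_sign_def\<close>)
    then show ?thesis using eq[OF m] b by simp
  next
    case False
    then obtain m where m: "b = Suc m" "even m" by (cases b) auto
    have "(\<Sum>a<2 * k. c a * symp_sign a m) = (\<Sum>a<2 * k. if a = b then - c b else 0)"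
      by (rule sum.cong) (use m in \<open>auto simp: symp_sign_def\<close>)
    then show ?thesis using eq[of m] m b by simp
  qed
qed

lemma symplectic_inj:
  assumes "symplectic \<omega> W k z"
  shows "inj_on z {..<2 * k}"
proof (rule inj_onI)
  fix a b assume ab: "a \<in> {..<2 * k}" "b \<in> {..<2 * k}" "z a = z b"
  show "a = b"
  proof (rule ccontr)
    assume ne: "a \<noteq> b"
    define c where "c i = (if i = a then 1 else if i = b then - 1 else (0::complex))" for i
    have "(\<Sum>i<2 * k. c i *s z i) = (\<Sum>i\<in>{a, b}. c i *s z i)"
      by (rule sum.mono_neutral_right) (use ab in \<open>auto simp: c_def\<close>)
    also have "\<dots> = 0" using ne ab by (simp add: c_def)
    finally have "c a = 0" using symplectic_independent[OF assms, of c a] ab by simp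
    then show False by (simp add: c_def)
  qed
qed

text \<open>Symplectic families are independent, so there is a longest one. If a nonzero w were
  orthogonal to it, a vector u pairing nontrivially with w, corrected by \<open>symp_proj\<close>
  and rescaled, would together with w form a further pair. Hence every vector equals its
  projection.\<close>

lemma symplectic_basis:
  assumes W: "subspace W" "W \<subseteq> G"
    and nondeg: "\<And>w. w \<in> W \<Longrightarrow> w \<noteq> 0 \<Longrightarrow> \<exists>u\<in>W. \<omega> w u \<noteq> 0"
  obtains k z where "symplectic \<omega> W k z" "W = span (z ` {..<2 * k})" "dim W = 2 * k"
proof -
  obtain B where B: "finite B" "G = span B" using G(2) by blast
  have indep: "independent (z ` {..<2 * k})" if z: "symplectic \<omega> W k z" for k z
  proof
    assume "dependent (z ` {..<2 * k})"
    then obtain u v where u: "(\<Sum>v\<in>z ` {..<2 * k}. u v *s v) = 0" "v \<in> z ` {..<2 * k}" "u v \<noteq> 0"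
      by (subst (asm) dependent_finite) auto
    have "(\<Sum>a<2 * k. u (z a) *s z a) = 0"
      using u(1) sum.reindex[OF symplectic_inj[OF z], of "\<lambda>v. u v *s v"] by (simp add: comp_def)
    then show False using symplectic_independent[OF z, of "\<lambda>a. u (z a)"] u(2,3) by auto
  qed
  have card: "card (z ` {..<2 * k}) = 2 * k" if "symplectic \<omega> W k z" for k z
    using card_image[OF symplectic_inj[OF that]] by simp
  have "k \<le> card B" if "\<exists>z. symplectic \<omega> W k z" for k
  proof -
    obtain z where z: "symplectic \<omega> W k z" using \<open>\<exists>z. symplectic \<omega> W k z\<close> by blast
    have "z ` {..<2 * k} \<subseteq> span B" using z W B unfolding symplectic_def by auto
    then have "2 * k \<le> card B" using independent_span_bound[OF B(1) indep[OF z]] card[OF z] by simp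
    then show ?thesis by simp
  qed
  moreover have "\<exists>z. symplectic \<omega> W 0 z" by (simp add: symplectic_def)
  ultimately obtain k where k: "\<exists>z. symplectic \<omega> W k z" "\<And>m. \<exists>z. symplectic \<omega> W m z \<Longrightarrow> m \<le> k"
    using Nat.ex_has_greatest_nat[of "\<lambda>k. \<exists>z. symplectic \<omega> W k z" 0 "card B"] by blast
  obtain z where z: "symplectic \<omega> W k z" using k(1) by blast
  have proj_W: "symp_proj k z u \<in> W" for u
    unfolding symp_proj_def
    by (intro subspace_sum[OF W(1)] subspace_diff[OF W(1)] subspace_scale[OF W(1)])
      (use z in \<open>auto simp: symplectic_def\<close>)
  have perp: "w = 0" if w: "w \<in> W" "\<And>a. a < 2 * k \<Longrightarrow> \<omega> w (z a) = 0" for w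
  proof (rule ccontr)
    assume "w \<noteq> 0"
    then obtain u where u: "u \<in> W" "\<omega> w u \<noteq> 0" using nondeg w(1) by blast
    define v where "v = (1 / \<omega> w u) *s (u - symp_proj k z u)"
    have vW: "v \<in> W" unfolding v_def using u proj_W subspace_scale[OF W(1)] subspace_diff[OF W(1)] by blast
    have "\<omega> w (symp_proj k z u) = 0"
      unfolding symp_proj_def functional_sum[OF \<omega>_right] functional_diff[OF \<omega>_right] functional_scale[OF \<omega>_right]
      by (rule sum.neutral) (use w(2) in auto)
    then have wv: "\<omega> w v = 1"
      using u(2) by (simp add: v_def functional_diff[OF \<omega>_right] functional_scale[OF \<omega>_right])
    have vz: "\<omega> v (z a) = 0" if "a < 2 * k" for a
      using symp_proj[OF z that, of u]
      by (simp add: v_def functional_diff[OF \<omega>_left] functional_scale[OF \<omega>_left])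
    have vw: "\<omega> v w = - 1" using \<omega>_anti[of v w] unfolding wv .
    have self: "\<omega> x x = 0" for x using \<omega>_anti[of x x] by simp
    define z' where "z' = (\<lambda>a. if a < 2 * k then z a else if a = 2 * k then w else v)"
    have "symplectic \<omega> W (Suc k) z'"
      unfolding symplectic_def
    proof (intro allI impI conjI)
      fix a assume a: "a < 2 * Suc k"
      then show "z' a \<in> W" using z w vW by (auto simp: z'_def symplectic_def)
      fix b assume b: "b < 2 * Suc k"
      have ab: "a < 2 * k \<or> a = 2 * k \<or> a = Suc (2 * k)" "b < 2 * k \<or> b = 2 * k \<or> b = Suc (2 * k)"
        using a b by auto
      have zz: "\<omega> (z a) (z b) = symp_sign a b" if "a < 2 * k" "b < 2 * k"
        using z that unfolding symplectic_def by blast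
      have zw: "\<omega> (z c) w = 0" "\<omega> (z c) v = 0" "\<omega> w (z c) = 0" "\<omega> v (z c) = 0" if "c < 2 * k" for c
        using w(2)[OF that] vz[OF that] \<omega>_anti[of w "z c"] \<omega>_anti[of v "z c"] by auto
      have sgn: "symp_sign c (2 * k) = 0" "symp_sign c (Suc (2 * k)) = 0"
        "symp_sign (2 * k) c = 0" "symp_sign (Suc (2 * k)) c = 0" if "c < 2 * k" for c
        using that by (auto simp: symp_sign_def elim: evenE) presburger+
      have sgn': "symp_sign (2 * k) (2 * k) = 0" "symp_sign (2 * k) (Suc (2 * k)) = 1"
        "symp_sign (Suc (2 * k)) (2 * k) = - 1" "symp_sign (Suc (2 * k)) (Suc (2 * k)) = 0"
        by (auto simp: symp_sign_def)
      show "\<omega> (z' a) (z' b) = symp_sign a b"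
        using ab zz zw sgn sgn' wv vw self
        by (elim disjE) (simp_all add: z'_def)
    qed
    then show False using k(2)[of "Suc k"] by auto
  qed
  have W_span: "W = span (z ` {..<2 * k})"
  proof
    show "span (z ` {..<2 * k}) \<subseteq> W"
      by (rule span_minimal[OF _ W(1)]) (use z in \<open>auto simp: symplectic_def\<close>)
    show "W \<subseteq> span (z ` {..<2 * k})"
    proof
      fix w assume w: "w \<in> W"
      have "w - symp_proj k z w = 0"
        using perp[of "w - symp_proj k z w"] subspace_diff[OF W(1) w proj_W] symp_proj[OF z]
        by (simp add: functional_diff[OF \<omega>_left])
      moreover have "symp_proj k z w \<in> span (z ` {..<2 * k})"
        unfolding symp_proj_def by (intro span_sum span_diff span_scale span_base) auto
      ultimately show "w \<in> span (z ` {..<2 * k})" by simp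
    qed
  qed
  then have "dim W = 2 * k" using dim_span_eq_card_independent[OF indep[OF z]] card[OF z] by simp
  then show thesis using that z W_span by blast
qed

end
end

section \<open>The form \<phi> \<and> \<omega>^k as an alternating multilinear function\<close>

lemma prod_split_slot:
  fixes g :: "nat \<Rightarrow> 'a::comm_monoid_mult"
  assumes "j < k"
  shows "(\<Prod>i<k. g i) = g j * (\<Prod>i\<in>{..<k} - {j}. g i)"
  using assms by (simp add: prod.remove)

text \<open>The form \<phi> \<and> \<omega>^k on the vectors \<open>x\<close>, without the constant
  of \<open>wedge_contact\<close>.\<close>

definition contact_value ::
    "('a \<Rightarrow> complex) \<Rightarrow> ('a \<Rightarrow> 'a \<Rightarrow> complex) \<Rightarrow> nat \<Rightarrow> (nat \<Rightarrow> 'a) \<Rightarrow> complex" where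
  "contact_value \<phi> \<omega> k x =
     (\<Sum>\<sigma> | \<sigma> permutes {..<1 + 2 * k}. of_int (sign \<sigma>) * contact_term \<phi> \<omega> k (\<lambda>i. x (\<sigma> i)))"

lemma contact_value_alternating:
  assumes ij: "i < 1 + 2 * k" "j < 1 + 2 * k" "i \<noteq> j" "x i = x j"
  shows "contact_value \<phi> \<omega> k x = 0"
proof -
  define t where "t = transpose i j"
  let ?P = "{\<sigma>. \<sigma> permutes {..<1 + 2 * k}}"
  have t: "t permutes {..<1 + 2 * k}" unfolding t_def by (rule permutes_swap_id) (use ij in auto)
  have tt: "t \<circ> (t \<circ> \<sigma>) = \<sigma>" for \<sigma> unfolding t_def by (simp add: fun_eq_iff)
  have t_perm: "t \<circ> \<sigma> permutes {..<1 + 2 * k}" if "\<sigma> permutes {..<1 + 2 * k}" for \<sigma>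
    by (rule permutes_compose[OF that t])
  have xt: "x (t m) = x m" for m
    unfolding t_def transpose_def using ij(4) by simp
  have "contact_value \<phi> \<omega> k x =
      (\<Sum>\<sigma>\<in>?P. of_int (sign (t \<circ> \<sigma>)) * contact_term \<phi> \<omega> k (\<lambda>i. x ((t \<circ> \<sigma>) i)))"
    unfolding contact_value_def
    by (rule sum.reindex_bij_witness[of _ "\<lambda>\<sigma>. t \<circ> \<sigma>" "\<lambda>\<sigma>. t \<circ> \<sigma>"])
      (simp_all only: tt t_perm mem_Collect_eq)
  also have "\<dots> = (\<Sum>\<sigma>\<in>?P. - (of_int (sign \<sigma>) * contact_term \<phi> \<omega> k (\<lambda>i. x (\<sigma> i))))"
  proof (rule sum.cong[OF refl])
    fix \<sigma> assume "\<sigma> \<in> ?P"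
    then have "permutation \<sigma>" "permutation t" using t permutation_permutes by blast+
    then have "sign (t \<circ> \<sigma>) = - sign \<sigma>"
      using sign_compose[of t \<sigma>] ij(3) by (simp add: t_def sign_swap_id)
    then show "of_int (sign (t \<circ> \<sigma>)) * contact_term \<phi> \<omega> k (\<lambda>i. x ((t \<circ> \<sigma>) i)) =
        - (of_int (sign \<sigma>) * contact_term \<phi> \<omega> k (\<lambda>i. x (\<sigma> i)))"
      by (simp add: xt)
  qed
  also have "\<dots> = - contact_value \<phi> \<omega> k x" unfolding contact_value_def by (simp add: sum_negf)
  finally show ?thesis by simp
qed

lemma permutes_slot:
  fixes \<sigma> :: "nat \<Rightarrow> nat"
  assumes "\<sigma> permutes {..<n}" "j < n"
  obtains m where "m < n" "\<sigma> m = j" "\<forall>i. \<sigma> i = j \<longleftrightarrow> i = m"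
proof -
  let ?m = "inv_into UNIV \<sigma> j"
  have "?m < n" "\<sigma> ?m = j"
    using permutes_in_image[OF permutes_inv[OF assms(1)], of j] permutes_inverses(1)[OF assms(1)] assms(2) by auto
  then show thesis using that[of ?m] permutes_inverses(2)[OF assms(1)] by metis
qed

lemma slot_cases:
  fixes m :: nat
  assumes "m < 1 + 2 * k"
  obtains "m = 0" | i where "i < k" "m = 1 + 2 * i" | i where "i < k" "m = 2 + 2 * i"
proof -
  have "m = 0 \<or> (m - 1) div 2 < k \<and> (m = 1 + 2 * ((m - 1) div 2) \<or> m = 2 + 2 * ((m - 1) div 2))"
    using assms by presburger
  then show thesis using that by blast
qed

lemma contact_term_zero:
  assumes m: "m < 1 + 2 * k" and z: "\<phi> (z m) = 0" "\<And>i. i < 1 + 2 * k \<Longrightarrow> \<omega> (z m) (z i) = 0"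
    "\<And>i. i < 1 + 2 * k \<Longrightarrow> \<omega> (z i) (z m) = 0"
  shows "contact_term \<phi> \<omega> k z = 0"
  using m
proof (cases rule: slot_cases)
  case 1
  then show ?thesis using z(1) by (simp add: contact_term_def)
next
  case (2 i)
  then have "\<omega> (z (1 + 2 * i)) (z (2 + 2 * i)) = 0" using z(2)[of "2 + 2 * i"] by simp
  then have "(\<Prod>i<k. \<omega> (z (1 + 2 * i)) (z (2 + 2 * i))) = 0"
    using 2(1) by (intro prod_zero) auto
  then show ?thesis unfolding contact_term_def by simp
next
  case (3 i)
  then have "\<omega> (z (1 + 2 * i)) (z (2 + 2 * i)) = 0" using z(3)[of "1 + 2 * i"] by simp
  then have "(\<Prod>i<k. \<omega> (z (1 + 2 * i)) (z (2 + 2 * i))) = 0"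
    using 3(1) by (intro prod_zero) auto
  then show ?thesis unfolding contact_term_def by simp
qed

context bilinear_lie_algebra
begin

lemma functional_const_mult: "functional f \<Longrightarrow> functional (\<lambda>u. c * f u)" "functional f \<Longrightarrow> functional (\<lambda>u. f u * c)"
  unfolding functional_def by (auto simp: algebra_simps)

lemma functional_sum_fun:
  "(\<And>i. i \<in> I \<Longrightarrow> functional (f i)) \<Longrightarrow> functional (\<lambda>u. \<Sum>i\<in>I. f i u)"
  unfolding functional_def by (simp add: sum.distrib sum_distrib_left)

context
  fixes \<phi> :: "'a \<Rightarrow> complex" and \<omega> :: "'a \<Rightarrow> 'a \<Rightarrow> complex"
  assumes \<phi>: "functional \<phi>" and \<omega>: "\<And>y. functional (\<lambda>x. \<omega> x y)" "\<And>x. functional (\<omega> x)"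
begin

lemma contact_term_functional:
  assumes m: "m < 1 + 2 * k"
  shows "functional (\<lambda>u. contact_term \<phi> \<omega> k (z(m := u)))"
  using m
proof (cases rule: slot_cases)
  case 1
  have "contact_term \<phi> \<omega> k (z(m := u)) = \<phi> u * (\<Prod>i<k. \<omega> (z (1 + 2 * i)) (z (2 + 2 * i)))" for u
    unfolding contact_term_def 1 by simp
  then show ?thesis using functional_const_mult(2)[OF \<phi>] by simp
next
  case (2 j)
  have "contact_term \<phi> \<omega> k (z(m := u)) = (\<phi> (z 0) *
      (\<Prod>i\<in>{..<k} - {j}. \<omega> (z (1 + 2 * i)) (z (2 + 2 * i)))) * \<omega> u (z (2 + 2 * j))" for u
  proof -
    have "(\<Prod>i\<in>{..<k} - {j}. \<omega> ((z(m := u)) (1 + 2 * i)) ((z(m := u)) (2 + 2 * i))) =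
        (\<Prod>i\<in>{..<k} - {j}. \<omega> (z (1 + 2 * i)) (z (2 + 2 * i)))"
    proof (rule prod.cong[OF refl])
      fix i assume "i \<in> {..<k} - {j}"
      then have "i \<noteq> j" by simp
      then have "1 + 2 * i \<noteq> m" "2 + 2 * i \<noteq> m" using 2(2) by presburger+
      then show "\<omega> ((z(m := u)) (1 + 2 * i)) ((z(m := u)) (2 + 2 * i)) = \<omega> (z (1 + 2 * i)) (z (2 + 2 * i))"
        by simp
    qed
    moreover have "2 + 2 * j \<noteq> m" "0 \<noteq> m" using 2(2) by auto
    ultimately show ?thesis
      unfolding contact_term_def prod_split_slot[OF 2(1)] using 2(2) by simp
  qed
  then show ?thesis using functional_const_mult(1)[OF \<omega>(1)] by simp
next
  case (3 j)
  have "contact_term \<phi> \<omega> k (z(m := u)) = (\<phi> (z 0) *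
      (\<Prod>i\<in>{..<k} - {j}. \<omega> (z (1 + 2 * i)) (z (2 + 2 * i)))) * \<omega> (z (1 + 2 * j)) u" for u
  proof -
    have "(\<Prod>i\<in>{..<k} - {j}. \<omega> ((z(m := u)) (1 + 2 * i)) ((z(m := u)) (2 + 2 * i))) =
        (\<Prod>i\<in>{..<k} - {j}. \<omega> (z (1 + 2 * i)) (z (2 + 2 * i)))"
    proof (rule prod.cong[OF refl])
      fix i assume "i \<in> {..<k} - {j}"
      then have "i \<noteq> j" by simp
      then have "1 + 2 * i \<noteq> m" "2 + 2 * i \<noteq> m" using 3(2) by presburger+
      then show "\<omega> ((z(m := u)) (1 + 2 * i)) ((z(m := u)) (2 + 2 * i)) = \<omega> (z (1 + 2 * i)) (z (2 + 2 * i))"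
        by simp
    qed
    moreover have "1 + 2 * j \<noteq> m" "0 \<noteq> m" using 3(2) by auto
    ultimately show ?thesis
      unfolding contact_term_def prod_split_slot[OF 3(1)] using 3(2) by simp
  qed
  then show ?thesis using functional_const_mult(1)[OF \<omega>(2)] by simp
qed

lemma contact_value_functional:
  assumes j: "j < 1 + 2 * k"
  shows "functional (\<lambda>u. contact_value \<phi> \<omega> k (x(j := u)))"
proof -
  have "functional (\<lambda>u. of_int (sign \<sigma>) * contact_term \<phi> \<omega> k (\<lambda>i. (x(j := u)) (\<sigma> i)))"
    if \<sigma>: "\<sigma> permutes {..<1 + 2 * k}" for \<sigma>
  proof -
    obtain m where m: "m < 1 + 2 * k" "\<sigma> m = j" "\<forall>i. \<sigma> i = j \<longleftrightarrow> i = m"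
      by (rule permutes_slot[OF \<sigma> j])
    have "(\<lambda>i. (x(j := u)) (\<sigma> i)) = (\<lambda>i. x (\<sigma> i))(m := u)" for u
      using m(3) by auto
    then show ?thesis
      using functional_const_mult(1)[OF contact_term_functional[OF m(1), of "\<lambda>i. x (\<sigma> i)"]] by simp
  qed
  then show ?thesis
    unfolding contact_value_def by (intro functional_sum_fun) simp
qed

text \<open>The 2 k + 1 vectors \<open>x\<close> and \<open>v\<close> exceed the dimension, so they
  are dependent. If some \<open>x j\<close> enters the relation, the combination of the
  \<open>x\<close> put into slot j gives a nonzero multiple of the value, by multilinearity and
  alternation; yet it is a multiple of \<open>v\<close>, and \<open>v\<close> kills every term. So
  only \<open>v\<close> enters, and it is zero.\<close>

lemma contact_value_nonzero:
  assumes nz: "contact_value \<phi> \<omega> k x \<noteq> 0" and x: "\<And>i. i < 1 + 2 * k \<Longrightarrow> x i \<in> G"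
    and dim: "dim G = 1 + 2 * k"
    and v: "v \<in> G" "\<phi> v = 0" "\<And>u. u \<in> G \<Longrightarrow> \<omega> v u = 0" "\<And>u. u \<in> G \<Longrightarrow> \<omega> u v = 0"
  shows "v = 0"
proof -
  obtain B where B: "B \<subseteq> G" "independent B" "G \<subseteq> span B" "card B = dim G"
    by (rule basis_exists)
  obtain B' where B': "finite B'" "G = span B'" using G(2) by blast
  have finB: "finite B"
    using independent_span_bound[OF B'(1) B(2)] B(1) B'(2) by blast
  define f where "f i = (if i < 1 + 2 * k then x i else v)" for i
  have "f i \<in> span B" for i using x v(1) B(3) unfolding f_def by auto
  then obtain c where c: "\<exists>i\<le>1 + 2 * k. c i \<noteq> 0" "(\<Sum>i\<le>1 + 2 * k. c i *s f i) = 0"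
    using dependent_family[OF finB, of "1 + 2 * k" f] B(4) dim by auto
  define s where "s = (\<Sum>i<1 + 2 * k. c i *s x i)"
  have "(\<Sum>i\<le>1 + 2 * k. c i *s f i) = (\<Sum>i<1 + 2 * k. c i *s f i) + c (1 + 2 * k) *s f (1 + 2 * k)"
    by (simp only: lessThan_Suc_atMost[symmetric] sum.lessThan_Suc)
  also have "(\<Sum>i<1 + 2 * k. c i *s f i) = s"
    unfolding s_def by (rule sum.cong) (auto simp: f_def)
  finally have sv: "s + c (1 + 2 * k) *s v = 0" using c(2) by (simp add: f_def)
  show ?thesis
  proof (cases "\<exists>j<1 + 2 * k. c j \<noteq> 0")
    case False
    then have "c (1 + 2 * k) \<noteq> 0" using c(1) le_neq_implies_less by blast
    moreover have "s = 0" unfolding s_def using False by (intro sum.neutral) auto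
    ultimately show ?thesis using sv by simp
  next
    case True
    then obtain j where j: "j < 1 + 2 * k" "c j \<noteq> 0" by blast
    define F where "F u = contact_value \<phi> \<omega> k (x(j := u))" for u
    have F: "functional F" unfolding F_def by (rule contact_value_functional[OF j(1)])
    have "F (x i) = 0" if "i < 1 + 2 * k" "i \<noteq> j" for i
      unfolding F_def by (rule contact_value_alternating[OF that(1) j(1) that(2)]) (use that in simp)
    then have "F s = (\<Sum>i<1 + 2 * k. if i = j then c j * F (x j) else 0)"
      unfolding s_def functional_sum[OF F] functional_scale[OF F] by (intro sum.cong) auto
    also have "\<dots> = c j * contact_value \<phi> \<omega> k x" using j(1) by (simp add: F_def)
    finally have "F s \<noteq> 0" using j(2) nz by simp
    moreover have "F v = 0"
      unfolding F_def contact_value_def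
    proof (rule sum.neutral, rule ballI)
      fix \<sigma> assume "\<sigma> \<in> {\<sigma>. \<sigma> permutes {..<1 + 2 * k}}"
      then have \<sigma>: "\<sigma> permutes {..<1 + 2 * k}" by simp
      obtain m where m: "m < 1 + 2 * k" "\<sigma> m = j" "\<forall>i. \<sigma> i = j \<longleftrightarrow> i = m"
        by (rule permutes_slot[OF \<sigma> j(1)])
      have "(x(j := v)) (\<sigma> i) \<in> G" if "i < 1 + 2 * k" for i
        using x[of "\<sigma> i"] permutes_in_image[OF \<sigma>, of i] that v(1) by auto
      then have "contact_term \<phi> \<omega> k (\<lambda>i. (x(j := v)) (\<sigma> i)) = 0"
        by (intro contact_term_zero[OF m(1)]) (use m(2) v in auto)
      then show "of_int (sign \<sigma>) * contact_term \<phi> \<omega> k (\<lambda>i. (x(j := v)) (\<sigma> i)) = 0" by simp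
    qed
    moreover have s: "s = (- c (1 + 2 * k)) *s v" using sv by (simp add: eq_neg_iff_add_eq_0)
    have "F s = - c (1 + 2 * k) * F v" unfolding s by (rule functional_scale[OF F])
    ultimately show ?thesis by simp
  qed
qed

end

text \<open>In a nonzero term \<sigma> fixes 0 and maps symplectic pairs to symplectic pairs. By
  \<open>sign_pair_permutation\<close> the product of the \<omega>-values is then the sign of
  \<sigma>, so all nonzero terms equal \<open>\<phi> v\<close> and nothing cancels. Their exact
  number is irrelevant: the identity is among them once \<open>\<phi> v\<close> is nonzero.\<close>

lemma contact_value_symplectic:
  assumes z: "symplectic \<omega> {w. \<phi> w = 0} k z"
  shows "contact_value \<phi> \<omega> k (\<lambda>i. if i = 0 then v else z (i - 1)) =
    of_nat (card {\<sigma>. \<sigma> permutes {..<1 + 2 * k} \<and>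
      contact_term \<phi> \<omega> k (\<lambda>i. if \<sigma> i = 0 then v else z (\<sigma> i - 1)) \<noteq> 0}) * \<phi> v"
proof -
  let ?P = "{\<sigma>. \<sigma> permutes {..<1 + 2 * k}}"
  let ?t = "\<lambda>\<sigma>. contact_term \<phi> \<omega> k (\<lambda>i. if \<sigma> i = 0 then v else z (\<sigma> i - 1))"
  have "of_int (sign \<sigma>) * ?t \<sigma> = (if ?t \<sigma> \<noteq> 0 then \<phi> v else 0)" if \<sigma>: "\<sigma> permutes {..<1 + 2 * k}" for \<sigma>
  proof (cases "?t \<sigma> = 0")
    case nz: False
    have less: "\<sigma> i < 1 + 2 * k" if "i < 1 + 2 * k" for i
      using permutes_in_image[OF \<sigma>, of i] that by simp
    have \<sigma>0: "\<sigma> 0 = 0"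
    proof (rule ccontr)
      assume "\<sigma> 0 \<noteq> 0"
      then have "\<phi> (z (\<sigma> 0 - 1)) = 0" using z less[of 0] unfolding symplectic_def by auto
      then show False using nz \<open>\<sigma> 0 \<noteq> 0\<close> unfolding contact_term_def by simp
    qed
    have pos: "\<sigma> i \<noteq> 0" if "i \<noteq> 0" for i
      using injD[OF permutes_inj[OF \<sigma>], of i 0] \<sigma>0 that by auto
    have val: "\<omega> (z (\<sigma> (1 + 2 * i) - 1)) (z (\<sigma> (2 + 2 * i) - 1)) =
        symp_sign (\<sigma> (1 + 2 * i) - 1) (\<sigma> (2 + 2 * i) - 1)" if "i < k" for i
    proof -
      have "\<sigma> (1 + 2 * i) - 1 < 2 * k" "\<sigma> (2 + 2 * i) - 1 < 2 * k"
        using less[of "1 + 2 * i"] less[of "2 + 2 * i"] that pos[of "1 + 2 * i"] pos[of "2 + 2 * i"] by auto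
      then show ?thesis using z unfolding symplectic_def by blast
    qed
    have t: "?t \<sigma> = \<phi> v * (\<Prod>i<k. symp_sign (\<sigma> (1 + 2 * i) - 1) (\<sigma> (2 + 2 * i) - 1))"
    proof -
      have "\<omega> (if \<sigma> (1 + 2 * i) = 0 then v else z (\<sigma> (1 + 2 * i) - 1))
          (if \<sigma> (2 + 2 * i) = 0 then v else z (\<sigma> (2 + 2 * i) - 1)) =
          symp_sign (\<sigma> (1 + 2 * i) - 1) (\<sigma> (2 + 2 * i) - 1)" if "i < k" for i
        using val[OF that] pos[of "1 + 2 * i"] pos[of "2 + 2 * i"] by simp
      then have "(\<Prod>i<k. \<omega> (if \<sigma> (1 + 2 * i) = 0 then v else z (\<sigma> (1 + 2 * i) - 1))
          (if \<sigma> (2 + 2 * i) = 0 then v else z (\<sigma> (2 + 2 * i) - 1))) =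
          (\<Prod>i<k. symp_sign (\<sigma> (1 + 2 * i) - 1) (\<sigma> (2 + 2 * i) - 1))"
        by (intro prod.cong) auto
      then show ?thesis unfolding contact_term_def \<sigma>0 by simp
    qed
    then have nz': "symp_sign (\<sigma> (1 + 2 * i) - 1) (\<sigma> (2 + 2 * i) - 1) \<noteq> 0" if "i < k" for i
      using nz that by (auto simp: prod_zero_iff)
    have pair: "odd (\<sigma> (1 + 2 * i)) \<and> \<sigma> (2 + 2 * i) = \<sigma> (1 + 2 * i) + 1 \<or>
        odd (\<sigma> (2 + 2 * i)) \<and> \<sigma> (1 + 2 * i) = \<sigma> (2 + 2 * i) + 1" if "i < k" for i
      using nz'[OF that] pos[of "1 + 2 * i"] pos[of "2 + 2 * i"]
      unfolding symp_sign_def by (auto split: if_splits)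
    have "symp_sign (\<sigma> (1 + 2 * i) - 1) (\<sigma> (2 + 2 * i) - 1) = of_int (if odd (\<sigma> (1 + 2 * i)) then 1 else - 1)"
      if "i < k" for i
      using pair[OF that] unfolding symp_sign_def by (auto elim!: oddE, presburger)
    then have "?t \<sigma> = \<phi> v * of_int (\<Prod>i<k. if odd (\<sigma> (1 + 2 * i)) then 1 else - 1)"
      unfolding t by (simp only: of_int_prod) simp
    also have "(\<Prod>i<k. if odd (\<sigma> (1 + 2 * i)) then 1 else - 1 :: int) = sign \<sigma>"
      by (rule sign_pair_permutation[OF \<sigma> \<sigma>0 pair, symmetric])
    finally have ts: "?t \<sigma> = \<phi> v * of_int (sign \<sigma>)" .
    have "of_int (sign \<sigma>) * ?t \<sigma> = \<phi> v * of_int (sign \<sigma> * sign \<sigma>)"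
      unfolding ts by (simp only: of_int_mult mult_ac)
    then show ?thesis using nz by simp
  qed simp
  then have "contact_value \<phi> \<omega> k (\<lambda>i. if i = 0 then v else z (i - 1)) =
      (\<Sum>\<sigma>\<in>?P. if ?t \<sigma> \<noteq> 0 then \<phi> v else 0)"
    unfolding contact_value_def by (intro sum.cong) auto
  also have "\<dots> = (\<Sum>\<sigma>\<in>{\<sigma> \<in> ?P. ?t \<sigma> \<noteq> 0}. \<phi> v)"
    by (rule sum.inter_filter[symmetric]) (simp add: finite_permutations)
  finally show ?thesis by simp
qed

lemma contact_value_symplectic_nonzero:
  assumes z: "symplectic \<omega> {w. \<phi> w = 0} k z" and v: "\<phi> v \<noteq> 0"
  shows "contact_value \<phi> \<omega> k (\<lambda>i. if i = 0 then v else z (i - 1)) \<noteq> 0"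
proof -
  let ?S = "{\<sigma>. \<sigma> permutes {..<1 + 2 * k} \<and>
      contact_term \<phi> \<omega> k (\<lambda>i. if \<sigma> i = 0 then v else z (\<sigma> i - 1)) \<noteq> 0}"
  have "contact_term \<phi> \<omega> k (\<lambda>i. if id i = 0 then v else z (id i - 1)) = \<phi> v * (\<Prod>i<k. 1)"
    unfolding contact_term_def
    by (rule arg_cong2[where f = "(*)"], simp, rule prod.cong)
      (use z in \<open>auto simp: symplectic_def symp_sign_def\<close>)
  then have id: "id \<in> ?S" using v permutes_id by simp
  have "finite ?S" by (rule finite_subset[OF _ finite_permutations[of "{..<1 + 2 * k}"]]) auto
  then have "card ?S > 0" by (subst card_gt_0_iff) (use id in blast)
  then show ?thesis unfolding contact_value_symplectic[OF z] using v by (simp only: of_nat_eq_0_iff mult_eq_0_iff) simp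
qed

end

section \<open>Contact forms and index in terms of Kirillov kernels\<close>

context bilinear_lie_algebra
begin

definition L :: "'a lie_structure" where
  "L = \<lparr>lie_carrier = G, lie_scale = scale, lie_bracket = br\<rparr>"

lemma L_simps [simp]: "lie_carrier L = G" "lie_scale L = scale" "lie_bracket L = br"
  unfolding L_def by simp_all

lemma G_basis:
  obtains B where "B \<subseteq> G" "independent B" "G = span B" "finite B" "card B = dim G"
proof -
  obtain B where B: "B \<subseteq> G" "independent B" "G \<subseteq> span B" "card B = dim G"
    by (rule basis_exists)
  obtain B' where B': "finite B'" "G = span B'" using G(2) by blast
  have "finite B" using independent_span_bound[OF B'(1) B(2)] B(1) B'(2) by blast
  moreover have "G = span B" using B(3) span_minimal[OF B(1) G(1)] by blast
  ultimately show thesis using that B by blast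
qed

lemma functional_in_dual: "functional \<phi> \<Longrightarrow> \<phi> \<in> lie_dual L"
  unfolding lie_dual_def functional_def by simp

text \<open>Members of \<open>lie_dual\<close> are arbitrary off the carrier; this replaces them by
  functionals linear on the ambient space.\<close>

lemma dual_extends:
  assumes "\<phi> \<in> lie_dual L"
  obtains \<phi>' where "functional \<phi>'" "\<And>x. x \<in> G \<Longrightarrow> \<phi>' x = \<phi> x"
proof -
  interpret p: vector_space_pair scale "(*) :: complex \<Rightarrow> complex \<Rightarrow> complex"
    by unfold_locales (auto simp: algebra_simps)
  obtain B where B: "B \<subseteq> G" "independent B" "G = span B" by (rule G_basis)
  obtain g where g: "Vector_Spaces.linear scale (*) g" "\<And>x. x \<in> B \<Longrightarrow> g x = \<phi> x"
    using p.linear_independent_extend[OF B(2), of \<phi>] by blast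
  have fg: "functional g"
    using p.linear_add[OF g(1)] p.linear_scale[OF g(1)] unfolding functional_def by blast
  have \<phi>: "\<phi> (x + y) = \<phi> x + \<phi> y" "\<phi> (c *s x) = c * \<phi> x" if "x \<in> G" "y \<in> G" for x y c
    using assms that unfolding lie_dual_def by auto
  have "x \<in> G \<and> g x = \<phi> x" if "x \<in> span B" for x
    using that
  proof (induction rule: span_induct_alt)
    case base
    have "\<phi> 0 = 0" using \<phi>(2)[of 0 0 0] subspace_0[OF G(1)] by simp
    then show ?case using functional_0[OF fg] subspace_0[OF G(1)] by simp
  next
    case (step c x y)
    then have "x \<in> G" "c *s x \<in> G" using B(1) subspace_scale[OF G(1)] by auto
    then show ?case
      using step g(2) \<phi> functional_add[OF fg] functional_scale[OF fg] subspace_add[OF G(1)] by simp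
  qed
  then show thesis using that[OF fg] B(3) by blast
qed

definition K :: "('a \<Rightarrow> complex) \<Rightarrow> 'a set" where
  "K \<phi> = {v \<in> G. \<forall>u\<in>G. \<phi> (br v u) = 0}"

lemma kirillov_kernel_eq: "(\<And>x. x \<in> G \<Longrightarrow> \<phi>' x = \<phi> x) \<Longrightarrow> kirillov_kernel L \<phi> = K \<phi>'"
  unfolding kirillov_kernel_def kirillov_form_def K_def using G_br by auto

lemma K_subspace: "functional \<phi> \<Longrightarrow> subspace (K \<phi>)"
  by (rule subspaceI)
    (auto simp: K_def br_0 br_add br_scale functional_0 functional_add functional_scale
      subspace_0[OF G(1)] subspace_add[OF G(1)] subspace_scale[OF G(1)])

lemma dim_0_iff:
  assumes "subspace W" "W \<subseteq> G"
  shows "dim W = 0 \<longleftrightarrow> W = {0}"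
proof
  assume d: "dim W = 0"
  obtain B where B: "B \<subseteq> W" "independent B" "W \<subseteq> span B" "card B = dim W"
    by (rule basis_exists)
  obtain B' where B': "finite B'" "G = span B'" using G(2) by blast
  have "finite B" using independent_span_bound[OF B'(1) B(2)] B(1) assms(2) B'(2) by blast
  then have "B = {}" using d B(4) by simp
  then show "W = {0}" using B(3) subspace_0[OF assms(1)] by auto
next
  assume "W = {0}"
  then have "W = span {}" by simp
  then show "dim W = 0" using dim_span_eq_card_independent[OF independent_empty] by simp
qed

lemma dim_line: "v \<noteq> 0 \<Longrightarrow> dim (span {v}) = 1"
  using dim_span_eq_card_independent[of "{v}"] by simp

lemma lie_index_eq: "lie_index L = (LEAST d. \<exists>\<phi>. functional \<phi> \<and> d = dim (K \<phi>))"
proof -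
  have "(\<exists>\<phi>\<in>lie_dual L. d = dim (kirillov_kernel L \<phi>)) \<longleftrightarrow> (\<exists>\<phi>. functional \<phi> \<and> d = dim (K \<phi>))" for d
  proof
    assume "\<exists>\<phi>\<in>lie_dual L. d = dim (kirillov_kernel L \<phi>)"
    then obtain \<phi> where \<phi>: "\<phi> \<in> lie_dual L" "d = dim (kirillov_kernel L \<phi>)" by blast
    obtain \<phi>' where "functional \<phi>'" "\<And>x. x \<in> G \<Longrightarrow> \<phi>' x = \<phi> x" by (rule dual_extends[OF \<phi>(1)]) blast
    then show "\<exists>\<phi>. functional \<phi> \<and> d = dim (K \<phi>)" using kirillov_kernel_eq[of \<phi>' \<phi>] \<phi>(2) by auto
  next
    assume "\<exists>\<phi>. functional \<phi> \<and> d = dim (K \<phi>)"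
    then show "\<exists>\<phi>\<in>lie_dual L. d = dim (kirillov_kernel L \<phi>)"
      using functional_in_dual kirillov_kernel_eq by metis
  qed
  then show ?thesis unfolding lie_index_def by simp
qed

lemma form_left: "functional \<phi> \<Longrightarrow> functional (\<lambda>x. - \<phi> (br x y))"
  and form_right: "functional \<phi> \<Longrightarrow> functional (\<lambda>y. - \<phi> (br x y))"
  unfolding functional_def by (simp_all add: br_add br_scale)

lemma form_anti: "functional \<phi> \<Longrightarrow> - \<phi> (br y x) = - (- \<phi> (br x y))"
  using br_anti[of y x] functional_minus[of \<phi> "br x y"] by simp

text \<open>A trivial kernel makes the Kirillov form nondegenerate on \<open>G\<close>, and a
  symplectic basis has an even number of elements.\<close>

lemma even_dim_of_trivial_kernel:
  assumes \<phi>: "functional \<phi>" and K: "K \<phi> = {0}"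
  shows "even (dim G)"
proof -
  have nondeg: "\<exists>u\<in>G. - \<phi> (br w u) \<noteq> 0" if "w \<in> G" "w \<noteq> 0" for w
    using K that unfolding K_def by auto
  obtain k z where "dim G = 2 * k"
    by (rule symplectic_basis[of "\<lambda>x y. - \<phi> (br x y)" G, OF form_left[OF \<phi>] form_anti[OF \<phi>] G(1) order_refl nondeg])
  then show ?thesis by simp
qed

lemma contact_form_value:
  assumes "\<And>i. i < 1 + 2 * k \<Longrightarrow> x i \<in> G" and ext: "\<And>x. x \<in> G \<Longrightarrow> \<phi>' x = \<phi> x"
  shows "wedge 1 (2 * k) (one_form \<phi>) (wedge_power 2 (lie_differential L \<phi>) k) x =
    1 / 2 ^ k * contact_value \<phi>' (\<lambda>x y. - \<phi>' (br x y)) k x"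
proof -
  have d: "lie_differential L \<phi> = (\<lambda>z. - \<phi> (br (z 0) (z 1)))"
    unfolding lie_differential_def[abs_def] by simp
  have "contact_term \<phi> (\<lambda>x y. - \<phi> (br x y)) k (\<lambda>i. x (\<sigma> i)) =
      contact_term \<phi>' (\<lambda>x y. - \<phi>' (br x y)) k (\<lambda>i. x (\<sigma> i))"
    if "\<sigma> permutes {..<1 + 2 * k}" for \<sigma>
  proof -
    have "x (\<sigma> i) \<in> G" if "i < 1 + 2 * k" for i
      using assms(1) permutes_in_image[OF \<open>\<sigma> permutes _\<close>, of i] that by simp
    then show ?thesis
      unfolding contact_term_def using ext G_br by (auto intro!: arg_cong2[where f = "(*)"] prod.cong)
  qed
  then show ?thesis
    unfolding d wedge_contact[where \<omega> = "\<lambda>x y. - \<phi> (br x y)"] contact_value_def by (auto intro!: sum.cong)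
qed

text \<open>Forwards, \<open>contact_value_nonzero\<close> makes \<phi> injective on its kernel, and
  odd dimension excludes a trivial kernel. Backwards, a kernel vector v with \<open>\<phi> v\<close>
  nonzero complements the hyperplane \<phi> = 0, on which the Kirillov form is nondegenerate; a
  symplectic basis there together with v detects the form and gives the odd dimension.\<close>

lemma contact_iff:
  "contact L \<longleftrightarrow> (\<exists>\<phi>. functional \<phi> \<and> K \<phi> \<noteq> {0} \<and> (\<forall>w\<in>K \<phi>. \<phi> w = 0 \<longrightarrow> w = 0))"
proof
  assume "contact L"
  then obtain k \<phi> x where dim: "dim G = 2 * k + 1" and \<phi>: "\<phi> \<in> lie_dual L"
    and x: "\<And>i. i < 2 * k + 1 \<Longrightarrow> x i \<in> G"
    and nz: "wedge 1 (2 * k) (one_form \<phi>) (wedge_power 2 (lie_differential L \<phi>) k) x \<noteq> 0"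
    unfolding contact_def lie_dim_def nonzero_form_def by auto
  obtain \<phi>' where \<phi>': "functional \<phi>'" "\<And>x. x \<in> G \<Longrightarrow> \<phi>' x = \<phi> x" using dual_extends[OF \<phi>] by blast
  have "contact_value \<phi>' (\<lambda>x y. - \<phi>' (br x y)) k x \<noteq> 0"
    using nz contact_form_value[of k x \<phi>' \<phi>] x \<phi>'(2) by auto
  note zero = contact_value_nonzero[OF \<phi>'(1) form_left[OF \<phi>'(1)] form_right[OF \<phi>'(1)] this]
  have "w = 0" if "w \<in> K \<phi>'" "\<phi>' w = 0" for w
  proof (rule zero)
    show "- \<phi>' (br w u) = 0" "- \<phi>' (br u w) = 0" if "u \<in> G" for u
      using \<open>w \<in> K \<phi>'\<close> that form_anti[OF \<phi>'(1), of u w] unfolding K_def by auto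
  qed (use that x dim in \<open>auto simp: K_def\<close>)
  moreover have "K \<phi>' \<noteq> {0}" using even_dim_of_trivial_kernel[OF \<phi>'(1)] dim by auto
  ultimately show "\<exists>\<phi>. functional \<phi> \<and> K \<phi> \<noteq> {0} \<and> (\<forall>w\<in>K \<phi>. \<phi> w = 0 \<longrightarrow> w = 0)"
    using \<phi>'(1) by blast
next
  assume "\<exists>\<phi>. functional \<phi> \<and> K \<phi> \<noteq> {0} \<and> (\<forall>w\<in>K \<phi>. \<phi> w = 0 \<longrightarrow> w = 0)"
  then obtain \<phi> where \<phi>: "functional \<phi>" and K: "K \<phi> \<noteq> {0}" "\<And>w. w \<in> K \<phi> \<Longrightarrow> \<phi> w = 0 \<Longrightarrow> w = 0"
    by blast
  obtain v where v: "v \<in> K \<phi>" "v \<noteq> 0" using K(1) subspace_0[OF K_subspace[OF \<phi>]] by blast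
  then have \<phi>v: "\<phi> v \<noteq> 0" and vG: "v \<in> G" using K(2) unfolding K_def by auto
  define W where "W = {w \<in> G. \<phi> w = 0}"
  have W: "subspace W"
    by (rule subspaceI) (auto simp: W_def functional_0[OF \<phi>] functional_add[OF \<phi>] functional_scale[OF \<phi>]
      subspace_0[OF G(1)] subspace_add[OF G(1)] subspace_scale[OF G(1)])
  have nondeg: "\<exists>u\<in>W. - \<phi> (br w u) \<noteq> 0" if w: "w \<in> W" "w \<noteq> 0" for w
  proof -
    obtain u where u: "u \<in> G" "\<phi> (br w u) \<noteq> 0" using K(2)[of w] w unfolding W_def K_def by auto
    \<comment> \<open>Subtracting a multiple of the kernel vector \<open>v\<close> moves
      \<open>u\<close> into the hyperplane without changing its bracket with \<open>w\<close> under
      \<phi>.\<close>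
    let ?u = "u - (\<phi> u / \<phi> v) *s v"
    have "\<phi> (br v w) = 0" using v w unfolding K_def W_def by blast
    then have "\<phi> (br w v) = 0" using form_anti[OF \<phi>, of w v] by simp
    moreover have "functional (\<lambda>y. \<phi> (br w y))"
      unfolding functional_def by (simp add: br_add br_scale functional_add[OF \<phi>] functional_scale[OF \<phi>])
    ultimately have "\<phi> (br w ?u) = \<phi> (br w u)"
      using functional_diff[of "\<lambda>y. \<phi> (br w y)" u] functional_scale[of "\<lambda>y. \<phi> (br w y)" _ v] by simp
    moreover have "?u \<in> W"
      unfolding W_def using u \<phi>v vG subspace_diff[OF G(1)] subspace_scale[OF G(1)]
      by (simp add: functional_diff[OF \<phi>] functional_scale[OF \<phi>])
    ultimately show ?thesis using u(2) by (intro bexI[of _ ?u]) auto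
  qed
  have WG: "W \<subseteq> G" unfolding W_def by blast
  obtain k z where z: "symplectic (\<lambda>x y. - \<phi> (br x y)) W k z" "W = span (z ` {..<2 * k})" "dim W = 2 * k"
    by (rule symplectic_basis[of "\<lambda>x y. - \<phi> (br x y)" W, OF form_left[OF \<phi>] form_anti[OF \<phi>] W WG nondeg])
  have dim: "dim G = 2 * k + 1"
  proof -
    obtain B where B: "B \<subseteq> W" "independent B" "W \<subseteq> span B" "card B = dim W" by (rule basis_exists)
    have spanB: "span B = W" using B(3) span_minimal[OF B(1) W] by blast
    have v_span: "v \<notin> span B" unfolding spanB W_def using \<phi>v by simp
    obtain B' where B': "finite B'" "G = span B'" using G(2) by blast
    have "B \<subseteq> span B'" using B(1) WG B'(2) by blast
    then have "finite B" using independent_span_bound[OF B'(1) B(2)] by blast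
    moreover have "v \<notin> B" using v_span span_base by blast
    moreover have "independent (insert v B)" using B(2) v_span by (rule independent_insertI[rotated])
    moreover have "G = span (insert v B)"
    proof
      show "span (insert v B) \<subseteq> G"
        by (rule span_minimal[OF _ G(1)]) (use B(1) WG vG in blast)
      show "G \<subseteq> span (insert v B)"
      proof
        fix u assume u: "u \<in> G"
        have "u - (\<phi> u / \<phi> v) *s v \<in> W"
          unfolding W_def using u \<phi>v vG subspace_diff[OF G(1)] subspace_scale[OF G(1)]
          by (simp add: functional_diff[OF \<phi>] functional_scale[OF \<phi>])
        then show "u \<in> span (insert v B)"
          unfolding span_breakdown_eq using spanB by blast
      qed
    qed
    ultimately show ?thesis
      using dim_span_eq_card_independent[of "insert v B"] B(4) z(3) by simp
  qed
  have "symplectic (\<lambda>x y. - \<phi> (br x y)) {w. \<phi> w = 0} k z"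
    using z(1) unfolding symplectic_def W_def by blast
  note nz = contact_value_symplectic_nonzero[OF this \<phi>v]
  have xG: "(if i = 0 then v else z (i - 1)) \<in> G" if "i < 1 + 2 * k" for i
    using z(1) that vG WG unfolding symplectic_def by auto
  have "nonzero_form L (2 * k + 1) (wedge 1 (2 * k) (one_form \<phi>) (wedge_power 2 (lie_differential L \<phi>) k))"
    unfolding nonzero_form_def
  proof (intro exI conjI allI impI)
    show "wedge 1 (2 * k) (one_form \<phi>) (wedge_power 2 (lie_differential L \<phi>) k)
        (\<lambda>i. if i = 0 then v else z (i - 1)) \<noteq> 0"
      using contact_form_value[where k = k and \<phi> = \<phi> and \<phi>' = \<phi>, OF xG refl] nz by simp
    show "(if i = 0 then v else z (i - 1)) \<in> lie_carrier L" if "i < 2 * k + 1" for i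
      using xG that by simp
  qed
  then show "contact L"
    unfolding contact_def lie_dim_def using dim functional_in_dual[OF \<phi>] by auto
qed

text \<open>A functional injective on its nonzero kernel has a kernel of dimension 1, and odd
  dimension forbids a trivial kernel for any other functional.\<close>

lemma contact_imp_index:
  assumes "contact L"
  shows "lie_index L = 1"
proof -
  obtain \<phi> where \<phi>: "functional \<phi>" and K: "K \<phi> \<noteq> {0}" "\<And>w. w \<in> K \<phi> \<Longrightarrow> \<phi> w = 0 \<Longrightarrow> w = 0"
    using assms unfolding contact_iff by blast
  obtain v where v: "v \<in> K \<phi>" "v \<noteq> 0" using K(1) subspace_0[OF K_subspace[OF \<phi>]] by blast
  then have \<phi>v: "\<phi> v \<noteq> 0" using K(2) by blast
  have "w \<in> span {v}" if w: "w \<in> K \<phi>" for w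
  proof -
    have "w - (\<phi> w / \<phi> v) *s v \<in> K \<phi>"
      using subspace_diff[OF K_subspace[OF \<phi>] w] subspace_scale[OF K_subspace[OF \<phi>] v(1)] by blast
    then have "w - (\<phi> w / \<phi> v) *s v = 0"
      by (rule K(2)) (use \<phi>v in \<open>simp add: functional_diff[OF \<phi>] functional_scale[OF \<phi>]\<close>)
    then show ?thesis by (auto simp: span_singleton)
  qed
  then have "K \<phi> = span {v}" using span_minimal[OF _ K_subspace[OF \<phi>], of "{v}"] v(1) by blast
  then have dimK: "dim (K \<phi>) = 1" using dim_line[OF v(2)] by simp
  have "odd (dim G)" using assms unfolding contact_def lie_dim_def by auto
  then have "dim (K \<phi>') \<noteq> 0" if "functional \<phi>'" for \<phi>'
    using even_dim_of_trivial_kernel[OF that] dim_0_iff[OF K_subspace[OF that]] unfolding K_def by auto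
  then show ?thesis
    unfolding lie_index_eq using \<phi> dimK by (intro Least_equality) (auto simp: Suc_le_eq)
qed

lemma index_one_kernels:
  assumes "lie_index L = 1"
  obtains \<phi> v where "functional \<phi>" "K \<phi> = span {v}" "v \<noteq> 0" "v \<in> G"
    and "\<And>\<phi>'. functional \<phi>' \<Longrightarrow> K \<phi>' \<noteq> {0}"
proof -
  let ?P = "\<lambda>d. \<exists>\<phi>. functional \<phi> \<and> d = dim (K \<phi>)"
  have "functional (\<lambda>_. 0)" unfolding functional_def by simp
  then have "\<exists>d. ?P d" by blast
  from LeastI_ex[OF this] have "?P 1" unfolding lie_index_eq[symmetric] assms .
  then obtain \<phi> where \<phi>: "functional \<phi>" "dim (K \<phi>) = 1" by metis
  have KG: "K \<phi>' \<subseteq> G" for \<phi>' unfolding K_def by blast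
  have nontriv: "K \<phi>' \<noteq> {0}" if "functional \<phi>'" for \<phi>'
  proof
    assume "K \<phi>' = {0}"
    then have "?P 0" using dim_0_iff[OF K_subspace[OF that] KG] that by metis
    then have "(LEAST d. ?P d) = 0" by (intro Least_equality) auto
    then show False using assms unfolding lie_index_eq by simp
  qed
  obtain B where B: "B \<subseteq> K \<phi>" "independent B" "K \<phi> \<subseteq> span B" "card B = dim (K \<phi>)"
    by (rule basis_exists)
  then obtain v where "B = {v}" using \<phi>(2) card_1_singletonE by metis
  then have "K \<phi> = span {v}" "v \<noteq> 0" "v \<in> G"
    using B span_minimal[OF B(1) K_subspace[OF \<phi>(1)]] KG by auto
  then show thesis using that \<phi>(1) nontriv by blast
qed

end

section \<open>From index one to a contact form\<close>

text \<open>Over an integral domain, because it is applied both to complex matrices and to matrices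
  of power series.\<close>

lemma det_zero_iff_kernel:
  fixes f :: "nat \<Rightarrow> nat \<Rightarrow> 'r::idom"
  shows "det (mat m m (\<lambda>(i, j). f i j)) = 0 \<longleftrightarrow>
    (\<exists>w. (\<exists>j<m. w j \<noteq> 0) \<and> (\<forall>i<m. (\<Sum>j<m. f i j * w j) = 0))"
proof -
  let ?A = "mat m m (\<lambda>(i, j). f i j)"
  have mv: "(?A *\<^sub>v vec m w) $ i = (\<Sum>j<m. f i j * w j)" if "i < m" for w i
    using that by (simp add: scalar_prod_def atLeast0LessThan row_def)
  have zero: "?A *\<^sub>v vec m w = 0\<^sub>v m \<longleftrightarrow> (\<forall>i<m. (\<Sum>j<m. f i j * w j) = 0)" for w
  proof
    assume *: "?A *\<^sub>v vec m w = 0\<^sub>v m"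
    show "\<forall>i<m. (\<Sum>j<m. f i j * w j) = 0"
    proof (intro allI impI)
      fix i assume "i < m"
      then show "(\<Sum>j<m. f i j * w j) = 0" using mv[of i w] unfolding * by simp
    qed
  next
    assume *: "\<forall>i<m. (\<Sum>j<m. f i j * w j) = 0"
    show "?A *\<^sub>v vec m w = 0\<^sub>v m"
    proof (rule eq_vecI)
      fix i assume "i < dim_vec (0\<^sub>v m :: 'r vec)"
      then have "i < m" by simp
      then show "(?A *\<^sub>v vec m w) $ i = 0\<^sub>v m $ i" using * mv[of i w] by (simp only: index_zero_vec)
    qed simp
  qed
  have "det ?A = 0 \<longleftrightarrow> (\<exists>v. v \<in> carrier_vec m \<and> v \<noteq> 0\<^sub>v m \<and> ?A *\<^sub>v v = 0\<^sub>v m)"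
    by (rule det_0_iff_vec_prod_zero) simp
  also have "\<dots> \<longleftrightarrow> (\<exists>w. vec m w \<noteq> 0\<^sub>v m \<and> ?A *\<^sub>v vec m w = 0\<^sub>v m)"
  proof
    assume "\<exists>v. v \<in> carrier_vec m \<and> v \<noteq> 0\<^sub>v m \<and> ?A *\<^sub>v v = 0\<^sub>v m"
    then obtain v where v: "v \<in> carrier_vec m" "v \<noteq> 0\<^sub>v m" "?A *\<^sub>v v = 0\<^sub>v m" by blast
    have "v = vec m (\<lambda>i. v $ i)" using v(1) by auto
    then show "\<exists>w. vec m w \<noteq> 0\<^sub>v m \<and> ?A *\<^sub>v vec m w = 0\<^sub>v m" using v(2,3) by metis
  qed (use vec_carrier in blast)
  also have "\<dots> \<longleftrightarrow> (\<exists>w. (\<exists>j<m. w j \<noteq> 0) \<and> (\<forall>i<m. (\<Sum>j<m. f i j * w j) = 0))"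
  proof -
    have "vec m w \<noteq> 0\<^sub>v m \<longleftrightarrow> (\<exists>j<m. w j \<noteq> 0)" for w :: "nat \<Rightarrow> 'r"
      by (auto simp: vec_eq_iff)
    then show ?thesis unfolding zero by simp
  qed
  finally show ?thesis .
qed

text \<open>With \<open>det_fps_of_poly\<close>, this allows one polynomial determinant to be
  examined at complex parameters and over power series.\<close>

lemma det_poly_eval:
  fixes f :: "nat \<Rightarrow> nat \<Rightarrow> complex poly"
  shows "poly (det (mat m m (\<lambda>(i, j). f i j))) s = det (mat m m (\<lambda>(i, j). poly (f i j) s))"
proof -
  interpret comm_ring_hom "\<lambda>p. poly p s" by unfold_locales auto
  have "map_mat (\<lambda>p. poly p s) (mat m m (\<lambda>(i, j). f i j)) = mat m m (\<lambda>(i, j). poly (f i j) s)"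
    by (rule eq_matI) auto
  then show ?thesis using hom_det[of "mat m m (\<lambda>(i, j). f i j)"] by simp
qed

lemma det_fps_of_poly:
  fixes f :: "nat \<Rightarrow> nat \<Rightarrow> complex poly"
  shows "fps_of_poly (det (mat m m (\<lambda>(i, j). f i j))) = det (mat m m (\<lambda>(i, j). fps_of_poly (f i j)))"
proof -
  interpret comm_ring_hom "fps_of_poly :: complex poly \<Rightarrow> complex fps"
    by unfold_locales (simp_all add: fps_of_poly_add fps_of_poly_mult)
  have "map_mat fps_of_poly (mat m m (\<lambda>(i, j). f i j)) = mat m m (\<lambda>(i, j). fps_of_poly (f i j))"
    by (rule eq_matI) auto
  then show ?thesis using hom_det[of "mat m m (\<lambda>(i, j). f i j)"] by simp
qed

text \<open>Over an integral domain, a skew form \<open>\<beta>\<close> with \<open>\<beta> + \<mu> \<mu>\<^sup>T\<close> nondegenerate has a kernel of rank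
  at most one, so a kernel vector on which \<open>\<Phi>\<close> does not vanish makes \<open>\<beta> + \<Phi> \<Phi>\<^sup>T\<close>
  nondegenerate.\<close>

lemma skew_plus_square_nondegenerate:
  fixes \<beta> :: "nat \<Rightarrow> nat \<Rightarrow> 'r::idom" and \<Phi> \<Lambda> X w :: "nat \<Rightarrow> 'r"
  assumes two: "(2 :: 'r) \<noteq> 0"
    and skew: "\<And>i j. i < m \<Longrightarrow> j < m \<Longrightarrow> \<beta> i j = - \<beta> j i"
    and R: "\<And>u. (\<And>i. i < m \<Longrightarrow> (\<Sum>j<m. (\<beta> i j + \<Lambda> j * \<Lambda> i) * u j) = 0) \<Longrightarrow> \<forall>j<m. u j = 0"
    and X: "\<And>i. i < m \<Longrightarrow> (\<Sum>j<m. \<beta> i j * X j) = 0" "(\<Sum>j<m. \<Phi> j * X j) \<noteq> 0"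
    and w: "\<And>i. i < m \<Longrightarrow> (\<Sum>j<m. (\<beta> i j + \<Phi> j * \<Phi> i) * w j) = 0"
  shows "\<forall>j<m. w j = 0"
proof -
  have split: "(\<Sum>j<m. (\<beta> i j + F j * F i) * u j) = (\<Sum>j<m. \<beta> i j * u j) + F i * (\<Sum>j<m. F j * u j)"
    for F u i
    unfolding sum_distrib_left sum.distrib[symmetric]
    by (rule sum.cong) (simp_all add: algebra_simps)
  \<comment> \<open>The value of the skew form at (w, w). It vanishes, so pairing the equation for
    \<open>w\<close> with \<open>w\<close> leaves only the square of \<Phi> at
    \<open>w\<close>.\<close>
  define q where "q = (\<Sum>i<m. \<Sum>j<m. w i * (\<beta> i j * w j))"
  have "q = (\<Sum>j<m. \<Sum>i<m. w i * (\<beta> i j * w j))" unfolding q_def by (rule sum.swap)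
  also have "\<dots> = (\<Sum>j<m. \<Sum>i<m. - (w j * (\<beta> j i * w i)))"
  proof (intro sum.cong refl)
    fix i j assume "i \<in> {..<m}" "j \<in> {..<m}"
    then have "\<beta> i j = - \<beta> j i" by (intro skew) auto
    then show "w i * (\<beta> i j * w j) = - (w j * (\<beta> j i * w i))" by (simp add: mult_ac)
  qed
  also have "\<dots> = - q" unfolding q_def by (simp add: sum_negf)
  finally have "q + q = 0" by (rule eq_neg_iff_add_eq_0[THEN iffD1])
  then have "2 * q = 0" by (simp only: mult_2)
  then have q: "q = 0" using two by simp
  have "0 = (\<Sum>i<m. w i * (\<Sum>j<m. (\<beta> i j + \<Phi> j * \<Phi> i) * w j))" using w by simp
  also have "\<dots> = q + (\<Sum>i<m. \<Phi> i * w i) * (\<Sum>j<m. \<Phi> j * w j)"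
    unfolding split q_def by (simp add: algebra_simps sum.distrib sum_distrib_left)
  finally have \<Phi>w: "(\<Sum>j<m. \<Phi> j * w j) = 0" unfolding q by simp
  then have \<beta>w: "(\<Sum>j<m. \<beta> i j * w j) = 0" if "i < m" for i
    using w[OF that] unfolding split by simp
  define a b where "a = (\<Sum>j<m. \<Lambda> j * w j)" and "b = (\<Sum>j<m. \<Lambda> j * X j)"
  \<comment> \<open>The combination of the kernel vectors \<open>X\<close> and \<open>w\<close> of
    \<beta> on which \<Lambda> vanishes. By \<open>R\<close> it is zero, and applying \<Phi> then
    gives \<open>a = 0\<close>, so \<open>w\<close> itself satisfies the hypothesis of
    \<open>R\<close>.\<close>
  define u where "u j = a * X j - b * w j" for j
  have lin: "(\<Sum>j<m. F j * u j) = a * (\<Sum>j<m. F j * X j) - b * (\<Sum>j<m. F j * w j)" for F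
    unfolding u_def by (simp add: algebra_simps sum_subtractf sum_distrib_left)
  have "\<forall>j<m. u j = 0"
  proof (rule R)
    fix i assume "i < m"
    then show "(\<Sum>j<m. (\<beta> i j + \<Lambda> j * \<Lambda> i) * u j) = 0"
      unfolding split lin X(1)[OF \<open>i < m\<close>] \<beta>w[OF \<open>i < m\<close>] a_def[symmetric] b_def[symmetric]
      by (simp add: algebra_simps)
  qed
  then have "(\<Sum>j<m. \<Phi> j * u j) = 0" by simp
  then have "a = 0" unfolding lin \<Phi>w using X(2) by simp
  show ?thesis
  proof (rule R)
    fix i assume "i < m"
    then show "(\<Sum>j<m. (\<beta> i j + \<Lambda> j * \<Lambda> i) * w j) = 0"
      unfolding split \<beta>w[OF \<open>i < m\<close>] a_def[symmetric] \<open>a = 0\<close> by simp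
  qed
qed

section \<open>Determinants along a line of functionals\<close>

context bilinear_lie_algebra
begin

lemma functional_comb: "functional \<phi> \<Longrightarrow> functional \<psi> \<Longrightarrow> functional (\<lambda>x. \<phi> x + c * \<psi> x)"
  unfolding functional_def by (simp add: algebra_simps)

lemma functional_nonzero:
  assumes "v \<noteq> 0"
  obtains \<eta> where "functional \<eta>" "\<eta> v \<noteq> 0"
proof -
  interpret p: vector_space_pair scale "(*) :: complex \<Rightarrow> complex \<Rightarrow> complex"
    by unfold_locales (auto simp: algebra_simps)
  obtain g where g: "Vector_Spaces.linear scale (*) g" "\<forall>x\<in>{v}. g x = 1"
    using p.linear_independent_extend[of "{v}" "\<lambda>_. 1"] assms by auto
  have "functional g"
    using p.linear_add[OF g(1)] p.linear_scale[OF g(1)] unfolding functional_def by blast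
  then show thesis using that g(2) by auto
qed

lemma indexed_basis:
  obtains e :: "nat \<Rightarrow> 'a" and m where "\<forall>j<m. e j \<in> G"
    "\<forall>x\<in>G. \<exists>c. x = (\<Sum>j<m. c j *s e j)"
    "\<forall>c. (\<Sum>j<m. c j *s e j) = 0 \<longrightarrow> (\<forall>j<m. c j = 0)"
proof -
  obtain B where B: "B \<subseteq> G" "independent B" "G = span B" "finite B" by (rule G_basis)
  obtain e where e: "bij_betw e {0..<card B} B" using ex_bij_betw_nat_finite[OF B(4)] by blast
  then have e': "bij_betw e {..<card B} B" by (simp add: atLeast0LessThan)
  have reindex: "(\<Sum>b\<in>B. u b *s b) = (\<Sum>j<card B. u (e j) *s e j)" for u
    by (rule sum.reindex_bij_betw[OF e', symmetric])
  show thesis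
  proof (rule that[of "card B" e])
    show "\<forall>j<card B. e j \<in> G" using bij_betwE[OF e'] B(1) by blast
    show "\<forall>x\<in>G. \<exists>c. x = (\<Sum>j<card B. c j *s e j)"
    proof
      fix x assume "x \<in> G"
      then have "x \<in> range (\<lambda>u. \<Sum>b\<in>B. u b *s b)" using B(3) span_finite[OF B(4)] by simp
      then show "\<exists>c. x = (\<Sum>j<card B. c j *s e j)" unfolding reindex by auto
    qed
    show "\<forall>c. (\<Sum>j<card B. c j *s e j) = 0 \<longrightarrow> (\<forall>j<card B. c j = 0)"
    proof (intro allI impI)
      fix c j assume c: "(\<Sum>j<card B. c j *s e j) = 0" "j < card B"
      define u where "u b = c (the_inv_into {..<card B} e b)" for b
      have u: "u (e i) = c i" if "i < card B" for i
        unfolding u_def using the_inv_into_f_f[of e "{..<card B}" i] e' that by (simp add: bij_betw_def)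
      have "(\<Sum>b\<in>B. u b *s b) = 0" unfolding reindex using c(1) u by simp
      then have "u (e j) = 0"
        using B(2) bij_betwE[OF e'] c(2) unfolding dependent_finite[OF B(4)] by blast
      then show "c j = 0" using u c(2) by simp
    qed
  qed
qed

text \<open>\<open>det (M \<phi> \<phi>)\<close> is nonzero exactly when \<phi> vanishes at no
  nonzero vector of its kernel, which for a nonzero kernel is the criterion of
  \<open>contact_iff\<close>. Contactness thus becomes the nonvanishing of a polynomial on lines of
  functionals.\<close>

theorem index_one_imp_contact:
  assumes index: "lie_index L = 1"
    and \<phi>0: "functional \<phi>0" and x: "x \<in> K \<phi>0" "x \<noteq> 0"
    and img: "\<And>z. z \<in> G \<Longrightarrow> br x z \<in> K \<phi>0 \<Longrightarrow> br x z = 0"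
  shows "contact L"
proof (rule ccontr)
  assume not_contact: "\<not> contact L"
  obtain \<phi>1 v where \<phi>1: "functional \<phi>1" "K \<phi>1 = span {v}" "v \<noteq> 0" "v \<in> G"
    and nontriv: "\<And>\<phi>. functional \<phi> \<Longrightarrow> K \<phi> \<noteq> {0}"
    by (rule index_one_kernels[OF index]) blast
  obtain e :: "nat \<Rightarrow> 'a" and m where e': "\<forall>j<m. e j \<in> G" "\<forall>x\<in>G. \<exists>c. x = (\<Sum>j<m. c j *s e j)"
    "\<forall>c. (\<Sum>j<m. c j *s e j) = 0 \<longrightarrow> (\<forall>j<m. c j = 0)"
    by (rule indexed_basis)
  then have e: "\<And>j. j < m \<Longrightarrow> e j \<in> G" "\<And>x. x \<in> G \<Longrightarrow> \<exists>c. x = (\<Sum>j<m. c j *s e j)"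
    "\<And>c j. (\<Sum>j<m. c j *s e j) = 0 \<Longrightarrow> j < m \<Longrightarrow> c j = 0"
    by blast+
  \<comment> \<open>As the kernel of \<open>\<phi>1\<close> is the line through \<open>v\<close>, a
    functional nonzero at \<open>v\<close> makes \<open>M \<phi>1 l\<close> invertible. This
    certificate of a one-dimensional kernel persists at almost all points of a line.\<close>
  obtain l where l: "functional l" "l v \<noteq> 0" by (rule functional_nonzero[OF \<phi>1(3)])
  define M where "M \<alpha> \<mu> = mat m m (\<lambda>(i, j). \<alpha> (br (e j) (e i)) + \<mu> (e j) * \<mu> (e i))"
    for \<alpha> \<mu> :: "'a \<Rightarrow> complex"
  define MP where "MP \<alpha> \<alpha>' \<mu> \<mu>' i j = [:\<alpha> (br (e j) (e i)), \<alpha>' (br (e j) (e i)):] +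
      [:\<mu> (e j), \<mu>' (e j):] * [:\<mu> (e i), \<mu>' (e i):]" for \<alpha> \<alpha>' \<mu> \<mu>' :: "'a \<Rightarrow> complex" and i j
  have MP: "poly (det (mat m m (\<lambda>(i, j). MP \<alpha> \<alpha>' \<mu> \<mu>' i j))) s =
      det (M (\<lambda>x. \<alpha> x + s * \<alpha>' x) (\<lambda>x. \<mu> x + s * \<mu>' x))" for \<alpha> \<alpha>' \<mu> \<mu>' s
    unfolding det_poly_eval M_def MP_def
    by (intro arg_cong[where f = det] eq_matI) (auto simp: algebra_simps)
  have M: "det (M \<alpha> \<mu>) = 0 \<longleftrightarrow> (\<exists>x\<in>G. x \<noteq> 0 \<and> (\<forall>z\<in>G. \<alpha> (br x z) + \<mu> x * \<mu> z = 0))"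
    if \<alpha>: "functional \<alpha>" and \<mu>: "functional \<mu>" for \<alpha> \<mu>
  proof -
    have eval: "(\<Sum>j<m. (\<alpha> (br (e j) z) + \<mu> (e j) * \<mu> z) * w j) =
        \<alpha> (br (\<Sum>j<m. w j *s e j) z) + \<mu> (\<Sum>j<m. w j *s e j) * \<mu> z" for w z
      by (simp add: br_sum br_scale functional_sum[OF \<alpha>] functional_sum[OF \<mu>] functional_scale[OF \<alpha>]
          functional_scale[OF \<mu>] algebra_simps sum.distrib sum_distrib_left)
    have all: "(\<forall>i<m. \<alpha> (br x (e i)) + \<mu> x * \<mu> (e i) = 0) \<longleftrightarrow> (\<forall>z\<in>G. \<alpha> (br x z) + \<mu> x * \<mu> z = 0)" for x
    proof
      assume *: "\<forall>i<m. \<alpha> (br x (e i)) + \<mu> x * \<mu> (e i) = 0"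
      show "\<forall>z\<in>G. \<alpha> (br x z) + \<mu> x * \<mu> z = 0"
      proof
        fix z assume "z \<in> G"
        then obtain c where c: "z = (\<Sum>j<m. c j *s e j)" using e(2) by blast
        have "\<alpha> (br x z) + \<mu> x * \<mu> z = (\<Sum>j<m. c j * (\<alpha> (br x (e j)) + \<mu> x * \<mu> (e j)))"
          unfolding c by (simp add: br_sum br_scale functional_sum[OF \<alpha>] functional_sum[OF \<mu>]
              functional_scale[OF \<alpha>] functional_scale[OF \<mu>] algebra_simps sum.distrib sum_distrib_left)
        then show "\<alpha> (br x z) + \<mu> x * \<mu> z = 0" using * by simp
      qed
    qed (use e(1) in blast)
    have "det (M \<alpha> \<mu>) = 0 \<longleftrightarrow> (\<exists>w. (\<exists>j<m. w j \<noteq> 0) \<and>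
        (\<forall>z\<in>G. \<alpha> (br (\<Sum>j<m. w j *s e j) z) + \<mu> (\<Sum>j<m. w j *s e j) * \<mu> z = 0))"
      unfolding M_def det_zero_iff_kernel eval all ..
    also have "\<dots> \<longleftrightarrow> (\<exists>x\<in>G. x \<noteq> 0 \<and> (\<forall>z\<in>G. \<alpha> (br x z) + \<mu> x * \<mu> z = 0))"
    proof
      assume "\<exists>w. (\<exists>j<m. w j \<noteq> 0) \<and>
        (\<forall>z\<in>G. \<alpha> (br (\<Sum>j<m. w j *s e j) z) + \<mu> (\<Sum>j<m. w j *s e j) * \<mu> z = 0)"
      then obtain w where w: "\<exists>j<m. w j \<noteq> 0"
        "\<forall>z\<in>G. \<alpha> (br (\<Sum>j<m. w j *s e j) z) + \<mu> (\<Sum>j<m. w j *s e j) * \<mu> z = 0" by blast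
      have "(\<Sum>j<m. w j *s e j) \<in> G"
        by (intro subspace_sum[OF G(1)] subspace_scale[OF G(1)]) (use e(1) in auto)
      moreover have "(\<Sum>j<m. w j *s e j) \<noteq> 0" using e(3) w(1) by blast
      ultimately show "\<exists>x\<in>G. x \<noteq> 0 \<and> (\<forall>z\<in>G. \<alpha> (br x z) + \<mu> x * \<mu> z = 0)" using w(2) by blast
    next
      assume "\<exists>x\<in>G. x \<noteq> 0 \<and> (\<forall>z\<in>G. \<alpha> (br x z) + \<mu> x * \<mu> z = 0)"
      then obtain x where x: "x \<in> G" "x \<noteq> 0" "\<forall>z\<in>G. \<alpha> (br x z) + \<mu> x * \<mu> z = 0" by blast
      obtain c where c: "x = (\<Sum>j<m. c j *s e j)" using e(2) x(1) by blast
      have "\<exists>j<m. c j \<noteq> 0"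
      proof (rule ccontr)
        assume "\<not> ?thesis"
        then have "x = 0" unfolding c by (intro sum.neutral) auto
        then show False using x(2) by simp
      qed
      then show "\<exists>w. (\<exists>j<m. w j \<noteq> 0) \<and>
        (\<forall>z\<in>G. \<alpha> (br (\<Sum>j<m. w j *s e j) z) + \<mu> (\<Sum>j<m. w j *s e j) * \<mu> z = 0)"
        using x(3) c by blast
    qed
    finally show ?thesis .
  qed
  \<comment> \<open>At z = y the bracket vanishes and the square of \<open>\<mu> y\<close>
    remains.\<close>
  have isotropic: "\<mu> y = 0 \<and> y \<in> K \<alpha>"
    if \<alpha>: "functional \<alpha>" and y: "y \<in> G" "\<forall>z\<in>G. \<alpha> (br y z) + \<mu> y * \<mu> z = 0" for \<alpha> \<mu> y
  proof -
    have "\<mu> y = 0" using y(2)[rule_format, OF y(1)] functional_0[OF \<alpha>] by (simp add: br_self)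
    then show ?thesis using y unfolding K_def by simp
  qed
  have "det (M \<phi>1 l) \<noteq> 0"
  proof
    assume "det (M \<phi>1 l) = 0"
    then obtain y where y: "y \<in> G" "y \<noteq> 0" "\<forall>z\<in>G. \<phi>1 (br y z) + l y * l z = 0"
      using M \<phi>1(1) l(1) by blast
    then have "l y = 0" "y \<in> span {v}" using isotropic[OF \<phi>1(1) y(1,3)] \<phi>1(2) by auto
    then obtain c where "y = c *s v" by (auto simp: span_singleton)
    then show False using \<open>l y = 0\<close> y(2) l(2) functional_scale[OF l(1)] by simp
  qed
  \<comment> \<open>If \<open>\<phi>0\<close> and \<open>\<phi>1\<close> both vanish at
    \<open>x\<close>, \<open>\<phi>1\<close> is moved along some \<eta> with \<open>\<eta> x\<close>
    nonzero. All but finitely many c keep the determinant nonzero, and c = 0 is excluded to make the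
    new value at \<open>x\<close> nonzero.\<close>
  then obtain \<phi>2 where \<phi>2: "functional \<phi>2" "det (M \<phi>2 l) \<noteq> 0" "\<phi>0 x \<noteq> 0 \<or> \<phi>2 x \<noteq> 0"
  proof (cases "\<phi>0 x \<noteq> 0 \<or> \<phi>1 x \<noteq> 0")
    case False
    obtain \<eta> where \<eta>: "functional \<eta>" "\<eta> x \<noteq> 0" by (rule functional_nonzero[OF x(2)])
    define P where "P = det (mat m m (\<lambda>(i, j). MP \<phi>1 \<eta> l (\<lambda>_. 0) i j))"
    have P: "poly P c = det (M (\<lambda>x. \<phi>1 x + c * \<eta> x) l)" for c
      unfolding P_def MP by simp
    have "poly P 0 \<noteq> 0" unfolding P using \<open>det (M \<phi>1 l) \<noteq> 0\<close> by simp
    then have "P \<noteq> 0" by auto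
    then have "finite (insert 0 {c. poly P c = 0})" using poly_roots_finite by blast
    then obtain c where c: "c \<notin> insert 0 {c. poly P c = 0}"
      using ex_new_if_finite[OF infinite_UNIV_char_0] by blast
    show ?thesis
      by (rule that[of "\<lambda>x. \<phi>1 x + c * \<eta> x"])
        (use c P \<eta> False functional_comb[OF \<phi>1(1) \<eta>(1)] in auto)
  qed (use \<phi>1(1) in blast)
  define \<psi> where "\<psi> y = \<phi>2 y + (- 1) * \<phi>0 y" for y
  have \<psi>: "functional \<psi>" unfolding \<psi>_def by (rule functional_comb[OF \<phi>2(1) \<phi>0])
  have ker: "\<phi>0 (br x z) = 0" if "z \<in> G" for z using x(1) that unfolding K_def by blast
  have img': "br x z = 0" if "z \<in> G" "\<And>y. y \<in> G \<Longrightarrow> \<phi>0 (br (br x z) y) = 0" for z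
    using img[OF that(1)] that G_br x(1) unfolding K_def by auto
  have xG: "x \<in> G" using x(1) unfolding K_def by blast
  obtain X :: "nat \<Rightarrow> 'a" where X: "X 0 = x" "\<And>k. X k \<in> G" "\<phi>0 (X 1) = 0"
    "\<And>k u. u \<in> G \<Longrightarrow> \<phi>0 (br (X k) u) + (if k = 0 then 0 else \<psi> (br (X (k - 1)) u)) = 0"
    using kernel_deformation[OF \<phi>0 \<psi> xG ker img'] by blast
  have "\<forall>k. \<exists>c. X k = (\<Sum>j<m. c j *s e j)" using e(2) X(2) by blast
  then obtain C where C: "\<And>k. X k = (\<Sum>j<m. C k j *s e j)" by metis
  define lin where "lin a b = fps_of_poly [:a, b:]" for a b :: complex
  have lin_nth: "fps_nth (lin a b * F) k = a * fps_nth F k + (if k = 0 then 0 else b * fps_nth F (k - 1))" for a b F k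
    unfolding lin_def by (simp add: fps_of_poly_pCons distrib_right mult.assoc)
  define XF where "XF j = Abs_fps (\<lambda>k. C k j)" for j
  have XF_nth: "fps_nth (\<Sum>j<m. lin (\<omega> (T (e j))) (\<psi>' (T (e j))) * XF j) k =
      \<omega> (T (X k)) + (if k = 0 then 0 else \<psi>' (T (X (k - 1))))"
    if "functional \<omega>" "functional \<psi>'" "\<And>c. T (\<Sum>j<m. c j *s e j) = (\<Sum>j<m. c j *s T (e j))" for \<omega> \<psi>' T k
  proof -
    have T: "\<chi> (T (X i)) = (\<Sum>j<m. \<chi> (T (e j)) * C i j)" if \<chi>: "functional \<chi>" for \<chi> i
      unfolding C \<open>\<And>c. T (\<Sum>j<m. c j *s e j) = (\<Sum>j<m. c j *s T (e j))\<close> functional_sum[OF \<chi>]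
        functional_scale[OF \<chi>] by (rule sum.cong) (simp_all add: mult.commute)
    show ?thesis
      unfolding T[OF that(1)] T[OF that(2)]
      by (simp add: fps_sum_nth lin_nth XF_def sum.distrib)
  qed
  define \<beta> where "\<beta> i j = lin (\<phi>0 (br (e j) (e i))) (\<psi> (br (e j) (e i)))" for i j
  define \<Phi> where "\<Phi> j = lin (\<phi>0 (e j)) (\<psi> (e j))" for j
  define \<Lambda> where "\<Lambda> j = lin (l (e j)) 0" for j
  have MPN: "fps_of_poly (MP \<phi>0 \<psi> \<phi>0 \<psi> i j) = \<beta> i j + \<Phi> j * \<Phi> i"
    and MPR: "fps_of_poly (MP \<phi>0 \<psi> l (\<lambda>_. 0) i j) = \<beta> i j + \<Lambda> j * \<Lambda> i" for i j
    unfolding MP_def \<beta>_def \<Phi>_def \<Lambda>_def lin_def fps_of_poly_add fps_of_poly_mult by simp_all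
  \<comment> \<open>One polynomial determinant read twice: it vanishes at every complex s because no
    functional is a contact form, hence also over power series, where the kernel vector with
    coefficients \<open>X\<close> will contradict this. The line reaches \<open>\<phi>2\<close> at s
    = 1, where the second determinant, formed with \<open>l\<close>, is nonzero.\<close>
  have "\<forall>s. poly (det (mat m m (\<lambda>(i, j). MP \<phi>0 \<psi> \<phi>0 \<psi> i j))) s = 0"
  proof
    fix s
    define \<phi>s where "\<phi>s = (\<lambda>x. \<phi>0 x + s * \<psi> x)"
    have \<phi>s: "functional \<phi>s" unfolding \<phi>s_def by (rule functional_comb[OF \<phi>0 \<psi>])
    obtain w where w: "w \<in> K \<phi>s" "\<phi>s w = 0" "w \<noteq> 0"
      using not_contact nontriv[OF \<phi>s] \<phi>s unfolding contact_iff by blast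
    then have "\<exists>x\<in>G. x \<noteq> 0 \<and> (\<forall>z\<in>G. \<phi>s (br x z) + \<phi>s x * \<phi>s z = 0)"
      unfolding K_def by auto
    then show "poly (det (mat m m (\<lambda>(i, j). MP \<phi>0 \<psi> \<phi>0 \<psi> i j))) s = 0"
      unfolding MP \<phi>s_def[symmetric] M[OF \<phi>s \<phi>s] .
  qed
  then have "det (mat m m (\<lambda>(i, j). MP \<phi>0 \<psi> \<phi>0 \<psi> i j)) = 0" by (simp only: poly_all_0_iff_0)
  then have "det (mat m m (\<lambda>(i, j). \<beta> i j + \<Phi> j * \<Phi> i)) = 0"
    unfolding MPN[symmetric] det_fps_of_poly[symmetric] by simp
  then obtain w where w: "\<exists>j<m. w j \<noteq> 0" "\<And>i. i < m \<Longrightarrow> (\<Sum>j<m. (\<beta> i j + \<Phi> j * \<Phi> i) * w j) = 0"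
    unfolding det_zero_iff_kernel by blast
  have "poly (det (mat m m (\<lambda>(i, j). MP \<phi>0 \<psi> l (\<lambda>_. 0) i j))) 1 \<noteq> 0"
    unfolding MP \<psi>_def using \<phi>2(2) by simp
  then have "det (mat m m (\<lambda>(i, j). MP \<phi>0 \<psi> l (\<lambda>_. 0) i j)) \<noteq> 0" by auto
  then have "fps_of_poly (det (mat m m (\<lambda>(i, j). MP \<phi>0 \<psi> l (\<lambda>_. 0) i j))) \<noteq> 0"
    using fps_of_poly_eq_iff[of _ 0] by simp
  then have "det (mat m m (\<lambda>(i, j). \<beta> i j + \<Lambda> j * \<Lambda> i)) \<noteq> 0"
    unfolding det_fps_of_poly MPR .
  then have R: "\<forall>j<m. u j = 0" if "\<And>i. i < m \<Longrightarrow> (\<Sum>j<m. (\<beta> i j + \<Lambda> j * \<Lambda> i) * u j) = 0" for u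
    unfolding det_zero_iff_kernel using that by blast
  have skew: "\<beta> i j = - \<beta> j i" for i j
    unfolding \<beta>_def lin_def br_anti[of "e j" "e i"] functional_minus[OF \<phi>0] functional_minus[OF \<psi>]
    by (simp flip: fps_of_poly_uminus)
  have X1: "(\<Sum>j<m. \<beta> i j * XF j) = 0" if "i < m" for i
  proof (rule fps_ext)
    fix k
    have "fps_nth (\<Sum>j<m. \<beta> i j * XF j) k = \<phi>0 (br (X k) (e i)) + (if k = 0 then 0 else \<psi> (br (X (k - 1)) (e i)))"
      unfolding \<beta>_def by (rule XF_nth[OF \<phi>0 \<psi>]) (simp add: br_sum br_scale)
    then show "fps_nth (\<Sum>j<m. \<beta> i j * XF j) k = fps_nth 0 k" using X(4) e(1) that by simp
  qed
  have \<Phi>X: "fps_nth (\<Sum>j<m. \<Phi> j * XF j) k = \<phi>0 (X k) + (if k = 0 then 0 else \<psi> (X (k - 1)))" for k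
    unfolding \<Phi>_def by (rule XF_nth[OF \<phi>0 \<psi>]) simp
  have "(\<Sum>j<m. \<Phi> j * XF j) \<noteq> 0"
  proof
    assume "(\<Sum>j<m. \<Phi> j * XF j) = 0"
    then have "\<phi>0 x = 0" "\<psi> x = 0" using \<Phi>X[of 0] \<Phi>X[of 1] X(1,3) by auto
    then show False using \<phi>2(3) unfolding \<psi>_def by simp
  qed
  moreover have "(2 :: complex fps) \<noteq> 0" by (simp add: numeral_fps_const)
  ultimately have "\<forall>j<m. w j = 0"
    using skew_plus_square_nondegenerate[OF _ skew R X1 _ w(2)] by blast
  then show False using w(1) by blast
qed

end

section \<open>Seaweeds\<close>

lemma diag_block_take:
  "diag_block p c i j \<longleftrightarrow> (\<exists>k<length c.
     i \<in> {p + sum_list (take k c)<..p + sum_list (take (Suc k) c)} \<and>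
     j \<in> {p + sum_list (take k c)<..p + sum_list (take (Suc k) c)})"
proof (induction p c i j rule: diag_block.induct)
  case (2 p x c i j)
  have "(\<exists>k<length (x # c).
      i \<in> {p + sum_list (take k (x # c))<..p + sum_list (take (Suc k) (x # c))} \<and>
      j \<in> {p + sum_list (take k (x # c))<..p + sum_list (take (Suc k) (x # c))}) \<longleftrightarrow>
    i \<in> {p<..p + x} \<and> j \<in> {p<..p + x} \<or> (\<exists>k<length c.
      i \<in> {p + x + sum_list (take k c)<..p + x + sum_list (take (Suc k) c)} \<and>
      j \<in> {p + x + sum_list (take k c)<..p + x + sum_list (take (Suc k) c)})"
    unfolding length_Cons Ex_less_Suc2 by (simp add: add.assoc)
  then show ?case using 2 by auto
qed simp

lemma in_block_diag_block: "in_block c i j \<longleftrightarrow> diag_block 0 c i j"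
  unfolding in_block_def diag_block_take by simp

lemma admissible_adm: "admissible c d i j \<longleftrightarrow> adm 0 c d i j"
  unfolding admissible_def adm_def in_block_diag_block ..

lemma diag_block_refl: "p < i \<Longrightarrow> i \<le> p + sum_list c \<Longrightarrow> diag_block p c i i"
proof (induction c arbitrary: p)
  case (Cons x c)
  then show ?case using Cons.IH[of "p + x"] by (cases "i \<le> p + x") auto
qed simp

lemma diag_block_append:
  "diag_block p (c @ d) i j \<longleftrightarrow> diag_block p c i j \<or> diag_block (p + sum_list c) d i j"
  by (induction c arbitrary: p) (auto simp: add.assoc)

lemma arc_append: "arc p (c @ d) i j \<longleftrightarrow> arc p c i j \<or> arc (p + sum_list c) d i j"
  by (induction c arbitrary: p) (auto simp: add.assoc)

lemma diag_block_rev: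
  "diag_block p c i j \<Longrightarrow>
    diag_block q (rev c) (p + q + sum_list c + 1 - i) (p + q + sum_list c + 1 - j)"
proof (induction c arbitrary: p)
  case (Cons x c)
  have e: "p + q + sum_list (x # c) = (p + x) + q + sum_list c" by simp
  consider "p < i" "i \<le> p + x" "p < j" "j \<le> p + x" | "diag_block (p + x) c i j"
    using Cons.prems by auto
  then show ?case
  proof cases
    case 1
    then show ?thesis by (auto simp: diag_block_append)
  next
    case 2
    from Cons.IH[OF this] show ?thesis unfolding e rev.simps diag_block_append by blast
  qed
qed simp

lemma arc_rev:
  "arc p c i j \<Longrightarrow> arc q (rev c) (p + q + sum_list c + 1 - i) (p + q + sum_list c + 1 - j)"
proof (induction c arbitrary: p)
  case (Cons x c)
  have e: "p + q + sum_list (x # c) = (p + x) + q + sum_list c" by simp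
  consider "p < i" "i \<le> p + x" "i + j = 2 * p + x + 1" | "arc (p + x) c i j"
    using Cons.prems by auto
  then show ?case
  proof cases
    case 1
    then show ?thesis by (auto simp: arc_append)
  next
    case 2
    from Cons.IH[OF this] show ?thesis unfolding e rev.simps arc_append by blast
  qed
qed simp

lemma arc_sum_eq:
  "arc p c i j \<Longrightarrow> arc p c k l \<Longrightarrow> diag_block p c i k \<Longrightarrow> i + j = k + l"
proof (induction c arbitrary: p)
  case (Cons x c)
  then show ?case
    using arc_bounds[of "p + x" c i j] arc_bounds[of "p + x" c k l] diag_block_bounds[of "p + x" c i k]
    by auto
qed simp

text \<open>Nested arcs of a block share the sum of their ends (\<open>arc_sum_eq\<close>), so the
  inner one is shorter; powers of 2 in the length are therefore graded. The phases
  \<open>\<eta>\<close> leave room for the signs that type C requires.\<close>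

definition meander_coeff ::
    "nat list \<Rightarrow> nat list \<Rightarrow> (nat \<Rightarrow> nat \<Rightarrow> complex) \<Rightarrow> nat \<Rightarrow> nat \<Rightarrow> complex" where
  "meander_coeff a b \<eta> i j =
     (if i > j \<and> arc 0 a i j then \<eta> i j * 2 ^ (i - j) else if i < j \<and> arc 0 b i j then \<eta> i j * 2 ^ (j - i) else 0)"

lemma meander_coeff:
  assumes \<eta>: "\<And>i j. norm (\<eta> i j) = 1"
  shows "meander 0 a b (meander_coeff a b \<eta>)"
proof -
  have nz: "\<eta> i j \<noteq> 0" for i j using \<eta>[of i j] by auto
  have graded: "graded_arcs 0 c g" if "\<And>i j. i < j \<Longrightarrow> arc 0 c i j \<Longrightarrow> norm (g i j) = 2 ^ (j - i)" for c g
    unfolding graded_arcs_def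
  proof (intro allI impI)
    fix i j k l assume *: "i < j" "k < l" "arc 0 c i j" "arc 0 c k l" "diag_block 0 c i k" "i < k"
    then have "l - k < j - i" using arc_sum_eq[of 0 c i j k l] by simp
    then show "norm (g k l) < norm (g i j)" using that * by simp
  qed
  show ?thesis
    unfolding meander_def
  proof (intro conjI allI graded)
    show "meander_coeff a b \<eta> i j \<noteq> 0 \<longleftrightarrow> i > j \<and> arc 0 a i j \<or> i < j \<and> arc 0 b i j" for i j
      unfolding meander_coeff_def using nz by auto
    show "norm (meander_coeff a b \<eta> j i) = 2 ^ (j - i)" if "i < j" "arc 0 a i j" for i j
      using that arc_sym[OF that(2)] by (simp add: meander_coeff_def norm_mult norm_power \<eta>)
    show "norm (meander_coeff a b \<eta> i j) = 2 ^ (j - i)" if "i < j" "arc 0 b i j" for i j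
      using that by (simp add: meander_coeff_def norm_mult norm_power \<eta>)
  qed
qed

section \<open>Seaweeds as instances of the abstract setting\<close>

definition pairing :: "nat \<Rightarrow> (nat \<Rightarrow> nat \<Rightarrow> complex) \<Rightarrow> cmat \<Rightarrow> complex" where
  "pairing N f x = (\<Sum>i=1..N. \<Sum>j=1..N. f i j * x i j)"

definition identity :: "nat \<Rightarrow> cmat" where
  "identity N = (\<lambda>i j. if i = j \<and> i \<in> {1..N} then 1 else 0)"

lemma pairing_linear:
  "pairing N f (x + y) = pairing N f x + pairing N f y"
  "pairing N f (mat_scale c x) = c * pairing N f x"
  unfolding pairing_def mat_scale_def
  by (simp_all add: algebra_simps sum.distrib sum_distrib_left)

lemma mat_prod_unit:
  assumes "k \<in> {1..N}" "l \<in> {1..N}"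
  shows "mat_prod N x (mat_unit k l) = (\<lambda>i j. if j = l then x i k else 0)"
    and "mat_prod N (mat_unit k l) x = (\<lambda>i j. if i = k then x l j else 0)"
proof -
  show "mat_prod N x (mat_unit k l) = (\<lambda>i j. if j = l then x i k else 0)"
  proof (intro ext)
    fix i j
    have "mat_prod N x (mat_unit k l) i j = (\<Sum>m=1..N. if m = k then (if j = l then x i k else 0) else 0)"
      unfolding mat_prod_def mat_unit_def by (rule sum.cong) auto
    then show "mat_prod N x (mat_unit k l) i j = (if j = l then x i k else 0)" using assms by simp
  qed
  show "mat_prod N (mat_unit k l) x = (\<lambda>i j. if i = k then x l j else 0)"
  proof (intro ext)
    fix i j
    have "mat_prod N (mat_unit k l) x i j = (\<Sum>m=1..N. if m = l then (if i = k then x l j else 0) else 0)"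
      unfolding mat_prod_def mat_unit_def by (rule sum.cong) auto
    then show "mat_prod N (mat_unit k l) x i j = (if i = k then x l j else 0)" using assms by simp
  qed
qed

lemma mat_prod_identity:
  assumes "x \<in> gl_space N"
  shows "mat_prod N (identity N) x = x" "mat_prod N x (identity N) = x"
proof -
  have out: "x i j = 0" if "i \<notin> {1..N} \<or> j \<notin> {1..N}" for i j
    using assms that unfolding gl_space_def by blast
  show "mat_prod N (identity N) x = x"
  proof (intro ext)
    fix i j
    have "mat_prod N (identity N) x i j = (\<Sum>m=1..N. if m = i then x i j else 0)"
      unfolding mat_prod_def identity_def by (rule sum.cong) auto
    then show "mat_prod N (identity N) x i j = x i j" using out[of i j] by auto
  qed
  show "mat_prod N x (identity N) = x"
  proof (intro ext)
    fix i j
    have "mat_prod N x (identity N) i j = (\<Sum>m=1..N. if m = j then x i j else 0)"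
      unfolding mat_prod_def identity_def by (rule sum.cong) auto
    then show "mat_prod N x (identity N) i j = x i j" using out[of i j] by auto
  qed
qed

lemma mat_prod_gl: "x \<in> gl_space N \<Longrightarrow> y \<in> gl_space N \<Longrightarrow> mat_prod N x y \<in> gl_space N"
  unfolding gl_space_def mat_prod_def
  by (auto simp del: neq0_conv elim!: sum.not_neutral_contains_not_neutral) 

lemma mat_prod_admissible:
  assumes "x \<in> admissible_space N c d" "y \<in> admissible_space N c d"
  shows "mat_prod N x y \<in> admissible_space N c d"
  unfolding admissible_space_def mat_prod_def
proof (intro CollectI ballI impI sum.neutral)
  fix i j k assume *: "i \<in> {1..N}" "j \<in> {1..N}" "\<not> admissible c d i j" "k \<in> {1..N}"
  then have "\<not> admissible c d i k \<or> \<not> admissible c d k j" using admissible_trans by blast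
  then show "x i k * y k j = 0" using assms * unfolding admissible_space_def by auto
qed

text \<open>Testing the invariance condition on matrix units at admissible positions turns it into
  \<open>stab\<close>, to which \<open>meander_reduced\<close> applies.\<close>

lemma seaweed_reduced_stabilizer:
  assumes sums: "sum_list c = N" "sum_list d = N" and f: "meander 0 c d f"
  shows "reduced_stabilizer N (gl_space N \<inter> admissible_space N c d) (pairing N f) (identity N)"
proof
  let ?A = "gl_space N \<inter> admissible_space N c d"
  show "mat.subspace ?A" by (intro mat.subspace_inter subspace_gl subspace_admissible)
  show "?A \<subseteq> gl_space N" by blast
  show "mat_prod N x y \<in> ?A" if "x \<in> ?A" "y \<in> ?A" for x y
    using that mat_prod_gl mat_prod_admissible by blast
  show "identity N \<in> ?A"
    using diag_block_refl[of 0 _ c] sums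
    by (auto simp: identity_def gl_space_def admissible_space_def admissible_adm adm_def)
  show "mat_prod N (identity N) x = x \<and> mat_prod N x (identity N) = x" if "x \<in> ?A" for x
    using that mat_prod_identity by blast
  show "pairing N f (x + y) = pairing N f x + pairing N f y"
    "pairing N f (mat_scale r x) = r * pairing N f x" for x y r
    by (rule pairing_linear)+
  show "x = 0" if x: "x \<in> ?A" "mat_prod N x x = 0"
    and comm: "\<And>y. y \<in> ?A \<Longrightarrow> pairing N f (mat_prod N x y) = pairing N f (mat_prod N y x)" for x
  proof -
    have "stab N (adm 0 c d) f x"
      unfolding stab_def
    proof (intro conjI allI impI)
      fix i j assume "x i j \<noteq> 0"
      then show "adm 0 c d i j"
        using x(1) unfolding gl_space_def admissible_space_def admissible_adm by blast
    next
      fix k l assume kl: "adm 0 c d k l"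
      then have in_range: "k \<in> {1..N}" "l \<in> {1..N}" using adm_bounds[OF kl sums] by auto
      have "mat_unit k l \<in> ?A"
        using kl in_range by (auto simp: mat_unit_def gl_space_def admissible_space_def admissible_adm)
      then have "pairing N f (mat_prod N x (mat_unit k l)) = pairing N f (mat_prod N (mat_unit k l) x)"
        by (rule comm)
      moreover have "pairing N f (mat_prod N x (mat_unit k l)) = (\<Sum>i=1..N. f i l * x i k)"
      proof -
        have "(\<Sum>j=1..N. f i j * (if j = l then x i k else 0)) = f i l * x i k" for i
          using in_range by (simp add: if_distrib cong: if_cong)
        then show ?thesis unfolding pairing_def mat_prod_unit[OF in_range] by simp
      qed
      moreover have "pairing N f (mat_prod N (mat_unit k l) x) = (\<Sum>j=1..N. f k j * x l j)"
      proof -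
        have "(\<Sum>i=1..N. f i j * (if i = k then x l j else 0)) = f k j * x l j" for j
          using in_range by (simp add: if_distrib cong: if_cong)
        then show ?thesis unfolding pairing_def mat_prod_unit[OF in_range] by (subst sum.swap) simp
      qed
      ultimately show "(\<Sum>i=1..N. f i l * x i k) = (\<Sum>j=1..N. f k j * x l j)" by simp
    qed
    moreover have "reduced N (adm 0 c d) f"
      by (rule meander_reduced) (use sums f in auto)
    ultimately show ?thesis using x(2) unfolding reduced_def by blast
  qed
qed

lemma mat_lie_algebra:
  assumes "mat.subspace S" "S \<subseteq> gl_space N"
    and "\<And>x y. x \<in> S \<Longrightarrow> y \<in> S \<Longrightarrow> mat_commutator N x y \<in> S"
  shows "bilinear_lie_algebra mat_scale (mat_commutator N) S"
proof unfold_locales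
  show "\<exists>B. finite B \<and> S = mat.span B" by (rule finite_span_of_subspace[OF assms(1,2)])
qed (use assms in \<open>simp_all add: mat_commutator_def mat_prod_simps mat_prod_assoc
  mat.scale_right_diff_distrib\<close>)

text \<open>The common frame for both types: \<open>H\<close> is any Lie subalgebra on which the
  Kirillov kernel of \<phi> is contained in \<open>S\<close>. The ring theory of \<open>S\<close>
  then provides the hypothesis of \<open>index_one_imp_contact\<close> on images of ad x.\<close>

lemma (in reduced_stabilizer) contact_iff_index_one:
  assumes H: "mat.subspace H" "H \<subseteq> A"
    "\<And>x y. x \<in> H \<Longrightarrow> y \<in> H \<Longrightarrow> mat_commutator N x y \<in> H"
    and kernel: "\<And>x. x \<in> H \<Longrightarrow> (\<And>y. y \<in> H \<Longrightarrow> \<phi> (mat_commutator N x y) = 0) \<Longrightarrow> x \<in> S"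
  shows "contact (mat_lie N H) \<longleftrightarrow> lie_index (mat_lie N H) = 1"
proof -
  interpret g: bilinear_lie_algebra mat_scale "mat_commutator N" H
    by (rule mat_lie_algebra) (use H A in auto)
  have L: "g.L = mat_lie N H" unfolding g.L_def mat_lie_def ..
  have \<phi>': "g.functional \<phi>" unfolding g.functional_def using \<phi> by blast
  have "contact g.L" if index: "lie_index g.L = 1"
  proof -
    have "g.K \<phi> \<noteq> {0}" by (rule g.index_one_kernels[OF index]) (use \<phi>' in blast)
    then obtain x where x: "x \<in> g.K \<phi>" "x \<noteq> 0"
      using mat.subspace_0[OF g.K_subspace[OF \<phi>']] by blast
    have KS: "y \<in> S" if "y \<in> g.K \<phi>" for y
      using kernel[of y] that unfolding g.K_def by blast
    have "mat_commutator N x z = 0" if z: "z \<in> H" "mat_commutator N x z \<in> g.K \<phi>" for z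
      using S_image_trivial[OF KS[OF x(1)], of z] z H(2) KS[OF z(2)] unfolding mat_commutator_def by blast
    then show ?thesis using g.index_one_imp_contact[OF index \<phi>' x] by blast
  qed
  then show ?thesis using g.contact_imp_index unfolding L by blast
qed

section \<open>Type A\<close>

lemma type_A_contact:
  assumes n: "1 \<le> n" and a: "composition n a" and b: "composition n b"
  shows "contact (seaweed_A n a b) \<longleftrightarrow> lie_index (seaweed_A n a b) = 1"
proof -
  let ?A = "gl_space n \<inter> admissible_space n a b"
  let ?H = "sl_space n \<inter> admissible_space n a b"
  let ?f = "meander_coeff a b (\<lambda>_ _. 1)"
  interpret reduced_stabilizer n ?A "pairing n ?f" "identity n"
    by (rule seaweed_reduced_stabilizer) (use a b meander_coeff in \<open>auto simp: composition_def\<close>)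
  have eq: "seaweed_A n a b = mat_lie n ?H"
    by (auto simp: seaweed_A_def admissible_space_def Int_def)
  have sl: "sl_space n \<subseteq> gl_space n" unfolding sl_space_def by blast
  show ?thesis
    unfolding eq
  proof (rule contact_iff_index_one)
    show "mat.subspace ?H" by (intro mat.subspace_inter subspace_sl subspace_admissible)
    show "?H \<subseteq> ?A" using sl by blast
    show "mat_commutator n x y \<in> ?H" if "x \<in> ?H" "y \<in> ?H" for x y
      using that sl commutator_sl commutator_admissible by blast
    fix x assume x: "x \<in> ?H"
      and ker: "\<And>y. y \<in> ?H \<Longrightarrow> pairing n ?f (mat_commutator n x y) = 0"
    have xA: "x \<in> ?A" using x sl by blast
    show "x \<in> S"
      unfolding S_def
    proof (intro CollectI conjI ballI)
      fix y assume y: "y \<in> ?A"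
      \<comment> \<open>Subtracting a multiple of the identity makes \<open>y\<close> trace-zero and
        does not change its commutator with \<open>x\<close>, so testing on trace-zero matrices
        suffices.\<close>
      define u where "u = y - mat_scale (mat_trace n y / of_nat n) (identity n)"
      have "mat_trace n (identity n) = of_nat n" by (simp add: mat_trace_def identity_def)
      moreover have "mat_trace n u = mat_trace n y - mat_trace n y / of_nat n * mat_trace n (identity n)"
        unfolding u_def mat_trace_def by (simp add: mat_scale_def sum_subtractf sum_distrib_left)
      ultimately have "mat_trace n u = 0" using n by simp
      moreover have uA: "u \<in> ?A"
        unfolding u_def by (intro mat.subspace_diff[OF A(1)] y mat.subspace_scale[OF A(1)] e(1))
      ultimately have "u \<in> ?H" unfolding sl_space_def by blast
      then have "pairing n ?f (mat_commutator n x u) = 0" by (rule ker)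
      moreover have "mat_commutator n x u = mat_commutator n x y"
        using e(2)[OF xA] unfolding u_def mat_commutator_def by (simp add: mat_prod_simps)
      ultimately have "pairing n ?f (mat_commutator n x y) = 0" by (simp only:)
      then show "pairing n ?f (mat_prod n x y) = pairing n ?f (mat_prod n y x)"
        by (simp add: mat_commutator_def \<phi>_diff)
    qed (rule xA)
  qed
qed

section \<open>Type C and the signed reflection in the antidiagonal\<close>

definition half_symmetric :: "nat \<Rightarrow> complex \<Rightarrow> cmat \<Rightarrow> bool" where
  "half_symmetric n \<epsilon> x \<longleftrightarrow> (\<forall>i\<in>{1..2 * n}. \<forall>j\<in>{1..2 * n}.
     x (flip n j) (flip n i) = \<epsilon> * half_sign n i * half_sign n j * x i j)"

text \<open>The signed reflection reverses products. In particular the commutator of an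
  anti-invariant and an invariant matrix is invariant.\<close>

lemma mat_prod_half_symmetric:
  assumes u: "half_symmetric n \<epsilon> u" and v: "half_symmetric n \<delta> v"
    and ij: "i \<in> {1..2 * n}" "j \<in> {1..2 * n}"
  shows "mat_prod (2 * n) u v (flip n j) (flip n i) =
    \<epsilon> * \<delta> * half_sign n i * half_sign n j * mat_prod (2 * n) v u i j"
proof -
  have "mat_prod (2 * n) u v (flip n j) (flip n i) =
      (\<Sum>k=1..2 * n. u (flip n j) (flip n k) * v (flip n k) (flip n i))"
    unfolding mat_prod_def
    by (rule sum.reindex_bij_witness[of _ "flip n" "flip n"]) (use flip_simps in auto)
  also have "\<dots> = (\<Sum>k=1..2 * n. \<epsilon> * \<delta> * half_sign n i * half_sign n j * (v i k * u k j))"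
  proof (rule sum.cong[OF refl])
    fix k assume k: "k \<in> {1..2 * n}"
    have "u (flip n j) (flip n k) = \<epsilon> * half_sign n k * half_sign n j * u k j"
      "v (flip n k) (flip n i) = \<delta> * half_sign n i * half_sign n k * v i k"
      using u v k ij unfolding half_symmetric_def by blast+
    then show "u (flip n j) (flip n k) * v (flip n k) (flip n i) =
        \<epsilon> * \<delta> * half_sign n i * half_sign n j * (v i k * u k j)"
      by (simp add: mult.left_commute mult.assoc)
  qed
  finally show ?thesis by (simp add: mat_prod_def sum_distrib_left)
qed

text \<open>The signed reflection preserves \<open>pairing\<close>, so its eigenspaces for -1 and 1
  are orthogonal.\<close>

lemma pairing_half_symmetric:
  assumes f: "half_symmetric n (- 1) f" and x: "half_symmetric n 1 x"
  shows "pairing (2 * n) f x = 0"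
proof -
  have "pairing (2 * n) f x = (\<Sum>i=1..2 * n. \<Sum>j=1..2 * n. f (flip n i) j * x (flip n i) j)"
    unfolding pairing_def
    by (rule sum.reindex_bij_witness[of _ "flip n" "flip n"]) (use flip_simps in auto)
  also have "\<dots> = (\<Sum>i=1..2 * n. \<Sum>j=1..2 * n. f (flip n i) (flip n j) * x (flip n i) (flip n j))"
  proof (rule sum.cong[OF refl])
    fix i
    show "(\<Sum>j=1..2 * n. f (flip n i) j * x (flip n i) j) =
        (\<Sum>j=1..2 * n. f (flip n i) (flip n j) * x (flip n i) (flip n j))"
      by (rule sum.reindex_bij_witness[of _ "flip n" "flip n"]) (use flip_simps in auto)
  qed
  also have "\<dots> = (\<Sum>i=1..2 * n. \<Sum>j=1..2 * n. - (f j i * x j i))"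
  proof (intro sum.cong refl)
    fix i j assume ij: "i \<in> {1..2 * n}" "j \<in> {1..2 * n}"
    have "f (flip n i) (flip n j) = - 1 * half_sign n j * half_sign n i * f j i"
      "x (flip n i) (flip n j) = 1 * half_sign n j * half_sign n i * x j i"
      using f x ij unfolding half_symmetric_def by blast+
    then show "f (flip n i) (flip n j) * x (flip n i) (flip n j) = - (f j i * x j i)"
      by (simp add: mult.left_commute mult.assoc)
  qed
  also have "\<dots> = - pairing (2 * n) f x"
    unfolding pairing_def sum_negf by (simp, rule sum.swap)
  finally show ?thesis by simp
qed

lemma antiskew_half_symmetric: "x \<in> antiskew n \<longleftrightarrow> half_symmetric n (- 1) x"
  unfolding antiskew_def half_symmetric_def by simp

lemma symmetric_blocks:
  assumes "partial_composition n a"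
  shows "sum_list (symmetric_blocks n a) = 2 * n" "rev (symmetric_blocks n a) = symmetric_blocks n a"
  using assms unfolding symmetric_blocks_def partial_composition_def by auto

lemma flip_order: "i \<in> {1..2 * n} \<Longrightarrow> j \<in> {1..2 * n} \<Longrightarrow> flip n i < flip n j \<longleftrightarrow> j < i"
  "i \<in> {1..2 * n} \<Longrightarrow> j \<in> {1..2 * n} \<Longrightarrow> flip n i - flip n j = j - i"
  unfolding flip_def by auto

lemma arc_flip:
  assumes c: "sum_list c = 2 * n" "rev c = c" and ij: "i \<in> {1..2 * n}" "j \<in> {1..2 * n}"
  shows "arc 0 c (flip n j) (flip n i) \<longleftrightarrow> arc 0 c i j"
proof -
  have "arc 0 c (flip n j) (flip n i)" if "arc 0 c i j" for i j
    using arc_rev[OF that, of 0] c unfolding flip_def by (auto intro: arc_sym)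
  from this[of i j] this[of "flip n j" "flip n i"] show ?thesis using flip_simps(2) ij by metis
qed

text \<open>Both block lists are palindromes, so the admissible positions are symmetric about the
  antidiagonal and the associative algebra is stable under the signed reflection.\<close>

lemma admissible_flip:
  assumes c: "sum_list c = 2 * n" "rev c = c" and d: "sum_list d = 2 * n" "rev d = d"
    and adm: "admissible c d i j"
  shows "admissible c d (flip n j) (flip n i)"
proof -
  have "diag_block 0 c (flip n j) (flip n i)" if "diag_block 0 c i j" "sum_list c = 2 * n" "rev c = c" for c
    using diag_block_rev[OF that(1), of 0] that unfolding flip_def by (auto intro: diag_block_sym)
  moreover have "i \<ge> j \<Longrightarrow> flip n j \<ge> flip n i" "i \<le> j \<Longrightarrow> flip n j \<le> flip n i"
    unfolding flip_def by auto
  ultimately show ?thesis using adm c d unfolding admissible_def in_block_diag_block by blast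
qed

lemma type_C_contact:
  assumes a: "partial_composition n a" and b: "partial_composition n b"
  shows "contact (seaweed_C n a b) \<longleftrightarrow> lie_index (seaweed_C n a b) = 1"
proof -
  define c where "c = symmetric_blocks n a"
  define d where "d = symmetric_blocks n b"
  have c: "sum_list c = 2 * n" "rev c = c" and d: "sum_list d = 2 * n" "rev d = d"
    unfolding c_def d_def using symmetric_blocks a b by blast+
  let ?A = "gl_space (2 * n) \<inter> admissible_space (2 * n) c d"
  let ?H = "gl_space (2 * n) \<inter> antiskew n \<inter> admissible_space (2 * n) c d"
  \<comment> \<open>the signs make the functional anti-invariant under the involution that defines \<open>antiskew\<close>\<close>
  define \<eta> :: "nat \<Rightarrow> nat \<Rightarrow> complex" where "\<eta> i j = (if i > n \<and> j > n then - 1 else 1)" for i j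
  let ?f = "meander_coeff c d \<eta>"
  interpret reduced_stabilizer "2 * n" ?A "pairing (2 * n) ?f" "identity (2 * n)"
    by (rule seaweed_reduced_stabilizer[OF c(1) d(1) meander_coeff]) (simp add: \<eta>_def)
  have f: "half_symmetric n (- 1) ?f"
    unfolding half_symmetric_def
  proof (intro ballI)
    fix i j assume ij: "i \<in> {1..2 * n}" "j \<in> {1..2 * n}"
    have "\<eta> (flip n j) (flip n i) = - 1 * half_sign n i * half_sign n j * \<eta> i j"
      using ij unfolding \<eta>_def half_sign_def flip_def by auto
    then show "?f (flip n j) (flip n i) = - 1 * half_sign n i * half_sign n j * ?f i j"
      unfolding meander_coeff_def arc_flip[OF c ij] arc_flip[OF d ij] flip_order(1)[OF ij]
        flip_order(1)[OF ij(2,1)] flip_order(2)[OF ij] flip_order(2)[OF ij(2,1)] by simp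
  qed
  have eq: "seaweed_C n a b = mat_lie (2 * n) ?H"
    by (auto simp: seaweed_C_def admissible_space_def Int_def sp_space_eq c_def d_def)
  show ?thesis
    unfolding eq
  proof (rule contact_iff_index_one)
    show "mat.subspace ?H"
      by (intro mat.subspace_inter subspace_gl subspace_antiskew subspace_admissible)
    show "?H \<subseteq> ?A" by blast
    show "mat_commutator (2 * n) x y \<in> ?H" if "x \<in> ?H" "y \<in> ?H" for x y
      using that commutator_gl commutator_antiskew commutator_admissible by blast
    fix x assume x: "x \<in> ?H"
      and ker: "\<And>y. y \<in> ?H \<Longrightarrow> pairing (2 * n) ?f (mat_commutator (2 * n) x y) = 0"
    have xs: "half_symmetric n (- 1) x" using x antiskew_half_symmetric by blast
    show "x \<in> S"
      unfolding S_def
    proof (intro CollectI conjI ballI)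
      show "x \<in> ?A" using x by blast
      fix y assume y: "y \<in> ?A"
      \<comment> \<open>The signed reflection of \<open>y\<close>. The difference
        \<open>y - t\<close> is anti-invariant and lies in the seaweed, where the kernel condition
        applies; the commutator of \<open>x\<close> with the invariant \<open>y + t\<close> is
        invariant and hence orthogonal to the functional. The two add up to twice the commutator
        with \<open>y\<close>.\<close>
      define t :: cmat where "t = (\<lambda>i j. if i \<in> {1..2 * n} \<and> j \<in> {1..2 * n} then
        half_sign n i * half_sign n j * y (flip n j) (flip n i) else 0)"
      have tA: "t \<in> ?A"
      proof
        show "t \<in> gl_space (2 * n)" unfolding gl_space_def t_def by auto
        show "t \<in> admissible_space (2 * n) c d"
          unfolding admissible_space_def
        proof (intro CollectI ballI impI)
          fix i j assume ij: "i \<in> {1..2 * n}" "j \<in> {1..2 * n}" "\<not> admissible c d i j"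
          have "\<not> admissible c d (flip n j) (flip n i)"
            using admissible_flip[OF c d, of "flip n j" "flip n i"] flip_simps(2) ij by metis
          then show "t i j = 0"
            using y flip_simps(1) ij unfolding t_def admissible_space_def by auto
        qed
      qed
      have t: "t (flip n j) (flip n i) = half_sign n i * half_sign n j * y i j"
        "y (flip n j) (flip n i) = half_sign n i * half_sign n j * t i j"
        if "i \<in> {1..2 * n}" "j \<in> {1..2 * n}" for i j
        using flip_simps[OF that(1)] flip_simps[OF that(2)] that by (simp_all add: t_def mult.left_commute mult.assoc)
      have "y - t \<in> ?H"
        unfolding antiskew_half_symmetric
        using mat.subspace_diff[OF A(1) y tA] t
        by (auto simp: antiskew_half_symmetric half_symmetric_def algebra_simps)
      then have 1: "pairing (2 * n) ?f (mat_commutator (2 * n) x (y - t)) = 0" by (rule ker)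
      have s: "half_symmetric n 1 (y + t)"
        using t by (simp add: half_symmetric_def algebra_simps)
      have "half_symmetric n 1 (mat_commutator (2 * n) x (y + t))"
        unfolding half_symmetric_def mat_commutator_def
        using mat_prod_half_symmetric[OF xs s] mat_prod_half_symmetric[OF s xs]
        by (auto simp: algebra_simps)
      then have 2: "pairing (2 * n) ?f (mat_commutator (2 * n) x (y + t)) = 0"
        by (rule pairing_half_symmetric[OF f])
      have "2 * pairing (2 * n) ?f (mat_commutator (2 * n) x y) =
          pairing (2 * n) ?f (mat_commutator (2 * n) x (y - t)) +
          pairing (2 * n) ?f (mat_commutator (2 * n) x (y + t))"
        by (simp add: mat_commutator_def mat_prod_simps \<phi> \<phi>_diff)
      then show "pairing (2 * n) ?f (mat_prod (2 * n) x y) = pairing (2 * n) ?f (mat_prod (2 * n) y x)"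
        unfolding 1 2 by (simp add: mat_commutator_def \<phi>_diff)
    qed
  qed
qed

theorem theorem30:
  fixes L :: "cmat lie_structure"
  assumes "type_A_seaweed L \<or> type_C_seaweed L"
  shows "contact L \<longleftrightarrow> lie_index L = 1"
  using assms type_A_contact type_C_contact unfolding type_A_seaweed_def type_C_seaweed_def by blast

end
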